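(* Let $\eta\in\Upsilon_{z_0}$, with $\mathsf{w}(\eta)=\cdots s_{i_1}s_{i_0}$ and period $N=N_\eta$. Let $(u_M,M)\in\widetilde W\times\mathbb{Z}/N\mathbb{Z}$ and $(v_M,M)\in\widehat W\times\mathbb{Z}/N\mathbb{Z}$ denote the states at time $M$ of $\widetilde{\mathbf M}_\eta$ and $\widehat{\mathbf M}_\eta$, respectively. Let \[\psi_\eta=\sum_{\substack{(w,k)\in W\times\mathbb{Z}/N\mathbb{Z}\\ i_k=0\\ w^{-1}\theta\in\Phi^+}}\zeta_\eta(w,k)\,\theta^\vee w .\] Then with probability $1$, $\lim_{M\to\infty}\langle\mathcal{A} v_M\rangle=\langle\psi_\eta\rangle$. Moreover, with probability $1$ the limit $\lim_{M\to\infty}\langle\mathcal{A} u_M\rangle$ exists and belongs to $\langle\psi_\eta\rangle W=\{\langle\psi_\eta\rangle w: w\in W\}$.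
   Context: Let $\Phi$ be a finite irreducible crystallographic root system spanning a Euclidean space $V$, with positive roots $\Phi^+$, simple roots $\{\alpha_i:i\in I\}$, highest root $\theta$, Weyl group $W$ (acting on $V$ on the left, $\beta\mapsto w\beta$) and affine Weyl group $\widetilde W$ with simple reflections $s_i$, $i\in\widetilde I=\{0\}\sqcup I$. Each root $\beta$ has a coroot $\beta^\vee\in V^*$; $Q^\vee=\mathrm{span}_{\mathbb Z}\{\beta^\vee:\beta\in\Phi\}$. For $\beta\in\Phi^+$, $k\in\mathbb Z$, let $\mathrm H_\beta^k=\{\gamma\in V^*:\gamma(\beta)=k\}$ and $\mathcal H_{\widetilde W}=\{\mathrm H_\beta^k\}$. The group $\widetilde W$ acts faithfully on $V^*$ on the right: $s_i$ ($i\in I$) acts by reflection through $\mathrm H^0_{\alpha_i}$, and $s_0$ by reflection through $\mathrm H^1_\theta$; $W=\langle s_i:i\in I\rangle\subseteq\widetilde W$. The fundamental chamber is $\mathcal C=\{\gamma\in V^*:\gamma(\alpha_i)\ge 0\ \forall i\in I\}$ and the fundamental alcove is $\mathcal A=\{\gamma\in\mathcal C:\gamma(\theta)\le1\}$; $u\mapsto\mathcal A u$ is a bijection from $\widetilde W$ to the alcoves (closures of connected components of $V^*\setminus\bigcup\mathcal H_{\widetilde W}$). For $u\in\widetilde W$ and $i\in\widetilde I$, $\mathrm H^{(u,s_i)}$ is the hyperplane of $\mathcal H_{\widetilde W}$ separating $\mathcal A u$ and $\mathcal A s_iu$. Each $w\in\widetilde W$ factors uniquely as $w=\overline w\,\tau_\xi$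 with $\overline w\in W$, $\xi\in Q^\vee$, where $\tau_\xi$ acts by $\gamma\mapsto\gamma-\xi$. Let $\widehat W=\{w\in\widetilde W:\mathcal A w\subseteq\mathcal C\}$. For nonzero $\gamma\in V^*$, $\langle\gamma\rangle=\gamma/\|\gamma\|$, and $\langle\mathcal A u\rangle$ is the unit vector pointing toward the center of $\mathcal A u$. Fix $z_0$ in the interior of $\mathcal A$ and $p\in(0,1)$. $\Upsilon_{z_0}$ is the set of $\eta\in Q^\vee\setminus\{0\}$ such that the ray from $z_0$ in direction $\eta$ passes through no intersection of two or more hyperplanes of $\mathcal H_{\widetilde W}$. For such $\eta$, if the ray passes successively through alcoves $\mathcal A u_0=\mathcal A,\mathcal A u_1,\mathcal A u_2,\dots$, let $i_j\in\widetilde I$ be defined by $u_{j+1}=s_{i_j}u_j$, and $\mathsf w(\eta)=\cdots s_{i_1}s_{i_0}$; the sequence $(i_j)$ is periodic with period $N_\eta$, and $i_k$ is read with $k\in\mathbb Z/N_\eta\mathbb Z$. $\widetilde{\mathbf M}_\eta$ (reduced random combinatorial billiard trajectory) is the Markov chain on $\widetilde W\times\mathbb Z/N_\eta\mathbb Z$ started at $(\mathbbm 1,0)$ where, from state $(u,k)$: if $\mathrm H^{(u,s_{i_k})}$ does not separate $\mathcal A u$ from $\mathcal A$, it moves to $(s_{i_k}u,k+1)$ with probability $p$ and to $(u,k+1)$ with probability $1-p$; otherwise it moves to $(u,k+1)$ with probability $1$. (This discretizes a beam of light shone from $z_0$ in direction $\eta$ that passes through each not-yet-crossed hyperplane it hits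 with probability $p$ and otherwise reflects.) $\widehat{\mathbf M}_\eta$ is the Markov chain on $\widehat W\times\mathbb Z/N_\eta\mathbb Z$ defined identically except that the move to $(s_{i_k}u,k+1)$ (with probability $p$) is allowed only if additionally $\mathcal A s_{i_k}u\subseteq\mathcal C$; otherwise it moves to $(u,k+1)$. The image of $\widehat{\mathbf M}_\eta$ under $(w,k)\mapsto(\overline w,k)$ is a Markov chain $\mathbf M_\eta$ on $W\times\mathbb Z/N_\eta\mathbb Z$, assumed irreducible; $\zeta_\eta$ denotes its stationary distribution. *)

theory Defs
  imports "HOL-Analysis.Analysis" "HOL-Probability.Probability"
begin

(* Conventions: V is a Euclidean space 'v; the dual V* is identified with V via the
   inner product, so gamma(beta) is written gamma \<bullet> beta.  Elements of the
   affine Weyl group are represented by the affine maps gamma |-> gamma u of V* (right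
   action); hence the product s_i u is represented by (u o s_i).  Simple roots are a
   set D; the index set I~ = {0} u I is  None (for 0)  and  Some a (a in D). *)

definition coroot :: "'v::euclidean_space \<Rightarrow> 'v" where
  "coroot b = (2 / (b \<bullet> b)) *\<^sub>R b"

definition nat_cone :: "'v::euclidean_space set \<Rightarrow> 'v set" where
  "nat_cone D = {x. \<exists>c::'v \<Rightarrow> nat. x = (\<Sum>a\<in>D. real (c a) *\<^sub>R a)}"

(* finite, reduced, irreducible, crystallographic root system spanning V *)
definition root_system :: "'v::euclidean_space set \<Rightarrow> bool" where
  "root_system R \<longleftrightarrow> finite R \<and> 0 \<notin> R \<and> span R = UNIV
    \<and> (\<forall>a\<in>R. \<forall>b\<in>R. b - (b \<bullet> coroot a) *\<^sub>R a \<in> R)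
    \<and> (\<forall>a\<in>R. \<forall>b\<in>R. b \<bullet> coroot a \<in> \<int>)
    \<and> (\<forall>a\<in>R. \<forall>c::real. c *\<^sub>R a \<in> R \<longrightarrow> c = 1 \<or> c = -1)
    \<and> \<not> (\<exists>A B. A \<union> B = R \<and> A \<noteq> {} \<and> B \<noteq> {} \<and> (\<forall>a\<in>A. \<forall>b\<in>B. a \<bullet> b = 0))"

definition simple_system :: "'v::euclidean_space set \<Rightarrow> 'v set \<Rightarrow> bool" where
  "simple_system R D \<longleftrightarrow> D \<subseteq> R \<and> independent D
    \<and> (\<forall>b\<in>R. b \<in> nat_cone D \<or> - b \<in> nat_cone D)"

definition pos_roots :: "'v::euclidean_space set \<Rightarrow> 'v set \<Rightarrow> 'v set" where
  "pos_roots R D = R \<inter> nat_cone D"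

definition highest_root :: "'v::euclidean_space set \<Rightarrow> 'v set \<Rightarrow> 'v" where
  "highest_root R D = (THE t. t \<in> pos_roots R D \<and> (\<forall>b\<in>pos_roots R D. t - b \<in> nat_cone D))"

(* coroot lattice Q^vee *)
definition coroot_lattice :: "'v::euclidean_space set \<Rightarrow> 'v set" where
  "coroot_lattice R = {x. \<exists>c::'v \<Rightarrow> int. x = (\<Sum>b\<in>R. of_int (c b) *\<^sub>R coroot b)}"

definition hyp :: "'v::euclidean_space \<Rightarrow> real \<Rightarrow> 'v set" where
  "hyp b k = {g. g \<bullet> b = k}"

(* the hyperplane arrangement H_{W~} *)
definition hyperplanes :: "'v::euclidean_space set \<Rightarrow> 'v set \<Rightarrow> 'v set set" where
  "hyperplanes R D = {hyp b (of_int k) | b k. b \<in> pos_roots R D}"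

(* reflection of V* through H_b^k *)
definition aff_refl :: "'v::euclidean_space \<Rightarrow> real \<Rightarrow> 'v \<Rightarrow> 'v" where
  "aff_refl b k g = g - (g \<bullet> b - k) *\<^sub>R coroot b"

definition idx :: "'v set \<Rightarrow> 'v option set" where
  "idx D = insert None (Some ` D)"

(* simple reflections s_i, i in I~ *)
definition gen :: "'v::euclidean_space set \<Rightarrow> 'v set \<Rightarrow> 'v option \<Rightarrow> 'v \<Rightarrow> 'v" where
  "gen R D i = (case i of None \<Rightarrow> aff_refl (highest_root R D) 1 | Some a \<Rightarrow> aff_refl a 0)"

inductive_set affine_weyl :: "'v::euclidean_space set \<Rightarrow> 'v set \<Rightarrow> ('v \<Rightarrow> 'v) set"
  for R D where
  "id \<in> affine_weyl R D"
| "u \<in> affine_weyl R D \<Longrightarrow> i \<in> idx D \<Longrightarrow> u \<circ> gen R D i \<in> affine_weyl R D"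

inductive_set weyl :: "'v::euclidean_space set \<Rightarrow> 'v set \<Rightarrow> ('v \<Rightarrow> 'v) set"
  for R D where
  "id \<in> weyl R D"
| "w \<in> weyl R D \<Longrightarrow> a \<in> D \<Longrightarrow> w \<circ> gen R D (Some a) \<in> weyl R D"

definition fund_chamber :: "'v::euclidean_space set \<Rightarrow> 'v set" where
  "fund_chamber D = {g. \<forall>a\<in>D. g \<bullet> a \<ge> 0}"

definition fund_alcove :: "'v::euclidean_space set \<Rightarrow> 'v set \<Rightarrow> 'v set" where
  "fund_alcove R D = {g \<in> fund_chamber D. g \<bullet> highest_root R D \<le> 1}"

(* the alcove A u *)
definition alcove :: "'v::euclidean_space set \<Rightarrow> 'v set \<Rightarrow> ('v \<Rightarrow> 'v) \<Rightarrow> 'v set" where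
  "alcove R D u = u ` fund_alcove R D"

(* w = bar w tau_xi; bar w is the linear part of the affine map *)
definition lin_part :: "('v::euclidean_space \<Rightarrow> 'v) \<Rightarrow> 'v \<Rightarrow> 'v" where
  "lin_part u = (\<lambda>g. u g - u 0)"

(* W-hat *)
definition dominant_part :: "'v::euclidean_space set \<Rightarrow> 'v set \<Rightarrow> ('v \<Rightarrow> 'v) set" where
  "dominant_part R D = {u \<in> affine_weyl R D. alcove R D u \<subseteq> fund_chamber D}"

definition separates :: "'v::euclidean_space set \<Rightarrow> 'v set \<Rightarrow> 'v set \<Rightarrow> bool" where
  "separates H X Y \<longleftrightarrow> (\<exists>b k. b \<noteq> 0 \<and> H = hyp b k \<and>
     ((X \<subseteq> {g. g \<bullet> b \<ge> k} \<and> Y \<subseteq> {g. g \<bullet> b \<le> k}) \<or>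
      (X \<subseteq> {g. g \<bullet> b \<le> k} \<and> Y \<subseteq> {g. g \<bullet> b \<ge> k})))"

(* H^{(u,s_i)} *)
definition sep_hyp :: "'v::euclidean_space set \<Rightarrow> 'v set \<Rightarrow> ('v \<Rightarrow> 'v) \<Rightarrow> 'v option \<Rightarrow> 'v set" where
  "sep_hyp R D u i = (THE H. H \<in> hyperplanes R D \<and>
      separates H (alcove R D u) (alcove R D (u \<circ> gen R D i)))"

(* centre of a simplex: barycentre of its vertices; <A u> = unit vector towards it *)
definition center :: "'v::euclidean_space set \<Rightarrow> 'v" where
  "center X = (1 / real (card {x. x extreme_point_of X})) *\<^sub>R (\<Sum>x\<in>{x. x extreme_point_of X}. x)"

definition unit_center :: "'v::euclidean_space set \<Rightarrow> 'v" where
  "unit_center X = sgn (center X)"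

(* Upsilon_{z0} *)
definition generic_dir :: "'v::euclidean_space set \<Rightarrow> 'v set \<Rightarrow> 'v \<Rightarrow> 'v \<Rightarrow> bool" where
  "generic_dir R D z0 eta \<longleftrightarrow> eta \<in> coroot_lattice R \<and> eta \<noteq> 0 \<and>
     (\<forall>t::real. t \<ge> 0 \<longrightarrow> \<not> (\<exists>H1\<in>hyperplanes R D. \<exists>H2\<in>hyperplanes R D.
        H1 \<noteq> H2 \<and> z0 + t *\<^sub>R eta \<in> H1 \<and> z0 + t *\<^sub>R eta \<in> H2))"

(* u_j with u_0 = 1, u_{j+1} = s_{i_j} u_j *)
primrec walk :: "'v::euclidean_space set \<Rightarrow> 'v set \<Rightarrow> (nat \<Rightarrow> 'v option) \<Rightarrow> nat \<Rightarrow> 'v \<Rightarrow> 'v" where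
  "walk R D i 0 = id"
| "walk R D i (Suc j) = walk R D i j \<circ> gen R D (i j)"

(* i is the sequence of walls crossed by the ray from z0 in direction eta *)
definition billiard_seq :: "'v::euclidean_space set \<Rightarrow> 'v set \<Rightarrow> 'v \<Rightarrow> 'v \<Rightarrow> (nat \<Rightarrow> 'v option) \<Rightarrow> bool" where
  "billiard_seq R D z0 eta i \<longleftrightarrow> (\<forall>j. i j \<in> idx D) \<and>
     (\<exists>t::nat \<Rightarrow> real. t 0 = 0 \<and> strict_mono t \<and>
        (\<forall>j. (\<lambda>s. z0 + s *\<^sub>R eta) ` {t j..t (Suc j)} \<subseteq> alcove R D (walk R D i j)))"

(* N_eta: the (least) period *)
definition period :: "(nat \<Rightarrow> 'a) \<Rightarrow> nat" where
  "period i = (LEAST n. n > 0 \<and> (\<forall>j. i (j + n) = i j))"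

definition tilde_allowed :: "'v::euclidean_space set \<Rightarrow> 'v set \<Rightarrow> ('v \<Rightarrow> 'v) \<Rightarrow> 'v option \<Rightarrow> bool" where
  "tilde_allowed R D u j \<longleftrightarrow>
     \<not> separates (sep_hyp R D u j) (alcove R D u) (fund_alcove R D)"

definition hat_allowed :: "'v::euclidean_space set \<Rightarrow> 'v set \<Rightarrow> ('v \<Rightarrow> 'v) \<Rightarrow> 'v option \<Rightarrow> bool" where
  "hat_allowed R D u j \<longleftrightarrow> tilde_allowed R D u j \<and>
     alcove R D (u \<circ> gen R D j) \<subseteq> fund_chamber D"

(* Trajectories of the chains driven by i.i.d. coins (coin M = True with probability p):
   the chain crosses the wall at time M iff the move is permitted and the coin is True. *)
primrec tilde_chain :: "'v::euclidean_space set \<Rightarrow> 'v set \<Rightarrow> (nat \<Rightarrow> 'v option) \<Rightarrow> nat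
    \<Rightarrow> bool stream \<Rightarrow> nat \<Rightarrow> ('v \<Rightarrow> 'v) \<times> nat" where
  "tilde_chain R D i N \<omega> 0 = (id, 0)"
| "tilde_chain R D i N \<omega> (Suc M) = (case tilde_chain R D i N \<omega> M of (u, k) \<Rightarrow>
     if tilde_allowed R D u (i k) \<and> \<omega> !! M then (u \<circ> gen R D (i k), Suc k mod N)
     else (u, Suc k mod N))"

primrec hat_chain :: "'v::euclidean_space set \<Rightarrow> 'v set \<Rightarrow> (nat \<Rightarrow> 'v option) \<Rightarrow> nat
    \<Rightarrow> bool stream \<Rightarrow> nat \<Rightarrow> ('v \<Rightarrow> 'v) \<times> nat" where
  "hat_chain R D i N \<omega> 0 = (id, 0)"
| "hat_chain R D i N \<omega> (Suc M) = (case hat_chain R D i N \<omega> M of (u, k) \<Rightarrow>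
     if hat_allowed R D u (i k) \<and> \<omega> !! M then (u \<circ> gen R D (i k), Suc k mod N)
     else (u, Suc k mod N))"

(* The projected chain M_eta on W x Z/NZ: its transition from (w,k) is the image of one
   step of W-hat-chain from any v in W-hat with bar v = w (independent of the choice). *)
definition rep :: "'v::euclidean_space set \<Rightarrow> 'v set \<Rightarrow> ('v \<Rightarrow> 'v) \<Rightarrow> ('v \<Rightarrow> 'v)" where
  "rep R D w = (SOME v. v \<in> dominant_part R D \<and> lin_part v = w)"

definition bar_trans :: "'v::euclidean_space set \<Rightarrow> 'v set \<Rightarrow> (nat \<Rightarrow> 'v option) \<Rightarrow> nat \<Rightarrow> real
    \<Rightarrow> ('v \<Rightarrow> 'v) \<times> nat \<Rightarrow> ('v \<Rightarrow> 'v) \<times> nat \<Rightarrow> real" where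
  "bar_trans R D i N p x y = (case x of (w, k) \<Rightarrow>
     (let v = rep R D w; stay = (w, Suc k mod N);
          move = (lin_part (v \<circ> gen R D (i k)), Suc k mod N) in
      if hat_allowed R D v (i k)
      then p * (if y = move then 1 else 0) + (1 - p) * (if y = stay then 1 else 0)
      else (if y = stay then 1 else 0)))"

definition bar_states :: "'v::euclidean_space set \<Rightarrow> 'v set \<Rightarrow> nat \<Rightarrow> (('v \<Rightarrow> 'v) \<times> nat) set" where
  "bar_states R D N = weyl R D \<times> {..<N}"

definition bar_irreducible :: "'v::euclidean_space set \<Rightarrow> 'v set \<Rightarrow> (nat \<Rightarrow> 'v option) \<Rightarrow> nat \<Rightarrow> real \<Rightarrow> bool" where
  "bar_irreducible R D i N p \<longleftrightarrow> (\<forall>x\<in>bar_states R D N. \<forall>y\<in>bar_states R D N.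
     (x, y) \<in> {(a, b). a \<in> bar_states R D N \<and> b \<in> bar_states R D N \<and> bar_trans R D i N p a b > 0}\<^sup>*)"

definition bar_stationary :: "'v::euclidean_space set \<Rightarrow> 'v set \<Rightarrow> (nat \<Rightarrow> 'v option) \<Rightarrow> nat \<Rightarrow> real
    \<Rightarrow> (('v \<Rightarrow> 'v) \<times> nat \<Rightarrow> real) \<Rightarrow> bool" where
  "bar_stationary R D i N p \<pi> \<longleftrightarrow> (\<forall>x. \<pi> x \<ge> 0) \<and> (\<forall>x. x \<notin> bar_states R D N \<longrightarrow> \<pi> x = 0)
     \<and> (\<Sum>x\<in>bar_states R D N. \<pi> x) = 1
     \<and> (\<forall>y\<in>bar_states R D N. (\<Sum>x\<in>bar_states R D N. \<pi> x * bar_trans R D i N p x y) = \<pi> y)"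

(* zeta_eta *)
definition zeta :: "'v::euclidean_space set \<Rightarrow> 'v set \<Rightarrow> (nat \<Rightarrow> 'v option) \<Rightarrow> nat \<Rightarrow> real
    \<Rightarrow> ('v \<Rightarrow> 'v) \<times> nat \<Rightarrow> real" where
  "zeta R D i N p = (THE \<pi>. bar_stationary R D i N p \<pi>)"

(* psi_eta.  For w in W (represented by its right action on V* = V), the left action of
   w^{-1} on V is the map w itself, so w^{-1} theta = w theta, and theta^vee w = w (coroot theta). *)
definition psi :: "'v::euclidean_space set \<Rightarrow> 'v set \<Rightarrow> (nat \<Rightarrow> 'v option) \<Rightarrow> nat \<Rightarrow> real \<Rightarrow> 'v" where
  "psi R D i N p = (\<Sum>(w, k) \<in> {(w, k) \<in> bar_states R D N. i k = None \<and>
        w (highest_root R D) \<in> pos_roots R D}.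
      zeta R D i N p (w, k) *\<^sub>R w (coroot (highest_root R D)))"

end

theory Submission
  imports Defs
begin

text \<open>
  Whether the chain on dominant alcoves may cross a wall depends only on the linear part of the
  current element, so its linear part is a finite Markov chain driven by the coins. The vertex
  \<open>v 0\<close> moves by \<open>w (coroot \<theta>)\<close> at each affine crossing, hence by ergodicity it drifts
  linearly with velocity \<open>p \<psi>\<close>, and \<open>\<psi> \<noteq> 0\<close> because it pairs positively with \<open>z0\<close>. For
  ergodicity it suffices that limit points of the empirical measures are stationary, which
  follows from a fourth moment bound for martingale transforms of the coins.

  Folding the unrestricted chain into the fundamental chamber gives exactly the dominant chain
  with the same coins. The chamber itself changes only when a linear hyperplane is crossed, and a
  crossed hyperplane is never crossed back, so it is eventually constant.
\<close>

section \<open>Root systems with a base\<close>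

text \<open>The definitions speak of separated sets and of hyperplanes picked by \<open>THE\<close>.
  All of this is reduced to signs at the single point \<open>u z0\<close>. Integrality makes the
  reduction legitimate: positive roots take values strictly between 0 and 1 at \<open>z0\<close>, so
  no hyperplane of integral level cuts an alcove. One fact goes beyond signs: adjacent alcoves are
  separated by exactly one hyperplane, which comes from a facet point lying on no other hyperplane.
  The linear part decides about a dominant step for this reason. Orient each wall by its inner
  normal. If the normal is a negative root, crossing leads away from the fundamental alcove and
  stays dominant. If it is a positive root, the level is at least 0: level 0 would lead out of the
  chamber, a higher level would lead back over a hyperplane already crossed. Since the period is a
  \<open>LEAST\<close>, that the wall sequence is periodic has to be proved from genericity of the
  ray. The same recurrence shows that the ray uses the affine reflection, without which the sum
  \<open>psi\<close> would be empty.\<close>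

lemma aff_refl_0: "aff_refl a 0 x = x - (x \<bullet> coroot a) *\<^sub>R a"
  by (simp add: aff_refl_def coroot_def)

lemma linear_aff_refl_0: "linear (aff_refl a 0)"
  unfolding aff_refl_0 by (intro linearI) (simp_all add: inner_add_left algebra_simps)

lemma inner_coroot_self: "a \<noteq> 0 \<Longrightarrow> a \<bullet> coroot a = 2"
  by (simp add: coroot_def)

lemma aff_refl_aff_refl: "a \<noteq> 0 \<Longrightarrow> aff_refl a k (aff_refl a k x) = x"
  by (simp add: aff_refl_def coroot_def inner_diff_left diff_divide_distrib add_divide_distrib
      scaleR_left_diff_distrib scaleR_left_distrib)

lemma inner_aff_refl_0: "a \<noteq> 0 \<Longrightarrow> aff_refl a 0 x \<bullet> aff_refl a 0 y = x \<bullet> y"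
  by (simp add: aff_refl_def coroot_def inner_diff_left inner_diff_right inner_commute field_simps)

lemma inner_aff_refl_self: "b \<noteq> 0 \<Longrightarrow> aff_refl b k g \<bullet> b - k = - (g \<bullet> b - k)"
  by (simp add: aff_refl_def coroot_def inner_diff_left)

lemma aff_refl_minus: "aff_refl (- b) (- k) = aff_refl b k"
  by (rule ext) (simp add: aff_refl_def coroot_def diff_divide_distrib scaleR_left_diff_distrib)

text \<open>An isometry preserves \<open>b \<bullet> b\<close>, so it commutes with
  \<open>coroot\<close>. Conjugating a reflection by a Euclidean motion then reflects in the image
  hyperplane.\<close>

lemma orthogonal_conj_aff_refl:
  fixes w :: "'v::euclidean_space \<Rightarrow> 'v"
  assumes "linear w" and inner: "\<And>x y. w x \<bullet> w y = x \<bullet> y"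
  shows "w (aff_refl b k x) + c = aff_refl (w b) (k + c \<bullet> w b) (w x + c)"
  using assms by (simp add: aff_refl_def coroot_def inner_add_left linear_diff linear_scale)

lemma finite_max_on:
  fixes f :: "'a \<Rightarrow> real"
  assumes "finite S" "x \<in> S" shows "\<exists>t\<in>S. \<forall>s\<in>S. f s \<le> f t"
proof -
  have "Max (f ` S) \<in> f ` S" using assms by (intro Max_in) auto
  then obtain t where t: "t \<in> S" "f t = Max (f ` S)" by auto
  then have "\<forall>s\<in>S. f s \<le> f t" using assms by simp
  then show ?thesis using t by blast
qed

locale based_root_system =
  fixes R D :: "'v::euclidean_space set"
  assumes rs: "root_system R" and ss: "simple_system R D"
begin

abbreviation "Pos \<equiv> pos_roots R D"

lemmas root_system_unfolded = rs[unfolded root_system_def]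

lemma finite_R: "finite R" and zero_notin_R: "0 \<notin> R" and span_R: "span R = UNIV"
  using root_system_unfolded by simp_all

lemma refl_R: assumes "a \<in> R" "b \<in> R" shows "aff_refl a 0 b \<in> R"
  using root_system_unfolded[THEN conjunct2, THEN conjunct2, THEN conjunct2, THEN conjunct1] assms
  unfolding aff_refl_0 by blast

lemma int_R: assumes "a \<in> R" "b \<in> R" shows "b \<bullet> coroot a \<in> \<int>"
  using root_system_unfolded[THEN conjunct2, THEN conjunct2, THEN conjunct2, THEN conjunct2,
      THEN conjunct1] assms by blast

lemma reduced_R: assumes "a \<in> R" "c *\<^sub>R a \<in> R" shows "c = 1 \<or> c = -1"
  using root_system_unfolded[THEN conjunct2, THEN conjunct2, THEN conjunct2, THEN conjunct2,
      THEN conjunct2, THEN conjunct1] assms by blast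

lemma irreducible_R: assumes "A \<union> B = R" "A \<noteq> {}" "B \<noteq> {}" shows "\<exists>a\<in>A. \<exists>b\<in>B. a \<bullet> b \<noteq> 0"
  using root_system_unfolded[THEN conjunct2, THEN conjunct2, THEN conjunct2, THEN conjunct2,
      THEN conjunct2, THEN conjunct2] assms by blast

lemma nonzero_R: "a \<in> R \<Longrightarrow> a \<noteq> 0"
  using zero_notin_R by blast

lemma neg_R: assumes "a \<in> R" shows "- a \<in> R"
proof -
  have "aff_refl a 0 a = - a" using nonzero_R[OF assms]
    by (simp add: aff_refl_0 inner_coroot_self scaleR_2)
  then show ?thesis using refl_R[OF assms assms] by simp
qed

lemma D_R: "a \<in> D \<Longrightarrow> a \<in> R" and indep_D: "independent D"
  and sign_R: "b \<in> R \<Longrightarrow> b \<in> nat_cone D \<or> - b \<in> nat_cone D"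
  using ss unfolding simple_system_def by blast+

lemma finite_D: "finite D"
  using finite_subset[OF _ finite_R, of D] D_R by blast

lemma nat_cone_span: "x \<in> nat_cone D \<Longrightarrow> x \<in> span D"
  unfolding nat_cone_def by (auto intro!: span_sum span_scale intro: span_base)

lemma span_D: "span D = UNIV"
proof -
  have "R \<subseteq> span D" using sign_R nat_cone_span span_neg by fastforce
  then have "span R \<subseteq> span D" by (simp add: span_minimal)
  then show ?thesis using span_R by auto
qed

section \<open>Coordinates with respect to the base\<close>

lemma ex_coweight: "\<exists>x. \<forall>a\<in>D. x \<bullet> a = f a"
proof -
  obtain g where g: "linear g" "\<forall>a\<in>D. g a = (f a :: real)"
    using linear_independent_extend[OF indep_D] by blast
  have "adjoint g 1 \<bullet> a = f a" if "a \<in> D" for a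
    using adjoint_works[OF g(1), of a 1] g(2) that by (simp add: inner_commute)
  then show ?thesis by blast
qed

text \<open>For \<open>a\<close> in \<open>D\<close> these are the fundamental coweights, the basis
  dual to \<open>D\<close>. Pairing with \<open>cw a\<close> reads off the coefficient at
  \<open>a\<close>, which turns membership in \<open>nat_cone\<close> into conditions on inner
  products.\<close>

definition cw :: "'v \<Rightarrow> 'v" where
  "cw a = (SOME x. \<forall>b\<in>D. x \<bullet> b = (if b = a then 1 else 0))"

lemma cw: "b \<in> D \<Longrightarrow> b \<bullet> cw a = (if b = a then 1 else 0)"
  using someI_ex[OF ex_coweight[of "\<lambda>b. if b = a then 1 else 0"]] unfolding cw_def
  by (auto simp: inner_commute)

lemma cw_sum: assumes "a \<in> D" shows "(\<Sum>b\<in>D. c b *\<^sub>R b) \<bullet> cw a = c a"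
proof -
  have "(\<Sum>b\<in>D. c b *\<^sub>R b) \<bullet> cw a = (\<Sum>b\<in>D. if b = a then c b else 0)"
    by (simp add: inner_sum_left cw if_distrib cong: if_cong)
  then show ?thesis using assms finite_D by (simp add: sum.delta')
qed

lemma expand: "(\<Sum>a\<in>D. (x \<bullet> cw a) *\<^sub>R a) = x"
proof -
  have "x \<in> span D" using span_D by simp
  then obtain c where c: "x = (\<Sum>b\<in>D. c b *\<^sub>R b)"
    unfolding span_finite[OF finite_D] by auto
  then have "(\<Sum>a\<in>D. (x \<bullet> cw a) *\<^sub>R a) = (\<Sum>a\<in>D. c a *\<^sub>R a)"
    by (intro sum.cong) (simp_all only: cw_sum)
  then show ?thesis by (simp only: c)
qed

lemma expand_inner: "(\<Sum>a\<in>D. (x \<bullet> cw a) * (y \<bullet> a)) = y \<bullet> x"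
  using arg_cong[OF expand[of x], of "\<lambda>v. y \<bullet> v"] by (simp add: inner_sum_right)

lemma nat_cone_iff: "x \<in> nat_cone D \<longleftrightarrow> (\<forall>a\<in>D. x \<bullet> cw a \<in> \<nat>)"
proof
  assume "x \<in> nat_cone D"
  then obtain c :: "'v \<Rightarrow> nat" where "x = (\<Sum>a\<in>D. real (c a) *\<^sub>R a)"
    unfolding nat_cone_def by blast
  then show "\<forall>a\<in>D. x \<bullet> cw a \<in> \<nat>" by (simp add: cw_sum)
next
  assume "\<forall>a\<in>D. x \<bullet> cw a \<in> \<nat>"
  then have "\<forall>a\<in>D. \<exists>n. x \<bullet> cw a = of_nat n" by (meson Nats_cases)
  from bchoice[OF this] obtain c where c: "\<forall>a\<in>D. x \<bullet> cw a = of_nat (c a)" by blast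
  have "x = (\<Sum>a\<in>D. (x \<bullet> cw a) *\<^sub>R a)" by (simp only: expand)
  also have "\<dots> = (\<Sum>a\<in>D. real (c a) *\<^sub>R a)" using c by (intro sum.cong) auto
  finally have "x = (\<Sum>a\<in>D. real (c a) *\<^sub>R a)" .
  then show "x \<in> nat_cone D" unfolding nat_cone_def by blast
qed

lemma nat_cone_nonneg: "x \<in> nat_cone D \<Longrightarrow> a \<in> D \<Longrightarrow> x \<bullet> cw a \<ge> 0"
  unfolding nat_cone_iff by (auto elim!: Nats_cases dest!: bspec)

lemma coef_Ints: "b \<in> R \<Longrightarrow> a \<in> D \<Longrightarrow> b \<bullet> cw a \<in> \<int>"
  using sign_R[of b] Nats_subset_Ints unfolding nat_cone_iff by fastforce

lemma Pos_R: "b \<in> Pos \<Longrightarrow> b \<in> R"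
  unfolding pos_roots_def by blast

lemma Pos_nonneg: "b \<in> Pos \<Longrightarrow> a \<in> D \<Longrightarrow> b \<bullet> cw a \<ge> 0"
  unfolding pos_roots_def by (blast intro: nat_cone_nonneg)

lemma Pos_cases: "b \<in> R \<Longrightarrow> b \<in> Pos \<or> - b \<in> Pos"
  unfolding pos_roots_def using sign_R neg_R by blast

text \<open>All coefficients of a root have the same weak sign, so a single strictly positive one
  decides.\<close>

lemma Pos_if_coef_pos: assumes "b \<in> R" "a \<in> D" "b \<bullet> cw a > 0" shows "b \<in> Pos"
  using Pos_cases[OF assms(1)] Pos_nonneg[of "- b" a] assms by auto

lemma D_Pos: "a \<in> D \<Longrightarrow> a \<in> Pos"
  by (rule Pos_if_coef_pos[of a a]) (simp_all add: D_R cw)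

lemma nat_cone_inner_nonneg:
  assumes "x \<in> nat_cone D" "\<And>a. a \<in> D \<Longrightarrow> y \<bullet> a \<ge> 0" shows "y \<bullet> x \<ge> 0"
  using assms sum_nonneg[of D "\<lambda>a. (x \<bullet> cw a) * (y \<bullet> a)"] nat_cone_nonneg[of x]
  by (simp add: expand_inner)

lemma ex_coef_nonzero: assumes "x \<noteq> 0" shows "\<exists>a\<in>D. x \<bullet> cw a \<noteq> 0"
proof (rule ccontr)
  assume "\<not> ?thesis"
  then have "(\<Sum>a\<in>D. (x \<bullet> cw a) *\<^sub>R a) = 0" by (intro sum.neutral) auto
  then show False using assms by (simp add: expand)
qed

lemma ex_coef_pos: assumes "b \<in> Pos" shows "\<exists>a\<in>D. b \<bullet> cw a > 0"
proof -
  obtain a where "a \<in> D" "b \<bullet> cw a \<noteq> 0" using ex_coef_nonzero nonzero_R[OF Pos_R[OF assms]] by blast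
  moreover from this have "b \<bullet> cw a \<ge> 0" using Pos_nonneg[OF assms] by blast
  ultimately show ?thesis by (intro bexI[of _ a]) auto
qed

text \<open>Otherwise \<open>b\<close> would be a multiple of \<open>a\<close>, and a reduced system
  contains only \<open>a\<close> and \<open>- a\<close> on that line. This is the only use made of
  reducedness.\<close>

lemma ex_coef_other:
  assumes "b \<in> Pos" "a \<in> D" "b \<noteq> a" shows "\<exists>c\<in>D. c \<noteq> a \<and> b \<bullet> cw c > 0"
proof -
  have "\<exists>c\<in>D. c \<noteq> a \<and> b \<bullet> cw c \<noteq> 0"
  proof (rule ccontr)
    assume "\<not> ?thesis"
    then have "(\<Sum>c\<in>D. (b \<bullet> cw c) *\<^sub>R c) = (\<Sum>c\<in>D. if c = a then (b \<bullet> cw a) *\<^sub>R a else 0)"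
      by (intro sum.cong) auto
    also have "\<dots> = (b \<bullet> cw a) *\<^sub>R a" using assms finite_D by (simp add: sum.delta')
    finally have b: "b = (b \<bullet> cw a) *\<^sub>R a" unfolding expand .
    then have "b \<bullet> cw a = 1 \<or> b \<bullet> cw a = -1"
      using reduced_R[OF D_R[OF assms(2)], of "b \<bullet> cw a"] Pos_R[OF assms(1)] by simp
    then show False using b assms Pos_nonneg[of b a] by auto
  qed
  then obtain c where c: "c \<in> D" "c \<noteq> a" "b \<bullet> cw c \<noteq> 0" by blast
  then show ?thesis using Pos_nonneg[OF assms(1), of c] by (intro bexI[of _ c]) auto
qed

text \<open>The reflection in \<open>a\<close> alters only the coefficient at \<open>a\<close>, so
  another positive coefficient survives and keeps the root positive.\<close>

lemma refl_Pos: assumes "b \<in> Pos" "a \<in> D" "b \<noteq> a" shows "aff_refl a 0 b \<in> Pos"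
proof -
  obtain c where c: "c \<in> D" "c \<noteq> a" "b \<bullet> cw c > 0" using ex_coef_other[OF assms] by blast
  have "aff_refl a 0 b \<bullet> cw c = b \<bullet> cw c"
    using c assms by (simp add: aff_refl_0 inner_diff_left cw)
  then show ?thesis
    using c refl_R[OF D_R[OF assms(2)] Pos_R[OF assms(1)]] Pos_if_coef_pos[of _ c] by simp
qed

text \<open>Expanding one factor of \<open>b \<bullet> b > 0\<close> in the base gives a sum with
  nonnegative coefficients, so some \<open>b \<bullet> a\<close> is positive.\<close>

lemma ex_descent: assumes "b \<in> Pos" shows "\<exists>a\<in>D. b \<bullet> a > 0"
proof (rule ccontr)
  assume "\<not> ?thesis"
  then have "(\<Sum>a\<in>D. (b \<bullet> cw a) * (b \<bullet> a)) \<le> 0"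
    using Pos_nonneg[OF assms] by (intro sum_nonpos mult_nonneg_nonpos) auto
  then show False using nonzero_R[OF Pos_R[OF assms]] inner_gt_zero_iff[of b]
    by (simp add: expand_inner del: inner_gt_zero_iff)
qed

section \<open>Height and induction over positive roots\<close>

definition height :: "'v \<Rightarrow> real" where "height x = (\<Sum>a\<in>D. x \<bullet> cw a)"

lemma height_diff: "height (x - y) = height x - height y"
  by (simp add: height_def inner_diff_left sum_subtractf)

lemma height_scaleR: "a \<in> D \<Longrightarrow> height (c *\<^sub>R a) = c"
  using finite_D by (simp add: height_def cw if_distrib sum.delta cong: if_cong)

lemma height_Ints: "b \<in> R \<Longrightarrow> height b \<in> \<int>"
  unfolding height_def using coef_Ints by auto

lemma height_nonneg: "x \<in> nat_cone D \<Longrightarrow> height x \<ge> 0"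
  unfolding height_def by (auto intro!: sum_nonneg nat_cone_nonneg)

lemma height_pos: assumes "x \<in> nat_cone D" "x \<noteq> 0" shows "height x > 0"
proof -
  obtain a where "a \<in> D" "x \<bullet> cw a \<noteq> 0" using ex_coef_nonzero assms by blast
  moreover from this have "x \<bullet> cw a > 0" using nat_cone_nonneg[OF assms(1), of a] by simp
  ultimately show ?thesis unfolding height_def
    by (intro sum_pos2[OF finite_D, of a]) (auto intro: nat_cone_nonneg[OF assms(1)])
qed

lemma height_refl_less: "a \<in> D \<Longrightarrow> b \<bullet> a > 0 \<Longrightarrow> height (aff_refl a 0 b) < height b"
  using nonzero_R[OF D_R] by (simp add: aff_refl_0 height_diff height_scaleR coroot_def)

text \<open>A positive root outside \<open>D\<close> is carried by a suitable simple reflection to a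
  positive root of smaller height. Heights of roots are integers, so the descent ends, and it ends
  in \<open>D\<close>.\<close>

lemma Pos_induct [consumes 1, case_names simple refl]:
  assumes b: "b \<in> Pos" and base: "\<And>a. a \<in> D \<Longrightarrow> P a"
    and step: "\<And>a c. a \<in> D \<Longrightarrow> c \<in> Pos \<Longrightarrow> P c \<Longrightarrow> P (aff_refl a 0 c)"
  shows "P b"
  using b
proof (induction "nat \<lfloor>height b\<rfloor>" arbitrary: b rule: less_induct)
  case less
  show ?case
  proof (cases "b \<in> D")
    case False
    obtain a where a: "a \<in> D" "b \<bullet> a > 0" using ex_descent less.prems by blast
    let ?c = "aff_refl a 0 b"
    have c: "?c \<in> Pos" using refl_Pos less.prems a False by blast
    have "height ?c \<ge> 0" using c unfolding pos_roots_def by (blast intro: height_nonneg)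
    moreover have "height ?c < height b" using height_refl_less a by blast
    ultimately have "nat \<lfloor>height ?c\<rfloor> < nat \<lfloor>height b\<rfloor>"
      using height_Ints[OF Pos_R[OF c]] height_Ints[OF Pos_R[OF less.prems]]
      by (auto elim!: Ints_cases)
    then have "P ?c" using less.hyps c by blast
    then have "P (aff_refl a 0 ?c)" using step a c by blast
    then show ?thesis using aff_refl_aff_refl[OF nonzero_R[OF D_R[OF a(1)]]] by simp
  qed (use base in blast)
qed

text \<open>The coefficient at \<open>a\<close> of the positive root \<open>aff_refl a 0 b\<close>
  is \<open>- (b \<bullet> coroot a)\<close>.\<close>

lemma simple_obtuse: assumes "a \<in> D" "b \<in> D" "a \<noteq> b" shows "b \<bullet> a \<le> 0"
proof -
  have "aff_refl a 0 b \<in> Pos" using refl_Pos D_Pos assms by blast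
  then have "aff_refl a 0 b \<bullet> cw a \<ge> 0" using Pos_nonneg assms by blast
  then have "b \<bullet> coroot a \<le> 0" using assms by (simp add: aff_refl_0 inner_diff_left cw)
  moreover have "a \<bullet> a > 0" using nonzero_R[OF D_R[OF assms(1)]] by simp
  ultimately show ?thesis by (simp add: coroot_def field_simps)
qed

text \<open>The product of the two Cartan integers is less than 4, so one of them is 1.\<close>

lemma diff_R: assumes "a \<in> R" "b \<in> R" "a \<bullet> b > 0" "a \<noteq> b" shows "a - b \<in> R"
proof -
  have nz: "a \<noteq> 0" "b \<noteq> 0" using assms nonzero_R by auto
  obtain m n where m: "b \<bullet> coroot a = of_int m" and n: "a \<bullet> coroot b = of_int n"
    using int_R assms by (meson Ints_cases)
  have pos: "a \<bullet> a > 0" "b \<bullet> b > 0" using nz by auto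
  have "real_of_int m > 0" "real_of_int n > 0" using pos assms
    by (simp_all add: m[symmetric] n[symmetric] coroot_def inner_commute)
  then have mn0: "m > 0" "n > 0" by auto
  have "\<not> (m \<ge> 2 \<and> n \<ge> 2)"
  proof
    assume "m \<ge> 2 \<and> n \<ge> 2"
    then have "2 \<le> real_of_int m" "2 \<le> real_of_int n" by auto
    then have "a \<bullet> a \<le> a \<bullet> b" "b \<bullet> b \<le> a \<bullet> b" using pos
      unfolding m[symmetric] n[symmetric] by (simp_all add: coroot_def inner_commute field_simps)
    then have "(a - b) \<bullet> (a - b) \<le> 0" by (simp add: inner_diff_left inner_diff_right inner_commute)
    then show False using assms(4) inner_gt_zero_iff[of "a - b"] by (simp del: inner_gt_zero_iff)
  qed
  then consider "m = 1" | "n = 1" using mn0 by linarith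
  then show ?thesis
  proof cases
    case 1
    then have "aff_refl a 0 b = b - a" by (simp add: aff_refl_0 m)
    then show ?thesis using refl_R[OF assms(1,2)] neg_R[of "b - a"] by simp
  next
    case 2
    then have "aff_refl b 0 a = a - b" by (simp add: aff_refl_0 n)
    then show ?thesis using refl_R[OF assms(2,1)] by simp
  qed
qed

section \<open>Existence and uniqueness of the highest root\<close>

definition maximal_root :: "'v \<Rightarrow> bool" where
  "maximal_root t \<longleftrightarrow> t \<in> Pos \<and> (\<forall>b\<in>Pos. b - t \<in> nat_cone D \<longrightarrow> b = t)"

lemma nat_cone_add: "x \<in> nat_cone D \<Longrightarrow> y \<in> nat_cone D \<Longrightarrow> x + y \<in> nat_cone D"
  unfolding nat_cone_iff by (simp add: inner_add_left)

lemma ex_maximal_root: assumes "b \<in> Pos" shows "\<exists>t. maximal_root t \<and> t - b \<in> nat_cone D"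
proof -
  let ?S = "{t \<in> Pos. t - b \<in> nat_cone D}"
  have "finite ?S" using finite_R unfolding pos_roots_def by auto
  moreover have "b \<in> ?S" using assms by (auto simp: nat_cone_iff)
  ultimately obtain t where t: "t \<in> ?S" "\<forall>s\<in>?S. height s \<le> height t"
    using finite_max_on[where f = height] by blast
  have "maximal_root t" unfolding maximal_root_def
  proof (intro conjI ballI impI)
    fix c assume c: "c \<in> Pos" "c - t \<in> nat_cone D"
    then have "c \<in> ?S" using nat_cone_add[of "c - t" "t - b"] t by simp
    then have "height c \<le> height t" using t by blast
    then show "c = t" using height_pos[of "c - t"] c by (force simp: height_diff)
  qed (use t in blast)
  then show ?thesis using t by blast
qed

text \<open>If \<open>t \<bullet> a\<close> were negative, reflecting in \<open>a\<close> would add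
  a positive multiple of \<open>a\<close> and contradict maximality.\<close>

lemma maximal_root_dominant: assumes "maximal_root t" "a \<in> D" shows "t \<bullet> a \<ge> 0"
proof (rule ccontr)
  assume neg: "\<not> ?thesis"
  have t: "t \<in> Pos" using assms maximal_root_def by blast
  have na: "a \<noteq> 0" using nonzero_R D_R assms by blast
  have "t \<noteq> a" using neg by auto
  then have s: "aff_refl a 0 t \<in> Pos" using refl_Pos t assms by blast
  obtain m where m: "t \<bullet> coroot a = of_int m" using int_R D_R assms t Pos_R by (meson Ints_cases)
  have "t \<bullet> coroot a < 0" using neg na by (simp add: coroot_def divide_less_0_iff mult_less_0_iff)
  then have m0: "m < 0" using m by simp
  have "aff_refl a 0 t - t = real (nat (- m)) *\<^sub>R a" using m m0 by (simp add: aff_refl_0)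
  then have "aff_refl a 0 t - t \<in> nat_cone D" using assms unfolding nat_cone_iff by (simp add: cw)
  then have "aff_refl a 0 t = t" using s assms unfolding maximal_root_def by blast
  then show False using m m0 na by (simp add: aff_refl_0)
qed

text \<open>Let \<open>J\<close> be the support of \<open>t\<close> and \<open>K\<close> its
  complement in \<open>D\<close>. Dominance together with obtuse angles makes \<open>J\<close> and
  \<open>K\<close> orthogonal, so every root lies in one of the two spans, and irreducibility leaves
  no room for a nonempty \<open>K\<close>.\<close>

lemma maximal_root_full_support: assumes t: "maximal_root t" and "a \<in> D" shows "t \<bullet> cw a > 0"
proof -
  have tP: "t \<in> Pos" using t maximal_root_def by blast
  define J where "J = {a \<in> D. t \<bullet> cw a > 0}"
  define K where "K = {a \<in> D. t \<bullet> cw a = 0}"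
  have D: "D = J \<union> K" unfolding J_def K_def using Pos_nonneg[OF tP] by force
  have "a \<bullet> b = 0" if a: "a \<in> K" and b: "b \<in> J" for a b
  proof -
    have aD: "a \<in> D" and bD: "b \<in> D" using a b unfolding J_def K_def by auto
    have le: "(t \<bullet> cw c) * (a \<bullet> c) \<le> 0" if "c \<in> D" for c
      using that a simple_obtuse[of c a] aD Pos_nonneg[OF tP, of c] unfolding K_def
      by (cases "c = a") (auto intro: mult_nonneg_nonpos)
    \<comment> \<open>Dominance bounds the expansion of \<open>a \<bullet> t\<close> from below by
      0, while every term is at most 0, so each term vanishes. Terms at indices in \<open>J\<close>
      have a positive coefficient.\<close>
    have "0 \<le> a \<bullet> t" using maximal_root_dominant[OF t aD] by (simp add: inner_commute)
    then have "0 \<le> (\<Sum>c\<in>D. (t \<bullet> cw c) * (a \<bullet> c))" by (simp add: expand_inner)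
    then have "(\<Sum>c\<in>D. (t \<bullet> cw c) * (a \<bullet> c)) = 0" using le by (intro order.antisym sum_nonpos)
    then have "(t \<bullet> cw b) * (a \<bullet> b) = 0"
      using sum_nonneg_eq_0_iff[OF finite_D, of "\<lambda>c. - ((t \<bullet> cw c) * (a \<bullet> c))"] le bD
      by (simp add: sum_negf)
    then show ?thesis using b unfolding J_def by simp
  qed
  then have orthJK: "orthogonal a b" if "a \<in> K" "b \<in> J" for a b
    using that by (simp add: orthogonal_def)
  have orth: "x \<bullet> y = 0" if "x \<in> span K" "y \<in> span J" for x y
  proof -
    have "orthogonal x b" if "b \<in> J" for b
      using orthogonal_to_span[OF \<open>x \<in> span K\<close>, of b] orthJK that
      by (simp add: orthogonal_commute)
    then show ?thesis using orthogonal_to_span[OF \<open>y \<in> span J\<close>, of x]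
      by (simp add: orthogonal_def)
  qed
  have refl_fix: "aff_refl a 0 b = b" if "a \<bullet> b = 0" for a b
    using that by (simp add: aff_refl_0 coroot_def inner_commute)
  have refl_span: "aff_refl a 0 b \<in> span S" if "a \<in> S" "b \<in> span S" for a b S
    using that unfolding aff_refl_0 by (intro span_diff span_scale) (auto intro: span_base)
  \<comment> \<open>The dichotomy survives simple reflections: a reflection from the same part
    preserves its span, one from the other part fixes the root.\<close>
  have split: "b \<in> span J \<or> b \<in> span K" if "b \<in> Pos" for b
    using that
  proof (induction b rule: Pos_induct)
    case (simple a)
    then show ?case using D span_base by blast
  next
    case (refl a c)
    consider "a \<in> J" "c \<in> span J" | "a \<in> K" "c \<in> span K" | "a \<in> J" "c \<in> span K" | "a \<in> K" "c \<in> span J"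
      using refl D by blast
    then show ?case
    proof cases
      case 3
      then have "aff_refl a 0 c = c" using orth[of c a] by (intro refl_fix) (simp add: span_base inner_commute)
      then show ?thesis using 3 by simp
    next
      case 4
      then have "aff_refl a 0 c = c" using orth[of a c] by (intro refl_fix) (simp add: span_base)
      then show ?thesis using 4 by simp
    qed (use refl_span in blast)+
  qed
  then have "b \<in> span J \<or> b \<in> span K" if "b \<in> R" for b
    using Pos_cases[OF that] span_neg[of "- b"] by fastforce
  then have RR: "(R \<inter> span K) \<union> (R \<inter> span J) = R" by blast
  obtain c where "c \<in> J" using ex_coef_pos[OF tP] J_def by blast
  then have "c \<in> R \<inter> span J" using span_base D D_R by blast
  then have "R \<inter> span K = {}" using irreducible_R[OF RR] orth by blast
  then have "K = {}" using D D_R span_base by blast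
  then show ?thesis using assms D unfolding J_def by blast
qed

text \<open>Full support of one and dominance of the other make \<open>s \<bullet> t\<close>
  positive, so the difference of distinct maximal roots would be a root. Roots have a sign, so
  \<open>s\<close> and \<open>t\<close> would be comparable.\<close>

lemma maximal_root_unique: assumes s: "maximal_root s" and t: "maximal_root t" shows "s = t"
proof (rule ccontr)
  assume ne: "s \<noteq> t"
  have P: "s \<in> Pos" "t \<in> Pos" using s t maximal_root_def by auto
  obtain a where a: "a \<in> D" "t \<bullet> a > 0" using ex_descent P by blast
  have "(\<Sum>a\<in>D. (s \<bullet> cw a) * (t \<bullet> a)) > 0"
  proof (rule sum_pos2[OF finite_D a(1)])
    show "0 < (s \<bullet> cw a) * (t \<bullet> a)" using a maximal_root_full_support s by simp
    show "0 \<le> (s \<bullet> cw b) * (t \<bullet> b)" if "b \<in> D" for b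
      using that maximal_root_full_support[OF s] maximal_root_dominant[OF t] by (simp add: less_imp_le)
  qed
  then have "s \<bullet> t > 0" by (simp add: expand_inner inner_commute[of s t])
  then have "s - t \<in> R" using diff_R P Pos_R ne by blast
  then have "s - t \<in> nat_cone D \<or> t - s \<in> nat_cone D" using sign_R by fastforce
  then show False using s t P ne unfolding maximal_root_def by blast
qed

abbreviation "\<theta> \<equiv> highest_root R D"

lemma highest_root: "\<theta> \<in> Pos \<and> (\<forall>b\<in>Pos. \<theta> - b \<in> nat_cone D)"
proof -
  have "R \<noteq> {}" using span_R UNIV_not_singleton[of "0::'v"] by auto
  then obtain b0 where b0: "b0 \<in> Pos" using Pos_cases by blast
  obtain t where t: "maximal_root t" using ex_maximal_root[OF b0] by blast
  have tt: "t \<in> Pos \<and> (\<forall>b\<in>Pos. t - b \<in> nat_cone D)"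
    using ex_maximal_root maximal_root_unique[OF t] t unfolding maximal_root_def by blast
  moreover have "s = t" if "s \<in> Pos \<and> (\<forall>b\<in>Pos. s - b \<in> nat_cone D)" for s
    using that t unfolding maximal_root_def by blast
  ultimately show ?thesis unfolding highest_root_def
    by (rule theI2) 
qed

end

section \<open>Weyl groups and alcoves\<close>

text \<open>\<open>separates\<close> uses weak inequalities, so it yields only a point of the
  hyperplane on the segment. This suffices for the later arguments, where the endpoints lie off the
  hyperplane.\<close>

lemma separates_segment:
  assumes "separates H X Y" "x \<in> X" "y \<in> Y" shows "\<exists>z\<in>closed_segment x y. z \<in> H"
proof -
  obtain b k where H: "H = hyp b k" and s: "x \<bullet> b \<ge> k \<and> y \<bullet> b \<le> k \<or> x \<bullet> b \<le> k \<and> y \<bullet> b \<ge> k"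
    using assms unfolding separates_def by blast
  show ?thesis
  proof (cases "x \<bullet> b = y \<bullet> b")
    case True
    then have "x \<in> H" using s H by (auto simp: hyp_def)
    then show ?thesis by (intro bexI[of _ x]) auto
  next
    case False
    \<comment> \<open>The parameter at which the affine function \<open>g \<bullet> b - k\<close>
      vanishes on the segment.\<close>
    define t where "t = (x \<bullet> b - k) / (x \<bullet> b - y \<bullet> b)"
    have "0 \<le> t" "t \<le> 1" using s False unfolding t_def by (auto simp: field_simps)
    moreover have "t * (x \<bullet> b - y \<bullet> b) = x \<bullet> b - k" using False unfolding t_def by simp
    then have "((1 - t) *\<^sub>R x + t *\<^sub>R y) \<bullet> b = k"
      by (simp add: inner_add_left algebra_simps)
    ultimately show ?thesis unfolding H hyp_def closed_segment_def by blast
  qed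
qed

lemma closed_segment_halfspace_gt:
  assumes "z \<in> closed_segment x y" "x \<bullet> b > k" "y \<bullet> b > k" shows "z \<bullet> b > (k :: real)"
proof -
  have "convex {z. b \<bullet> z > k}" by (rule convex_halfspace_gt)
  then have "closed_segment x y \<subseteq> {z. b \<bullet> z > k}"
    using assms by (intro closed_segment_subset) (auto simp: inner_commute)
  then show ?thesis using assms by (auto simp: inner_commute)
qed

lemma hyp_uminus: "hyp (- b) (- k) = hyp b k"
  unfolding hyp_def by auto

lemma weyl_comp: "w \<in> weyl R D \<Longrightarrow> v \<in> weyl R D \<Longrightarrow> v \<circ> w \<in> weyl R D"
  by (induction rule: weyl.induct) (auto simp: comp_assoc[symmetric] intro: weyl.intros)

lemma affine_weyl_comp:
  "u \<in> affine_weyl R D \<Longrightarrow> v \<in> affine_weyl R D \<Longrightarrow> v \<circ> u \<in> affine_weyl R D"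
  by (induction rule: affine_weyl.induct) (auto simp: comp_assoc[symmetric] intro: affine_weyl.intros)

lemma weyl_affine: "w \<in> weyl R D \<Longrightarrow> w \<in> affine_weyl R D"
  by (induction rule: weyl.induct) (auto intro: affine_weyl.intros simp: idx_def simp del: id_apply comp_apply)

text \<open>Inner normals of the fundamental alcove. With \<open>- \<theta>\<close> and level
  \<open>- 1\<close> for the affine wall, the alcove is cut out by inequalities of one shape, and no
  case distinction between the affine and the linear reflections is needed.\<close>

definition wall_root :: "'v::euclidean_space set \<Rightarrow> 'v set \<Rightarrow> 'v option \<Rightarrow> 'v" where
  "wall_root R D i = (case i of None \<Rightarrow> - highest_root R D | Some a \<Rightarrow> a)"

definition wall_level :: "'v option \<Rightarrow> real" where
  "wall_level i = (case i of None \<Rightarrow> - 1 | Some a \<Rightarrow> 0)"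

lemma gen_wall: "gen R D i = aff_refl (wall_root R D i) (wall_level i)"
  by (auto simp: gen_def wall_root_def wall_level_def aff_refl_minus split: option.split)

lemma wall_level_Ints: "wall_level i \<in> \<int>"
  by (auto simp: wall_level_def split: option.split)

lemma fund_alcove_wall:
  "x \<in> fund_alcove R D \<longleftrightarrow> (\<forall>i\<in>idx D. x \<bullet> wall_root R D i \<ge> wall_level i)"
  by (auto simp: fund_alcove_def fund_chamber_def idx_def wall_root_def wall_level_def)

context based_root_system
begin

section \<open>The Weyl group as a finite group of isometries\<close>

lemma weyl_refl_D: "a \<in> D \<Longrightarrow> aff_refl a 0 \<in> weyl R D"
  using weyl.intros(2)[OF weyl.intros(1), of a D R] by (simp add: gen_def)

text \<open>\<open>weyl\<close> is generated as a monoid; inverses exist because the generators are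
  involutions.\<close>

lemma weyl_props:
  "w \<in> weyl R D \<Longrightarrow> linear w \<and> (\<forall>x y. w x \<bullet> w y = x \<bullet> y) \<and> (\<forall>b\<in>R. w b \<in> R)
     \<and> (\<exists>w'\<in>weyl R D. w \<circ> w' = id \<and> w' \<circ> w = id)"
proof (induction rule: weyl.induct)
  case 1
  show ?case using weyl.intros(1)[of R D] linear_id[where 'a = 'v] by (auto simp: id_def)
next
  case (2 w a)
  note IH = "2.IH"
  have na: "a \<noteq> 0" using nonzero_R D_R 2 by blast
  have g: "gen R D (Some a) = aff_refl a 0" by (simp add: gen_def)
  obtain w' where w': "w' \<in> weyl R D" "w \<circ> w' = id" "w' \<circ> w = id" using 2 by blast
  have 1: "(w \<circ> aff_refl a 0) \<circ> (aff_refl a 0 \<circ> w') = id"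
    using w'(2) aff_refl_aff_refl[OF na] by (simp add: fun_eq_iff)
  have 2: "(aff_refl a 0 \<circ> w') \<circ> (w \<circ> aff_refl a 0) = id"
    using w'(3) aff_refl_aff_refl[OF na] by (simp add: fun_eq_iff)
  have "aff_refl a 0 \<circ> w' \<in> weyl R D" using w' weyl_refl_D 2 weyl_comp \<open>a \<in> D\<close> by blast
  then have "\<exists>w'\<in>weyl R D. (w \<circ> aff_refl a 0) \<circ> w' = id \<and> w' \<circ> (w \<circ> aff_refl a 0) = id"
    using 1 2 by blast
  moreover have "linear (w \<circ> aff_refl a 0)" using linear_compose[OF linear_aff_refl_0, of w a] IH by blast
  moreover have "(w \<circ> aff_refl a 0) x \<bullet> (w \<circ> aff_refl a 0) y = x \<bullet> y" for x y
    using IH inner_aff_refl_0[OF na] by simp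
  moreover have "(w \<circ> aff_refl a 0) b \<in> R" if "b \<in> R" for b
    using IH refl_R[OF D_R[OF \<open>a \<in> D\<close>] that] by simp
  ultimately show ?case unfolding g by blast
qed

lemma weyl_linear: "w \<in> weyl R D \<Longrightarrow> linear w"
  and weyl_inner: "w \<in> weyl R D \<Longrightarrow> w x \<bullet> w y = x \<bullet> y"
  and weyl_R: "w \<in> weyl R D \<Longrightarrow> b \<in> R \<Longrightarrow> w b \<in> R"
  using weyl_props[of w] by simp_all

lemma weyl_inverse:
  assumes "w \<in> weyl R D"
  obtains w' where "w' \<in> weyl R D" "\<And>x. w (w' x) = x" "\<And>x. w' (w x) = x"
proof -
  obtain w' where "w' \<in> weyl R D" "w \<circ> w' = id" "w' \<circ> w = id" using weyl_props[OF assms] by blast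
  then show ?thesis using that[of w'] by (simp add: fun_eq_iff)
qed

text \<open>Every positive root is reached from a simple one by simple reflections, and each of
  these conjugates the reflection accordingly.\<close>

lemma weyl_refl_Pos: assumes "b \<in> Pos" shows "aff_refl b 0 \<in> weyl R D"
  using assms
proof (induction b rule: Pos_induct)
  case (simple a)
  then show ?case using weyl_refl_D by blast
next
  case (refl a c)
  have na: "a \<noteq> 0" using nonzero_R D_R refl by blast
  let ?s = "aff_refl a 0"
  have "aff_refl (?s c) 0 = ?s \<circ> aff_refl c 0 \<circ> ?s"
  proof
    fix x
    show "aff_refl (?s c) 0 x = (?s \<circ> aff_refl c 0 \<circ> ?s) x"
      using orthogonal_conj_aff_refl[OF linear_aff_refl_0 inner_aff_refl_0[OF na], of c 0 "?s x" 0]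
      by (simp add: aff_refl_aff_refl[OF na])
  qed
  then show ?case using refl weyl_refl_D weyl_comp by metis
qed

lemma weyl_refl: "b \<in> R \<Longrightarrow> aff_refl b 0 \<in> weyl R D"
  using Pos_cases[of b] weyl_refl_Pos[of b] weyl_refl_Pos[of "- b"] aff_refl_minus[of b 0] by auto

text \<open>An element is determined by the map it induces on the finite spanning set
  \<open>R\<close>.\<close>

lemma finite_weyl: "finite (weyl R D)"
proof -
  have "inj_on (\<lambda>w. restrict w R) (weyl R D)"
  proof (rule inj_onI)
    fix v w assume v: "v \<in> weyl R D" and w: "w \<in> weyl R D" and eq: "restrict v R = restrict w R"
    have "v b = w b" if "b \<in> R" for b using eq that by (metis restrict_apply')
    then have "v x = w x" for x
      using linear_eq_on_span[OF weyl_linear[OF v] weyl_linear[OF w], of R x] span_R by auto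
    then show "v = w" by auto
  qed
  moreover have "(\<lambda>w. restrict w R) ` weyl R D \<subseteq> R \<rightarrow>\<^sub>E R" using weyl_R by auto
  ultimately show ?thesis
    using finite_PiE[OF finite_R, of "\<lambda>_. R"] finite_R by (meson finite_imageD finite_subset)
qed

text \<open>The translation parts are controlled in this lattice, which contains the coroot lattice.
  Integral values on roots are all that the arguments need, and this property is visibly stable
  under the Weyl group.\<close>

definition coweights :: "'v set" where "coweights = {x. \<forall>b\<in>R. x \<bullet> b \<in> \<int>}"

lemma coweights_add: "x \<in> coweights \<Longrightarrow> y \<in> coweights \<Longrightarrow> x + y \<in> coweights"
  unfolding coweights_def by (simp add: inner_add_left)

lemma weyl_coweights: assumes "w \<in> weyl R D" "x \<in> coweights" shows "w x \<in> coweights"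
proof -
  obtain w' where w': "w' \<in> weyl R D" "\<And>x. w (w' x) = x" using weyl_inverse assms by metis
  have "w x \<bullet> b = x \<bullet> w' b" for b using weyl_inner[OF assms(1), of x "w' b"] w'(2) by simp
  then show ?thesis using assms(2) weyl_R[OF w'(1)] unfolding coweights_def by auto
qed

lemma coroot_coweights: "b \<in> R \<Longrightarrow> coroot b \<in> coweights"
  unfolding coweights_def using int_R by (auto simp: inner_commute)

lemma coroot_lattice_coweights: assumes "x \<in> coroot_lattice R" shows "x \<in> coweights"
proof -
  obtain c :: "'v \<Rightarrow> int" where "x = (\<Sum>b\<in>R. of_int (c b) *\<^sub>R coroot b)"
    using assms unfolding coroot_lattice_def by blast
  then show ?thesis using coroot_coweights unfolding coweights_def
    by (auto simp: inner_sum_left intro!: Ints_sum Ints_mult)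
qed

lemma \<theta>_R: "\<theta> \<in> R" and \<theta>_Pos: "\<theta> \<in> Pos"
  using highest_root Pos_R by blast+

lemma wall_root_R: "i \<in> idx D \<Longrightarrow> wall_root R D i \<in> R"
  using \<theta>_R neg_R D_R by (auto simp: wall_root_def idx_def)

lemma affine_weyl_split:
  "u \<in> affine_weyl R D \<Longrightarrow> \<exists>w\<in>weyl R D. \<exists>c\<in>coweights. u = (\<lambda>g. w g + c)"
proof (induction rule: affine_weyl.induct)
  case 1
  have "(0::'v) \<in> coweights" "id = (\<lambda>g::'v. id g + 0)" by (auto simp: coweights_def)
  then show ?case using weyl.intros(1)[of R D] by blast
next
  case (2 u i)
  obtain w c where w: "w \<in> weyl R D" and c: "c \<in> coweights" and u: "u = (\<lambda>g. w g + c)"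
    using 2 by blast
  let ?b = "wall_root R D i" and ?k = "wall_level i"
  have b: "?b \<in> R" using wall_root_R 2 by blast
  have g: "gen R D i g = aff_refl ?b 0 g + ?k *\<^sub>R coroot ?b" for g
    by (simp add: gen_wall aff_refl_def scaleR_left_diff_distrib)
  have "?k *\<^sub>R coroot ?b \<in> coweights"
    using coroot_coweights[OF b] wall_level_Ints[of i] unfolding coweights_def by auto
  then have "w (?k *\<^sub>R coroot ?b) + c \<in> coweights" using coweights_add weyl_coweights w c by blast
  moreover have "w \<circ> aff_refl ?b 0 \<in> weyl R D" using weyl_comp weyl_refl b w by blast
  moreover have "u \<circ> gen R D i = (\<lambda>g. (w \<circ> aff_refl ?b 0) g + (w (?k *\<^sub>R coroot ?b) + c))"
    using linear_add[OF weyl_linear[OF w]] by (auto simp: u g)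
  ultimately show ?case by blast
qed

section \<open>Linear part, translation part and walls of an alcove\<close>

context
  fixes u assumes u: "u \<in> affine_weyl R D"
begin

lemma lin_part_weyl: "lin_part u \<in> weyl R D" and origin_coweights: "u 0 \<in> coweights"
  and affine_eq: "u x = lin_part u x + u 0"
proof -
  obtain w c where w: "w \<in> weyl R D" and c: "c \<in> coweights" and uu: "u = (\<lambda>g. w g + c)"
    using affine_weyl_split[OF u] by blast
  have "w 0 = 0" using linear_0 weyl_linear w by blast
  then have "lin_part u = w" "u 0 = c" unfolding uu lin_part_def by auto
  then show "lin_part u \<in> weyl R D" "u 0 \<in> coweights" "u x = lin_part u x + u 0"
    using w c uu by auto
qed

lemma lin_part_linear: "linear (lin_part u)" and lin_part_inner: "lin_part u x \<bullet> lin_part u y = x \<bullet> y"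
  and lin_part_R: "b \<in> R \<Longrightarrow> lin_part u b \<in> R"
  using weyl_linear weyl_inner weyl_R lin_part_weyl by simp_all

lemma affine_gen: "i \<in> idx D \<Longrightarrow> u \<circ> gen R D i \<in> affine_weyl R D"
  using u affine_weyl.intros(2) by blast

text \<open>Inner normal and level of the wall of \<open>alcove R D u\<close> that carries the label
  \<open>i\<close>: the images under \<open>u\<close> of the data of the fundamental alcove.\<close>

abbreviation "wroot i \<equiv> lin_part u (wall_root R D i)"
abbreviation "wlevel i \<equiv> wall_level i + u 0 \<bullet> lin_part u (wall_root R D i)"

text \<open>Multiplying by a generator on the side of the alcove labels amounts to reflecting in the
  corresponding wall of the current alcove.\<close>

lemma affine_gen_apply: "u (gen R D i x) = aff_refl (wroot i) (wlevel i) (u x)"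
proof -
  have "u (gen R D i x) = lin_part u (gen R D i x) + u 0" by (rule affine_eq)
  also have "\<dots> = aff_refl (wroot i) (wlevel i) (lin_part u x + u 0)"
    unfolding gen_wall by (rule orthogonal_conj_aff_refl[OF lin_part_linear lin_part_inner])
  finally show ?thesis using affine_eq[of x] by simp
qed

lemma affine_wall_value: "u x \<bullet> wroot i - wlevel i = x \<bullet> wall_root R D i - wall_level i"
  by (subst affine_eq) (simp add: inner_add_left lin_part_inner)

lemma wroot_R: "i \<in> idx D \<Longrightarrow> wroot i \<in> R"
  using lin_part_R wall_root_R by blast

lemma wlevel_Ints: "i \<in> idx D \<Longrightarrow> wlevel i \<in> \<int>"
  using wroot_R origin_coweights wall_level_Ints[of i] unfolding coweights_def by auto

lemma affine_inner_root:
  assumes "b \<in> R"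
  obtains b' where "b' \<in> R" "b = lin_part u b'" "\<And>x. u x \<bullet> b = x \<bullet> b' + u 0 \<bullet> b"
proof -
  obtain w' where w': "w' \<in> weyl R D" "\<And>x. lin_part u (w' x) = x"
    using weyl_inverse[OF lin_part_weyl] by metis
  have "u x \<bullet> b = x \<bullet> w' b + u 0 \<bullet> b" for x
    using lin_part_inner[of x "w' b"] affine_eq[of x] w'(2) by (simp add: inner_add_left)
  then show ?thesis using that[OF weyl_R[OF w'(1) assms] w'(2)[symmetric]] by blast
qed

lemma lin_part_comp_gen:
  assumes "i \<in> idx D" shows "lin_part (u \<circ> gen R D i) = lin_part u \<circ> aff_refl (wall_root R D i) 0"
proof
  fix x
  have "gen R D i x = aff_refl (wall_root R D i) 0 x + gen R D i 0"
    by (simp add: gen_wall aff_refl_def scaleR_left_diff_distrib)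
  then have "u (gen R D i x) = lin_part u (aff_refl (wall_root R D i) 0 x) + lin_part u (gen R D i 0) + u 0"
    using affine_eq[of "gen R D i x"] linear_add[OF lin_part_linear] by simp
  then show "lin_part (u \<circ> gen R D i) x = (lin_part u \<circ> aff_refl (wall_root R D i) 0) x"
    using affine_eq[of "gen R D i 0"] unfolding lin_part_def[of "u \<circ> gen R D i"] by simp
qed

end

lemma fund_alcove_inner:
  assumes "x \<in> fund_alcove R D" "b \<in> Pos" shows "0 \<le> x \<bullet> b" "x \<bullet> b \<le> 1"
proof -
  have nn: "x \<bullet> a \<ge> 0" if "a \<in> D" for a
    using assms that unfolding fund_alcove_def fund_chamber_def by blast
  show "0 \<le> x \<bullet> b" using nat_cone_inner_nonneg[of b x] nn assms unfolding pos_roots_def by blast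
  have "x \<bullet> (\<theta> - b) \<ge> 0" using nat_cone_inner_nonneg[of "\<theta> - b" x] nn highest_root assms by blast
  then show "x \<bullet> b \<le> 1" using assms unfolding fund_alcove_def by (simp add: inner_diff_right)
qed

text \<open>A point in the relative interior of the facet \<open>i\<close> that no other hyperplane
  contains. The two alternatives are the two ways, \<open>(b, m)\<close> and
  \<open>(- b, - m)\<close>, of describing the same hyperplane.\<close>

lemma ex_facet_point:
  assumes i: "i \<in> idx D"
  shows "\<exists>x\<in>fund_alcove R D. x \<bullet> wall_root R D i = wall_level i \<and>
    (\<forall>b\<in>R. \<forall>m\<in>\<int>. x \<bullet> b = m \<longrightarrow> b = wall_root R D i \<and> m = wall_level i \<or>
       b = - wall_root R D i \<and> m = - wall_level i)"
proof -
  let ?h = "height \<theta>"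
  have \<theta>c: "\<theta> \<in> nat_cone D" using \<theta>_Pos unfolding pos_roots_def by blast
  have h: "?h > 0" using height_pos[OF \<theta>c] nonzero_R[OF \<theta>_R] by blast
  \<comment> \<open>On the affine wall, equal values on the simple roots make
    \<open>x \<bullet> b\<close> the ratio of \<open>height b\<close> to
    \<open>height \<theta>\<close>, which is 1 only at \<open>\<theta>\<close>. On the wall of
    \<open>c\<close>, the value 0 at \<open>c\<close> and the factor 1/2 elsewhere keep
    \<open>x \<bullet> \<theta>\<close> at most 1/2, so 0 is the only integer taken on positive
    roots.\<close>
  define f where "f = (case i of None \<Rightarrow> (\<lambda>a. 1 / ?h) | Some c \<Rightarrow> (\<lambda>a. if a = c then 0 else 1 / (2 * ?h)))"
  obtain x where x: "\<And>a. a \<in> D \<Longrightarrow> x \<bullet> a = f a" using ex_coweight[of f] by blast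
  have xb: "x \<bullet> b = (\<Sum>a\<in>D. (b \<bullet> cw a) * f a)" for b
    unfolding expand_inner[of b x, symmetric] using x by (intro sum.cong) auto
  have f0: "f a \<ge> 0" for a using h unfolding f_def by (auto split: option.split)
  have xc: "x \<in> fund_chamber D" using x f0 unfolding fund_chamber_def by simp
  have xP: "\<And>b. b \<in> Pos \<Longrightarrow> 0 \<le> x \<bullet> b" "\<And>b. b \<in> Pos \<Longrightarrow> x \<bullet> b \<le> x \<bullet> \<theta>"
  proof -
    fix b assume b: "b \<in> Pos"
    show "0 \<le> x \<bullet> b" using nat_cone_inner_nonneg[of b x] x f0 b unfolding pos_roots_def by simp
    have "x \<bullet> (\<theta> - b) \<ge> 0" using nat_cone_inner_nonneg[of "\<theta> - b" x] x f0 highest_root b by simp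
    then show "x \<bullet> b \<le> x \<bullet> \<theta>" by (simp add: inner_diff_right)
  qed
  show ?thesis
  proof (cases i)
    case None
    have xh: "x \<bullet> b = height b / ?h" for b
      unfolding xb height_def f_def None by (simp add: sum_divide_distrib)
    have x\<theta>: "x \<bullet> \<theta> = 1" using xh h by simp
    have key: "b = \<theta> \<and> m = 1" if b: "b \<in> Pos" and m: "m \<in> \<int>" "x \<bullet> b = m" for b m
    proof -
      have "height b > 0" using height_pos b nonzero_R[OF Pos_R[OF b]] unfolding pos_roots_def by blast
      then have "x \<bullet> b > 0" using xh h by simp
      then have m1: "m = 1" using m xP(2)[OF b] x\<theta> by (auto elim!: Ints_cases)
      then have "height b = ?h" using xh[of b] m h by simp
      then have "height (\<theta> - b) = 0" by (simp add: height_diff)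
      then have "\<theta> - b = 0" using height_pos[of "\<theta> - b"] highest_root b by force
      then show ?thesis using m1 by simp
    qed
    show ?thesis
    proof (intro bexI[of _ x] conjI ballI impI)
      show "x \<in> fund_alcove R D" using xc x\<theta> unfolding fund_alcove_def by simp
      show "x \<bullet> wall_root R D i = wall_level i" using x\<theta> None by (simp add: wall_root_def wall_level_def)
      fix b m assume b: "b \<in> R" and m: "m \<in> \<int>" "x \<bullet> b = m"
      show "b = wall_root R D i \<and> m = wall_level i \<or> b = - wall_root R D i \<and> m = - wall_level i"
        using Pos_cases[OF b]
      proof
        assume "b \<in> Pos"
        then show ?thesis using key[of b m] m None by (simp add: wall_root_def wall_level_def)
      next
        assume "- b \<in> Pos"
        then have "- b = \<theta> \<and> - m = 1" using key[of "- b" "- m"] m by simp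
        then have "b = - \<theta>" "m = - 1" by (metis minus_minus)+
        then show ?thesis using None by (simp add: wall_root_def wall_level_def)
      qed
    qed
  next
    case (Some c)
    then have c: "c \<in> D" using i by (auto simp: idx_def)
    have xc0: "x \<bullet> c = 0" using x[OF c] unfolding f_def Some by simp
    have "x \<bullet> \<theta> \<le> (\<Sum>a\<in>D. (\<theta> \<bullet> cw a) * (1 / (2 * ?h)))"
      unfolding xb using h nat_cone_nonneg[OF \<theta>c]
      by (intro sum_mono mult_left_mono) (auto simp: f_def Some)
    also have "\<dots> = ?h * (1 / (2 * ?h))" unfolding height_def sum_distrib_right ..
    also have "\<dots> = 1 / 2" using h by simp
    finally have x\<theta>: "x \<bullet> \<theta> \<le> 1 / 2" .
    have key: "b = c \<and> m = 0" if b: "b \<in> Pos" and m: "m \<in> \<int>" "x \<bullet> b = m" for b m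
    proof -
      have m0: "m = 0" using m xP[OF b] x\<theta> by (auto elim!: Ints_cases)
      have "b = c"
      proof (rule ccontr)
        assume "b \<noteq> c"
        then obtain a where a: "a \<in> D" "a \<noteq> c" "b \<bullet> cw a > 0"
          using ex_coef_other[OF b c] by blast
        have "(\<Sum>a\<in>D. (b \<bullet> cw a) * f a) > 0"
        proof (rule sum_pos2[OF finite_D a(1)])
          show "0 < (b \<bullet> cw a) * f a" using a h by (simp add: f_def Some)
          show "0 \<le> (b \<bullet> cw d) * f d" if "d \<in> D" for d using Pos_nonneg[OF b that] f0[of d] by simp
        qed
        then show False using xb m m0 by simp
      qed
      then show ?thesis using m0 by simp
    qed
    show ?thesis
    proof (intro bexI[of _ x] conjI ballI impI)
      show "x \<in> fund_alcove R D" using xc x\<theta> unfolding fund_alcove_def by simp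
      show "x \<bullet> wall_root R D i = wall_level i" using xc0 Some by (simp add: wall_root_def wall_level_def)
      fix b m assume b: "b \<in> R" and m: "m \<in> \<int>" "x \<bullet> b = m"
      show "b = wall_root R D i \<and> m = wall_level i \<or> b = - wall_root R D i \<and> m = - wall_level i"
        using Pos_cases[OF b]
      proof
        assume "b \<in> Pos"
        then show ?thesis using key[of b m] m Some by (simp add: wall_root_def wall_level_def)
      next
        assume "- b \<in> Pos"
        then have "- b = c \<and> - m = 0" using key[of "- b" "- m"] m by simp
        then have "b = - c" "m = 0" by (metis minus_minus, simp)
        then show ?thesis using Some by (simp add: wall_root_def wall_level_def)
      qed
    qed
  qed
qed

end

section \<open>Alcoves tested at an interior point\<close>

locale based_root_system_point = based_root_system R D
  for R D :: "'v::euclidean_space set" +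
  fixes z0 :: 'v
  assumes z0_interior: "z0 \<in> interior (fund_alcove R D)"
begin

lemma z0_alcove: "z0 \<in> fund_alcove R D"
  using z0_interior interior_subset by blast

lemma z0_wall: assumes "i \<in> idx D" shows "z0 \<bullet> wall_root R D i > wall_level i"
proof -
  let ?b = "wall_root R D i"
  have "?b \<noteq> 0" using assms wall_root_R nonzero_R by blast
  then have "interior {x. ?b \<bullet> x \<ge> wall_level i} = {x. ?b \<bullet> x > wall_level i}" by (rule interior_halfspace_ge)
  moreover have "fund_alcove R D \<subseteq> {x. ?b \<bullet> x \<ge> wall_level i}"
    using fund_alcove_wall assms by (auto simp: inner_commute)
  ultimately show ?thesis using z0_interior interior_mono[of "fund_alcove R D"] by (auto simp: inner_commute)
qed

lemma z0_Pos: assumes "b \<in> Pos" shows "0 < z0 \<bullet> b" "z0 \<bullet> b < 1"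
proof -
  have z0a: "z0 \<bullet> a > 0" if "a \<in> D" for a
    using z0_wall[of "Some a"] that by (simp add: idx_def wall_root_def wall_level_def)
  obtain a where a: "a \<in> D" "b \<bullet> cw a > 0" using ex_coef_pos assms by blast
  have "(\<Sum>a\<in>D. (b \<bullet> cw a) * (z0 \<bullet> a)) > 0"
    using a z0a Pos_nonneg[OF assms] by (intro sum_pos2[OF finite_D a(1)]) (auto simp: less_imp_le)
  then show "0 < z0 \<bullet> b" by (simp add: expand_inner)
  have "z0 \<bullet> (\<theta> - b) \<ge> 0" using nat_cone_inner_nonneg[of "\<theta> - b" z0] z0a highest_root assms
    by (simp add: less_imp_le)
  moreover have "z0 \<bullet> \<theta> < 1" using z0_wall[of None] by (simp add: idx_def wall_root_def wall_level_def)
  ultimately show "z0 \<bullet> b < 1" by (simp add: inner_diff_right)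
qed

text \<open>No hyperplane of integral level cuts the fundamental alcove: roots map it into [0,1] or
  [-1,0] and take \<open>z0\<close> to the open interval, so an integer below the value at
  \<open>z0\<close> is at most the left end.\<close>

lemma z0_gt: assumes "b \<in> R" "m \<in> \<int>" "z0 \<bullet> b > m" "x \<in> fund_alcove R D" shows "x \<bullet> b \<ge> m"
proof -
  obtain k where k: "m = of_int k" using assms Ints_cases by blast
  from Pos_cases[OF assms(1)] show ?thesis
  proof
    assume b: "b \<in> Pos"
    then have "k \<le> 0" using z0_Pos[OF b] assms k by simp
    then show ?thesis using fund_alcove_inner[OF assms(4) b] k by (smt (verit) of_int_le_0_iff)
  next
    assume b: "- b \<in> Pos"
    then have "k < 0" using z0_Pos[OF b] assms k by simp
    then have "k \<le> - 1" by simp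
    then have "m \<le> - 1" using k by linarith
    then show ?thesis using fund_alcove_inner[OF assms(4) b] by simp
  qed
qed

lemma z0_not_Ints: assumes "b \<in> R" shows "z0 \<bullet> b \<notin> \<int>"
  using Pos_cases[OF assms] z0_Pos[of b] z0_Pos[of "- b"] by (auto elim!: Ints_cases)

context
  fixes u assumes u: "u \<in> affine_weyl R D"
begin

lemma affine_gt:
  assumes "b \<in> R" "m \<in> \<int>" "u z0 \<bullet> b > m" "x \<in> fund_alcove R D" shows "u x \<bullet> b \<ge> m"
proof -
  obtain b' where b': "b' \<in> R" "\<And>x. u x \<bullet> b = x \<bullet> b' + u 0 \<bullet> b"
    using affine_inner_root[OF u assms(1)] by metis
  have "m - u 0 \<bullet> b \<in> \<int>" using assms origin_coweights[OF u] unfolding coweights_def by auto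
  then have "x \<bullet> b' \<ge> m - u 0 \<bullet> b" using z0_gt[OF b'(1)] b'(2)[of z0] assms by simp
  then show ?thesis using b'(2)[of x] by simp
qed

lemma affine_not_Ints: assumes "b \<in> R" shows "u z0 \<bullet> b \<notin> \<int>"
proof
  assume "u z0 \<bullet> b \<in> \<int>"
  obtain b' where b': "b' \<in> R" "\<And>x. u x \<bullet> b = x \<bullet> b' + u 0 \<bullet> b"
    using affine_inner_root[OF u assms(1)] by metis
  have "z0 \<bullet> b' = u z0 \<bullet> b - u 0 \<bullet> b" using b'(2)[of z0] by simp
  also have "\<dots> \<in> \<int>" using assms \<open>u z0 \<bullet> b \<in> \<int>\<close> origin_coweights[OF u] unfolding coweights_def by auto
  finally show False using z0_not_Ints b' by blast
qed

lemma affine_z0_wall: "i \<in> idx D \<Longrightarrow> u z0 \<bullet> wroot u i > wlevel u i"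
  using affine_wall_value[OF u, of z0 i] z0_wall[of i] by simp

lemma affine_gen_z0_wall: "i \<in> idx D \<Longrightarrow> u (gen R D i z0) \<bullet> wroot u i < wlevel u i"
  using affine_z0_wall[of i]
    inner_aff_refl_self[OF nonzero_R[OF wroot_R[OF u, of i]], of "wlevel u i" "u z0"]
  unfolding affine_gen_apply[OF u, of i z0] by linarith

text \<open>The facet point of wall \<open>i\<close> is fixed by the generator, so its image lies in
  both alcoves. Any integral hyperplane passed between \<open>u z0\<close> and its mirror image must
  contain it, hence is the wall itself; the side of \<open>u z0\<close> fixes the
  orientation.\<close>

lemma crossing_unique:
  assumes i: "i \<in> idx D" and b: "b \<in> R" and m: "m \<in> \<int>"
    and gt: "u z0 \<bullet> b > m" and lt: "u (gen R D i z0) \<bullet> b < m"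
  shows "b = wroot u i \<and> m = wlevel u i"
proof -
  let ?b = "wall_root R D i" and ?k = "wall_level i"
  obtain x where x: "x \<in> fund_alcove R D" "x \<bullet> ?b = ?k" and
    uniq: "\<And>b m. b \<in> R \<Longrightarrow> m \<in> \<int> \<Longrightarrow> x \<bullet> b = m \<Longrightarrow> b = ?b \<and> m = ?k \<or> b = - ?b \<and> m = - ?k"
    using ex_facet_point[OF i] by blast
  have "gen R D i x = x" using x by (simp add: gen_wall aff_refl_def)
  moreover have "u (gen R D i x) \<bullet> (- b) \<ge> - m"
    using based_root_system_point.affine_gt[OF based_root_system_point_axioms affine_gen[OF u i], of "- b" "- m" x]
      neg_R[OF b] m lt x by simp
  ultimately have "u x \<bullet> b \<le> m" by simp
  moreover have "u x \<bullet> b \<ge> m" using affine_gt[OF b m gt x(1)] .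
  ultimately have ux: "u x \<bullet> b = m" by simp
  obtain b' where b': "b' \<in> R" "b = lin_part u b'" "\<And>x. u x \<bullet> b = x \<bullet> b' + u 0 \<bullet> b"
    using affine_inner_root[OF u b] by metis
  have "m - u 0 \<bullet> b \<in> \<int>" using m b origin_coweights[OF u] unfolding coweights_def by auto
  then have "b' = ?b \<and> m - u 0 \<bullet> b = ?k \<or> b' = - ?b \<and> m - u 0 \<bullet> b = - ?k"
    using uniq[OF b'(1), of "m - u 0 \<bullet> b"] ux b'(3)[of x] by simp
  then show ?thesis
  proof
    assume "b' = ?b \<and> m - u 0 \<bullet> b = ?k"
    then show ?thesis using b'(2) by (simp add: algebra_simps)
  next
    assume "b' = - ?b \<and> m - u 0 \<bullet> b = - ?k"
    then have "b = - wroot u i" "m = - wlevel u i"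
      using b'(2) linear_neg[OF lin_part_linear[OF u]] by (auto simp: algebra_simps)
    then show ?thesis using gt affine_z0_wall[OF i] by simp
  qed
qed

lemma alcove_ge_wall: "i \<in> idx D \<Longrightarrow> alcove R D u \<subseteq> {g. g \<bullet> wroot u i \<ge> wlevel u i}"
proof
  fix y assume i: "i \<in> idx D" and "y \<in> alcove R D u"
  then obtain x where x: "x \<in> fund_alcove R D" "y = u x" unfolding alcove_def by blast
  then have "x \<bullet> wall_root R D i \<ge> wall_level i" using fund_alcove_wall i by blast
  then show "y \<in> {g. g \<bullet> wroot u i \<ge> wlevel u i}" using affine_wall_value[OF u, of x i] x by simp
qed

lemma wall_hyperplane: assumes "i \<in> idx D" shows "hyp (wroot u i) (wlevel u i) \<in> hyperplanes R D"
proof -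
  obtain k where k: "wlevel u i = of_int k" using wlevel_Ints[OF u assms] Ints_cases by blast
  from Pos_cases[OF wroot_R[OF u assms]] show ?thesis
  proof
    assume "wroot u i \<in> Pos"
    then show ?thesis unfolding hyperplanes_def k by blast
  next
    assume "- wroot u i \<in> Pos"
    then have "hyp (- wroot u i) (of_int (- k)) \<in> hyperplanes R D" unfolding hyperplanes_def by blast
    then show ?thesis using hyp_uminus[of "wroot u i" "wlevel u i"] k by simp
  qed
qed

text \<open>This discharges the \<open>THE\<close>. A separating hyperplane of the arrangement meets
  the segment from \<open>u z0\<close> to its mirror image but contains neither endpoint, so it is
  strictly crossed and \<open>crossing_unique\<close> identifies it.\<close>

lemma sep_hyp_eq: assumes i: "i \<in> idx D" shows "sep_hyp R D u i = hyp (wroot u i) (wlevel u i)"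
  unfolding sep_hyp_def
proof (rule the_equality)
  have nz: "wroot u i \<noteq> 0" using nonzero_R wroot_R[OF u i] by blast
  have "alcove R D (u \<circ> gen R D i) \<subseteq> {g. g \<bullet> wroot u i \<le> wlevel u i}"
  proof
    fix y assume "y \<in> alcove R D (u \<circ> gen R D i)"
    then obtain x where x: "x \<in> fund_alcove R D" "y = u (gen R D i x)" unfolding alcove_def by auto
    have "u x \<bullet> wroot u i \<ge> wlevel u i" using alcove_ge_wall[OF i] x unfolding alcove_def by auto
    then show "y \<in> {g. g \<bullet> wroot u i \<le> wlevel u i}"
      using x affine_gen_apply[OF u, of i x] inner_aff_refl_self[OF nz, of "wlevel u i" "u x"] by simp
  qed
  then show "hyp (wroot u i) (wlevel u i) \<in> hyperplanes R D \<and>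
      separates (hyp (wroot u i) (wlevel u i)) (alcove R D u) (alcove R D (u \<circ> gen R D i))"
    using wall_hyperplane[OF i] alcove_ge_wall[OF i] nz unfolding separates_def by blast
next
  fix H assume H: "H \<in> hyperplanes R D \<and> separates H (alcove R D u) (alcove R D (u \<circ> gen R D i))"
  then obtain b k where bk: "b \<in> Pos" "H = hyp b (of_int k)" unfolding hyperplanes_def by blast
  have b: "b \<in> R" using bk Pos_R by blast
  let ?x = "u z0" and ?y = "u (gen R D i z0)"
  have "?x \<in> alcove R D u" "?y \<in> alcove R D (u \<circ> gen R D i)"
    using z0_alcove unfolding alcove_def by auto
  then obtain z where z: "z \<in> closed_segment ?x ?y" "z \<in> H" using separates_segment H by blast
  then have zb: "z \<bullet> b = of_int k" using bk by (simp add: hyp_def)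
  have ne: "?x \<bullet> b \<noteq> of_int k" "?y \<bullet> b \<noteq> of_int k"
    using affine_not_Ints[OF b] Ints_of_int[of k, where 'a = real]
      based_root_system_point.affine_not_Ints[OF based_root_system_point_axioms affine_gen[OF u i] b]
    by auto
  have "\<not> (?x \<bullet> b > of_int k \<and> ?y \<bullet> b > of_int k)"
    using closed_segment_halfspace_gt[OF z(1), of "of_int k" b] zb by auto
  moreover have "\<not> (?x \<bullet> b < of_int k \<and> ?y \<bullet> b < of_int k)"
    using closed_segment_halfspace_gt[OF z(1), of "- of_int k" "- b"] zb by auto
  ultimately consider "?x \<bullet> b > of_int k" "?y \<bullet> b < of_int k" | "?x \<bullet> b < of_int k" "?y \<bullet> b > of_int k"
    using ne by linarith
  then show "H = hyp (wroot u i) (wlevel u i)"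
  proof cases
    case 1
    then show ?thesis using crossing_unique[OF i b, of "of_int k"] bk by simp
  next
    case 2
    then have "- b = wroot u i \<and> - of_int k = wlevel u i"
      using crossing_unique[OF i neg_R[OF b], of "- of_int k"] by simp
    then show ?thesis using hyp_uminus[of b "of_int k"] bk by simp
  qed
qed

text \<open>The current alcove lies on the nonnegative side of its wall. The step is therefore
  permitted exactly when the fundamental alcove, tested at \<open>z0\<close>, lies on that side as
  well.\<close>

lemma tilde_allowed_iff:
  assumes i: "i \<in> idx D" shows "tilde_allowed R D u i \<longleftrightarrow> z0 \<bullet> wroot u i > wlevel u i"
proof
  assume a: "tilde_allowed R D u i"
  have b: "wroot u i \<in> R" and m: "wlevel u i \<in> \<int>" using wroot_R wlevel_Ints u i by blast+
  show "z0 \<bullet> wroot u i > wlevel u i"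
  proof (rule ccontr)
    assume "\<not> ?thesis"
    moreover have "z0 \<bullet> wroot u i \<noteq> wlevel u i" using z0_not_Ints[OF b] m by auto
    ultimately have "z0 \<bullet> (- wroot u i) > - wlevel u i" by simp
    then have "fund_alcove R D \<subseteq> {g. g \<bullet> wroot u i \<le> wlevel u i}"
      using z0_gt[OF neg_R[OF b], of "- wlevel u i"] m by (auto simp del: minus_add_distrib)
    then have "separates (sep_hyp R D u i) (alcove R D u) (fund_alcove R D)"
      unfolding sep_hyp_eq[OF i] separates_def using alcove_ge_wall[OF i] nonzero_R[OF b] by blast
    then show False using a unfolding tilde_allowed_def by blast
  qed
next
  assume a: "z0 \<bullet> wroot u i > wlevel u i"
  show "tilde_allowed R D u i" unfolding tilde_allowed_def
  proof
    assume "separates (sep_hyp R D u i) (alcove R D u) (fund_alcove R D)"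
    moreover have "u z0 \<in> alcove R D u" using z0_alcove unfolding alcove_def by blast
    ultimately obtain z where "z \<in> closed_segment (u z0) z0" "z \<in> hyp (wroot u i) (wlevel u i)"
      using separates_segment[OF _ _ z0_alcove] unfolding sep_hyp_eq[OF i] by blast
    then show False using closed_segment_halfspace_gt[OF _ affine_z0_wall[OF i] a] by (force simp: hyp_def)
  qed
qed

end

lemma dominant_part_iff:
  "v \<in> dominant_part R D \<longleftrightarrow> v \<in> affine_weyl R D \<and> (\<forall>a\<in>D. v z0 \<bullet> a > 0)"
proof
  assume v: "v \<in> dominant_part R D"
  then have vW: "v \<in> affine_weyl R D" and vz: "v z0 \<in> fund_chamber D"
    using z0_alcove unfolding dominant_part_def alcove_def by auto
  have "v z0 \<bullet> a > 0" if "a \<in> D" for a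
  proof -
    have "v z0 \<bullet> a \<ge> 0" using vz that unfolding fund_chamber_def by blast
    moreover have "v z0 \<bullet> a \<noteq> 0" using affine_not_Ints[OF vW D_R[OF that]] by auto
    ultimately show ?thesis by simp
  qed
  then show "v \<in> affine_weyl R D \<and> (\<forall>a\<in>D. v z0 \<bullet> a > 0)" using vW by blast
next
  assume v: "v \<in> affine_weyl R D \<and> (\<forall>a\<in>D. v z0 \<bullet> a > 0)"
  then have "v x \<bullet> a \<ge> 0" if "a \<in> D" "x \<in> fund_alcove R D" for a x
    using affine_gt[of v a 0 x] D_R that by auto
  then show "v \<in> dominant_part R D" using v unfolding dominant_part_def alcove_def fund_chamber_def by auto
qed

section \<open>Walls of dominant alcoves\<close>

context
  fixes v assumes v: "v \<in> dominant_part R D"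
begin

lemma dominant_affine: "v \<in> affine_weyl R D"
  using v unfolding dominant_part_def by blast

lemma dominant_Pos: assumes b: "b \<in> Pos" shows "v z0 \<bullet> b > 0"
proof -
  have va: "v z0 \<bullet> a > 0" if "a \<in> D" for a using v that unfolding dominant_part_iff by blast
  obtain a where a: "a \<in> D" "b \<bullet> cw a > 0" using ex_coef_pos b by blast
  have "(\<Sum>a\<in>D. (b \<bullet> cw a) * (v z0 \<bullet> a)) > 0"
    using a va Pos_nonneg[OF b] by (intro sum_pos2[OF finite_D a(1)]) (auto simp: less_imp_le)
  then show ?thesis by (simp add: expand_inner)
qed

text \<open>An alcove has width at most 1 in the direction of each wall. Together with the sign of
  \<open>v z0\<close> on roots this confines the integral levels of the walls in the following two
  lemmas.\<close>

lemma wall_strip: assumes i: "i \<in> idx D" shows "v z0 \<bullet> wroot v i < wlevel v i + 1"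
proof -
  have "z0 \<bullet> wall_root R D i < wall_level i + 1"
  proof (cases i)
    case None
    then show ?thesis using z0_Pos[OF \<theta>_Pos] by (simp add: wall_root_def wall_level_def)
  next
    case (Some a)
    then show ?thesis using z0_Pos[of a] D_Pos[of a] i by (auto simp: wall_root_def wall_level_def idx_def)
  qed
  then show ?thesis using affine_wall_value[OF dominant_affine, of z0 i] by simp
qed

lemma dominant_wall_Pos:
  assumes i: "i \<in> idx D" and b: "wroot v i \<in> Pos" shows "wlevel v i \<ge> 0"
proof -
  obtain k where k: "wlevel v i = of_int k" using wlevel_Ints[OF dominant_affine i] Ints_cases by blast
  have "of_int k + (1::real) > 0" using dominant_Pos[OF b] wall_strip[OF i] k by simp
  then have "k \<ge> 0" by linarith
  then show ?thesis using k by simp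
qed

lemma dominant_wall_neg:
  assumes i: "i \<in> idx D" and b: "- wroot v i \<in> Pos" shows "wlevel v i \<le> - 1"
proof -
  obtain k where k: "wlevel v i = of_int k" using wlevel_Ints[OF dominant_affine i] Ints_cases by blast
  have "of_int k < (0::real)" using dominant_Pos[OF b] affine_z0_wall[OF dominant_affine i] k by simp
  then have "k \<le> - 1" by linarith
  then show ?thesis using k by linarith
qed

text \<open>Leaving the chamber would mean crossing a simple hyperplane of level 0, whereas this
  wall has level at most \<open>- 1\<close>.\<close>

lemma dominant_cross: assumes i: "i \<in> idx D" and b: "- wroot v i \<in> Pos"
  shows "v \<circ> gen R D i \<in> dominant_part R D"
proof -
  have "v (gen R D i z0) \<bullet> a > 0" if a: "a \<in> D" for a
  proof (rule ccontr)
    assume "\<not> ?thesis"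
    moreover have "(v \<circ> gen R D i) z0 \<bullet> a \<notin> \<int>"
      using affine_not_Ints[OF affine_gen[OF dominant_affine i] D_R[OF a]] .
    then have "v (gen R D i z0) \<bullet> a \<noteq> 0" by auto
    ultimately have "wlevel v i = 0"
      using crossing_unique[OF dominant_affine i D_R[OF a], of 0] dominant_Pos[OF D_Pos[OF a]] by simp
    then show False using dominant_wall_neg[OF i b] by simp
  qed
  then show ?thesis using affine_gen[OF dominant_affine i] unfolding dominant_part_iff by simp
qed

text \<open>The right-hand side involves only the linear part of \<open>v\<close>; this is why the
  projected process is a Markov chain and why the choice made in \<open>rep\<close> is
  immaterial.\<close>

lemma hat_allowed_iff:
  assumes i: "i \<in> idx D" shows "hat_allowed R D v i \<longleftrightarrow> - wroot v i \<in> Pos"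
proof
  assume b: "- wroot v i \<in> Pos"
  have "tilde_allowed R D v i"
    using tilde_allowed_iff[OF dominant_affine i] z0_Pos[OF b] dominant_wall_neg[OF i b] by simp
  then show "hat_allowed R D v i"
    using dominant_cross[OF i b] unfolding hat_allowed_def dominant_part_def by blast
next
  assume h: "hat_allowed R D v i"
  show "- wroot v i \<in> Pos"
  proof (rule ccontr)
    assume "\<not> ?thesis"
    then have b: "wroot v i \<in> Pos" using Pos_cases wroot_R[OF dominant_affine i] by blast
    obtain k where k: "wlevel v i = of_int k" using wlevel_Ints[OF dominant_affine i] Ints_cases by blast
    \<comment> \<open>Permission forces the level below 1, dominance forces it to be at least 0. At
      level 0 the crossing makes a positive root negative and leaves the chamber.\<close>
    have "z0 \<bullet> wroot v i > of_int k"
      using h tilde_allowed_iff[OF dominant_affine i] k unfolding hat_allowed_def by simp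
    then have "k \<le> 0" using z0_Pos[OF b] by simp
    then have k0: "wlevel v i = 0" using dominant_wall_Pos[OF i b] k by simp
    have "v (gen R D i z0) \<in> fund_chamber D"
      using h z0_alcove unfolding hat_allowed_def alcove_def by auto
    then have "v (gen R D i z0) \<bullet> wroot v i \<ge> 0"
      using nat_cone_inner_nonneg b unfolding fund_chamber_def pos_roots_def by blast
    then show False using affine_gen_z0_wall[OF dominant_affine i] k0 by simp
  qed
qed

end

end

section \<open>Periodicity of the ray\<close>

context based_root_system
begin

lemma gen_gen: assumes "i \<in> idx D" shows "gen R D i (gen R D i x) = x"
  using aff_refl_aff_refl[OF nonzero_R[OF wall_root_R[OF assms]]] by (simp add: gen_wall)

text \<open>The wall just crossed is the same hyperplane seen from its other side, so normal and
  level both change sign.\<close>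

lemma wall_flip:
  assumes u: "u \<in> affine_weyl R D" and i: "i \<in> idx D"
  shows "wroot (u \<circ> gen R D i) i = - wroot u i" "wlevel (u \<circ> gen R D i) i = - wlevel u i"
proof -
  let ?b = "wall_root R D i"
  have nz: "?b \<noteq> 0" using nonzero_R wall_root_R i by blast
  have "aff_refl ?b 0 ?b = - ?b" using nz by (simp add: aff_refl_0 inner_coroot_self scaleR_2)
  then show 1: "wroot (u \<circ> gen R D i) i = - wroot u i"
    using lin_part_comp_gen[OF u i] linear_neg[OF lin_part_linear[OF u]] by simp
  have "u (gen R D i 0) \<bullet> wroot u i - wlevel u i = wall_level i"
    using affine_wall_value[OF u, of "gen R D i 0" i] inner_aff_refl_self[OF nz, of "wall_level i" 0]
    by (simp add: gen_wall)
  then show "wlevel (u \<circ> gen R D i) i = - wlevel u i" using 1 by simp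
qed

lemma alcove_gen_le_wall:
  assumes "u \<in> affine_weyl R D" "i \<in> idx D" "y \<in> alcove R D (u \<circ> gen R D i)"
  shows "y \<bullet> wroot u i \<le> wlevel u i"
proof -
  obtain x where x: "x \<in> fund_alcove R D" "y = (u \<circ> gen R D i) x" using assms unfolding alcove_def by blast
  have "y \<bullet> wroot (u \<circ> gen R D i) i - wlevel (u \<circ> gen R D i) i = x \<bullet> wall_root R D i - wall_level i"
    unfolding x(2) by (rule affine_wall_value[OF affine_gen[OF assms(1,2)]])
  also have "\<dots> \<ge> 0" using x(1) assms(2) unfolding fund_alcove_wall by simp
  finally have "y \<bullet> wroot (u \<circ> gen R D i) i \<ge> wlevel (u \<circ> gen R D i) i" by simp
  moreover have "y \<bullet> wroot (u \<circ> gen R D i) i = - (y \<bullet> wroot u i)" using wall_flip(1)[OF assms(1,2)] by simp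
  ultimately show ?thesis using wall_flip(2)[OF assms(1,2)] by linarith
qed

lemma wall_flip_hyp:
  assumes "u \<in> affine_weyl R D" "i \<in> idx D"
  shows "hyp (wroot (u \<circ> gen R D i) i) (wlevel (u \<circ> gen R D i) i) = hyp (wroot u i) (wlevel u i)"
  by (subst wall_flip(2)[OF assms], subst wall_flip(1)[OF assms], rule hyp_uminus)

lemma fund_alcove_bounded: "\<exists>C. \<forall>x\<in>fund_alcove R D. norm x \<le> C"
proof (intro exI ballI)
  fix x assume x: "x \<in> fund_alcove R D"
  have xa: "\<bar>x \<bullet> a\<bar> \<le> 1" if "a \<in> D" for a using fund_alcove_inner[OF x D_Pos[OF that]] by simp
  have "norm x \<le> (\<Sum>e\<in>Basis. \<bar>x \<bullet> e\<bar>)" by (rule norm_le_l1)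
  also have "\<dots> \<le> (\<Sum>e\<in>(Basis :: 'v set). \<Sum>a\<in>D. \<bar>e \<bullet> cw a\<bar>)"
  proof (rule sum_mono)
    fix e :: 'v
    have "\<bar>x \<bullet> e\<bar> = \<bar>\<Sum>a\<in>D. (e \<bullet> cw a) * (x \<bullet> a)\<bar>" by (simp add: expand_inner)
    also have "\<dots> \<le> (\<Sum>a\<in>D. \<bar>(e \<bullet> cw a) * (x \<bullet> a)\<bar>)" by (rule sum_abs)
    also have "\<dots> \<le> (\<Sum>a\<in>D. \<bar>e \<bullet> cw a\<bar>)"
      using xa by (intro sum_mono) (simp add: abs_mult mult_left_le)
    finally show "\<bar>x \<bullet> e\<bar> \<le> (\<Sum>a\<in>D. \<bar>e \<bullet> cw a\<bar>)" .
  qed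
  finally show "norm x \<le> (\<Sum>e\<in>(Basis :: 'v set). \<Sum>a\<in>D. \<bar>e \<bullet> cw a\<bar>)" .
qed

text \<open>A coweight is determined by its pairings with the roots, and for bounded norm these are
  integers in a bounded range.\<close>

lemma finite_bounded_coweights: "finite {c \<in> coweights. norm c \<le> C}"
proof -
  define K where "K = (\<Sum>b\<in>R. C * norm b)"
  let ?f = "\<lambda>c. restrict (\<lambda>b. c \<bullet> b) R"
  have "inj_on ?f UNIV"
  proof (rule inj_onI)
    fix c d assume "?f c = ?f d"
    then have "c \<bullet> b = d \<bullet> b" if "b \<in> R" for b using that by (metis restrict_apply')
    then have "orthogonal (c - d) b" if "b \<in> R" for b using that by (simp add: orthogonal_def inner_diff_left)
    then have "orthogonal (c - d) (c - d)" using orthogonal_to_span[of "c - d" R "c - d"] span_R by simp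
    then show "c = d" by (simp add: orthogonal_self)
  qed
  then have inj: "inj_on ?f {c \<in> coweights. norm c \<le> C}" using inj_on_subset by blast
  have "?f ` {c \<in> coweights. norm c \<le> C} \<subseteq> R \<rightarrow>\<^sub>E {x \<in> \<int>. \<bar>x\<bar> \<le> K}"
  proof (rule image_subsetI)
    fix c assume "c \<in> {c \<in> coweights. norm c \<le> C}"
    then have c: "c \<in> coweights" "norm c \<le> C" by auto
    then have C0: "C \<ge> 0" using norm_ge_zero order_trans by blast
    have "\<bar>c \<bullet> b\<bar> \<le> K" if b: "b \<in> R" for b
    proof -
      have "\<bar>c \<bullet> b\<bar> \<le> norm c * norm b" by (rule Cauchy_Schwarz_ineq2)
      also have "\<dots> \<le> C * norm b" using c by (intro mult_right_mono) auto
      also have "\<dots> \<le> K" unfolding K_def using member_le_sum[OF b, of "\<lambda>b. C * norm b"] C0 finite_R by simp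
      finally show ?thesis .
    qed
    then show "?f c \<in> R \<rightarrow>\<^sub>E {x \<in> \<int>. \<bar>x\<bar> \<le> K}" using c unfolding coweights_def by auto
  qed
  moreover have "finite (R \<rightarrow>\<^sub>E {x :: real. x \<in> \<int> \<and> \<bar>x\<bar> \<le> K})"
    using finite_abs_int_segment[of K] finite_R by (intro finite_PiE) auto
  ultimately show ?thesis using inj finite_imageD finite_subset by blast
qed

end

context based_root_system_point
begin

text \<open>The midpoint of \<open>u z0\<close> and its mirror image in wall \<open>i\<close> lies
  on that wall. If wall \<open>j\<close> is the same hyperplane, the reflection crosses it too, and
  uniqueness of the crossing identifies the normals and hence the labels.\<close>

lemma wall_hyp_inj:
  assumes u: "u \<in> affine_weyl R D" and i: "i \<in> idx D" "j \<in> idx D"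
    and eq: "hyp (wroot u i) (wlevel u i) = hyp (wroot u j) (wlevel u j)"
  shows "i = j"
proof -
  let ?m = "(1 / 2) *\<^sub>R (u z0 + u (gen R D i z0))"
  have nz: "wroot u i \<noteq> 0" using nonzero_R wroot_R[OF u i(1)] by blast
  have "u (gen R D i z0) \<bullet> wroot u i - wlevel u i = - (u z0 \<bullet> wroot u i - wlevel u i)"
    unfolding affine_gen_apply[OF u] by (rule inner_aff_refl_self[OF nz])
  then have "?m \<in> hyp (wroot u i) (wlevel u i)" by (simp add: hyp_def inner_add_left)
  then have "?m \<bullet> wroot u j = wlevel u j" unfolding eq by (simp add: hyp_def)
  then have "u z0 \<bullet> wroot u j + u (gen R D i z0) \<bullet> wroot u j = 2 * wlevel u j"
    by (simp add: inner_add_left)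
  moreover have "b < k" if "a + b = 2 * k" "k < a" for a b k :: real using that by linarith
  ultimately have "u (gen R D i z0) \<bullet> wroot u j < wlevel u j" using affine_z0_wall[OF u i(2)] by blast
  then have w: "wroot u j = wroot u i" "wlevel u j = wlevel u i"
    using crossing_unique[OF u i(1) wroot_R[OF u i(2)] wlevel_Ints[OF u i(2)] affine_z0_wall[OF u i(2)]] by auto
  obtain w' where "\<And>x. w' (lin_part u x) = x" using weyl_inverse[OF lin_part_weyl[OF u]] by metis
  then have "wall_root R D i = wall_root R D j" using w(1) by metis
  moreover have "wall_level i = wall_level j" using w by simp
  ultimately show ?thesis by (auto simp: wall_root_def wall_level_def split: option.splits)
qed

section \<open>Crossing times of a generic ray\<close>

context
  fixes eta :: 'v and i :: "nat \<Rightarrow> 'v option"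
  assumes gd: "generic_dir R D z0 eta" and bs: "billiard_seq R D z0 eta i"
begin

lemma eta_coweights: "eta \<in> coweights" and eta_nonzero: "eta \<noteq> 0"
  using gd coroot_lattice_coweights unfolding generic_dir_def by blast+

lemma idx_i: "i j \<in> idx D"
  using bs unfolding billiard_seq_def by blast

abbreviation "wk \<equiv> walk R D i"

lemma walk_affine: "wk j \<in> affine_weyl R D"
  by (induction j) (auto intro: affine_weyl.intros idx_i simp del: comp_apply id_apply)

definition time :: "nat \<Rightarrow> real" where
  "time = (SOME time. time 0 = 0 \<and> strict_mono time \<and>
        (\<forall>j. (\<lambda>s. z0 + s *\<^sub>R eta) ` {time j..time (Suc j)} \<subseteq> alcove R D (walk R D i j)))"

lemma time_props: "time 0 = 0 \<and> strict_mono time \<and>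
        (\<forall>j. (\<lambda>s. z0 + s *\<^sub>R eta) ` {time j..time (Suc j)} \<subseteq> alcove R D (walk R D i j))"
  using someI_ex[OF bs[unfolded billiard_seq_def, THEN conjunct2], folded time_def] .

lemma time_mono: "strict_mono time" using time_props by blast

lemma time_less: "time j < time (Suc j)" using time_mono by (simp add: strict_mono_Suc_iff)

lemma time_nonneg: "time j \<ge> 0" using time_props strict_mono_less_eq[OF time_mono, of 0 j] by simp

abbreviation "ray s \<equiv> z0 + s *\<^sub>R eta"

lemma z_alcove: "time j \<le> s \<Longrightarrow> s \<le> time (Suc j) \<Longrightarrow> ray s \<in> alcove R D (wk j)"
  using time_props by (auto simp: image_subset_iff)

lemmas z_entry_alcove = z_alcove[OF order_refl less_imp_le[OF time_less]]
lemmas z_exit_alcove = z_alcove[OF less_imp_le[OF time_less] order_refl]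

text \<open>At \<open>time (Suc j)\<close> the ray lies in two adjacent alcoves, hence on their
  common wall; \<open>c\<close> is the speed of approach to it.\<close>

lemma exit_value: "\<exists>c>0. \<forall>s. ray s \<bullet> wroot (wk j) (i j) - wlevel (wk j) (i j) = c * (time (Suc j) - s)"
proof -
  let ?b = "wroot (wk j) (i j)" and ?k = "wlevel (wk j) (i j)"
  define c where "c = - (eta \<bullet> ?b)"
  have "ray (time (Suc j)) \<bullet> ?b \<ge> ?k"
    using alcove_ge_wall[OF walk_affine idx_i] z_alcove[of j "time (Suc j)"] time_less[of j] by fastforce
  moreover have "ray (time (Suc j)) \<bullet> ?b \<le> ?k"
    using alcove_gen_le_wall[OF walk_affine idx_i, of "ray (time (Suc j))" j j] z_alcove[of "Suc j" "time (Suc j)"]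
      time_less[of "Suc j"] by simp
  ultimately have 0: "ray (time (Suc j)) \<bullet> ?b = ?k" by simp
  have val: "ray s \<bullet> ?b - ?k = c * (time (Suc j) - s)" for s
  proof -
    have "ray s = ray (time (Suc j)) + (s - time (Suc j)) *\<^sub>R eta" by (simp add: algebra_simps)
    then have "ray s \<bullet> ?b = ?k + (s - time (Suc j)) * (eta \<bullet> ?b)" using 0 by (simp add: inner_add_left)
    then show ?thesis by (simp add: c_def algebra_simps)
  qed
  have "ray (time j) \<bullet> ?b \<ge> ?k"
    using alcove_ge_wall[OF walk_affine idx_i] z_alcove[of j "time j"] time_less[of j] by fastforce
  then have "0 \<le> c * (time (Suc j) - time j)" using val[of "time j"] by simp
  then have "c \<ge> 0" using time_less[of j] zero_le_mult_iff[of c "time (Suc j) - time j"] by simp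
  \<comment> \<open>A ray parallel to the wall would lie in it entirely, including
    \<open>z0\<close>, which avoids all hyperplanes.\<close>
  moreover have "c \<noteq> 0"
  proof
    assume "c = 0"
    then have "z0 \<bullet> ?b = ?k" using val[of 0] by simp
    then show False
      using z0_not_Ints[OF wroot_R[OF walk_affine idx_i], of j j] wlevel_Ints[OF walk_affine idx_i, of j j] by simp
  qed
  ultimately have "c > 0" by simp
  then show ?thesis using val by blast
qed

lemma exit_zero: "ray (time (Suc j)) \<in> hyp (wroot (wk j) (i j)) (wlevel (wk j) (i j))"
proof -
  obtain c where "\<And>s. ray s \<bullet> wroot (wk j) (i j) - wlevel (wk j) (i j) = c * (time (Suc j) - s)"
    using exit_value[of j] by blast
  from this[of "time (Suc j)"] show ?thesis by (simp add: hyp_def)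
qed

text \<open>With positive approach speed, the ray is beyond the wall after the exit time. This and
  the next lemma make the crossing times intrinsic to the alcoves, although \<open>time\<close> was
  merely chosen as a witness.\<close>

lemma exit_le: assumes "ray s \<in> alcove R D (wk j)" shows "s \<le> time (Suc j)"
proof -
  obtain c where c: "c > 0" "ray s \<bullet> wroot (wk j) (i j) - wlevel (wk j) (i j) = c * (time (Suc j) - s)"
    using exit_value[of j] by blast
  have "ray s \<bullet> wroot (wk j) (i j) \<ge> wlevel (wk j) (i j)"
    using alcove_ge_wall[OF walk_affine idx_i] assms by blast
  then have "0 \<le> c * (time (Suc j) - s)" using c by simp
  then show ?thesis using c by (simp add: zero_le_mult_iff)
qed

lemma entry_ge: assumes "ray s \<in> alcove R D (wk (Suc j))" shows "time (Suc j) \<le> s"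
proof -
  obtain c where c: "c > 0" "ray s \<bullet> wroot (wk j) (i j) - wlevel (wk j) (i j) = c * (time (Suc j) - s)"
    using exit_value[of j] by blast
  have "ray s \<bullet> wroot (wk j) (i j) \<le> wlevel (wk j) (i j)"
    using alcove_gen_le_wall[OF walk_affine idx_i, of "ray s" j j] assms by simp
  then have "c * (time (Suc j) - s) \<le> 0" using c by simp
  then show ?thesis using c by (simp add: mult_le_0_iff)
qed

text \<open>Genericity makes the two hyperplanes equal, and equal walls of one alcove have equal
  labels.\<close>

lemma ray_wall_unique:
  assumes "s \<ge> 0" "v \<in> affine_weyl R D" "k \<in> idx D" "l \<in> idx D"
    and "ray s \<in> hyp (wroot v k) (wlevel v k)" "ray s \<in> hyp (wroot v l) (wlevel v l)"
  shows "k = l"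
  using gd assms wall_hyperplane[OF assms(2)] wall_hyp_inj[OF assms(2-4)] unfolding generic_dir_def by blast

section \<open>Translations along the ray\<close>

context
  fixes j j' :: nat and m :: int
  assumes shift: "\<And>x. wk j' x = wk j x + of_int m *\<^sub>R eta"
begin

lemma shift_alcove: "ray s \<in> alcove R D (wk j) \<longleftrightarrow> ray (s + of_int m) \<in> alcove R D (wk j')"
proof -
  have "ray (s + of_int m) = ray s + of_int m *\<^sub>R eta" by (simp add: algebra_simps)
  then show ?thesis unfolding alcove_def by (auto simp: shift)
qed

lemma shift_wall:
  "ray s \<in> hyp (wroot (wk j) k) (wlevel (wk j) k) \<longleftrightarrow> ray (s + of_int m) \<in> hyp (wroot (wk j') k) (wlevel (wk j') k)"
proof -
  have "lin_part (wk j') = lin_part (wk j)" unfolding lin_part_def by (simp add: shift)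
  moreover have "wk j' 0 = wk j 0 + of_int m *\<^sub>R eta" by (rule shift)
  ultimately show ?thesis by (simp add: hyp_def inner_add_left algebra_simps)
qed

lemma shift_exit: "time (Suc j') = time (Suc j) + of_int m"
proof (rule antisym)
  have "ray (time (Suc j')) \<in> alcove R D (wk j')" by (rule z_exit_alcove)
  then have "ray (time (Suc j') - of_int m) \<in> alcove R D (wk j)"
    unfolding shift_alcove[of "time (Suc j') - of_int m"] by simp
  then show "time (Suc j') \<le> time (Suc j) + of_int m" using exit_le[of "time (Suc j') - of_int m" j] by simp
  have "ray (time (Suc j)) \<in> alcove R D (wk j)" by (rule z_exit_alcove)
  then show "time (Suc j) + of_int m \<le> time (Suc j')" unfolding shift_alcove by (rule exit_le)
qed

text \<open>A translation along the ray carries exit point to exit point. A generic exit point lies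
  on a single wall, so the labels agree and the relation passes to the next alcoves.\<close>

lemma shift_forward: "i j' = i j \<and> (\<forall>x. wk (Suc j') x = wk (Suc j) x + of_int m *\<^sub>R eta)"
proof -
  have "ray (time (Suc j)) \<in> hyp (wroot (wk j) (i j')) (wlevel (wk j) (i j'))"
    unfolding shift_wall using exit_zero[of j'] shift_exit by simp
  then have "i j' = i j" using ray_wall_unique[OF time_nonneg walk_affine idx_i idx_i] exit_zero by blast
  then show ?thesis by (simp add: shift)
qed

end

text \<open>The wall of entry into an alcove carries the label of the step that led there, so the
  same argument at entry points runs backwards. It is needed to obtain periodicity from index 0 on
  rather than eventual periodicity.\<close>

lemma shift_backward:
  assumes shift: "\<And>x. wk (Suc j') x = wk (Suc j) x + of_int m *\<^sub>R eta"
  shows "i j' = i j \<and> (\<forall>x. wk j' x = wk j x + of_int m *\<^sub>R eta)"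
proof -
  have tt: "time (Suc j') = time (Suc j) + of_int m"
  proof (rule antisym)
    have "ray (time (Suc j')) \<in> alcove R D (wk (Suc j'))" by (rule z_entry_alcove)
    then have "ray (time (Suc j') - of_int m) \<in> alcove R D (wk (Suc j))"
      unfolding shift_alcove[OF shift, of "time (Suc j') - of_int m"] by simp
    then show "time (Suc j) + of_int m \<le> time (Suc j')" using entry_ge[of "time (Suc j') - of_int m" j] by simp
    have "ray (time (Suc j)) \<in> alcove R D (wk (Suc j))" by (rule z_entry_alcove)
    then show "time (Suc j') \<le> time (Suc j) + of_int m" unfolding shift_alcove[OF shift] by (rule entry_ge)
  qed
  have entry: "ray (time (Suc j)) \<in> hyp (wroot (wk (Suc j)) (i j)) (wlevel (wk (Suc j)) (i j))" for j
    using exit_zero[of j] wall_flip_hyp[OF walk_affine idx_i, of j j] by simp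
  then have "ray (time (Suc j)) \<in> hyp (wroot (wk (Suc j)) (i j')) (wlevel (wk (Suc j)) (i j'))"
    unfolding shift_wall[OF shift] using entry[of j'] tt by simp
  then have "i j' = i j" using ray_wall_unique[OF time_nonneg walk_affine idx_i idx_i] entry by blast
  moreover have "wk j x = wk (Suc j) (gen R D (i j) x)" for j x using gen_gen[OF idx_i] by simp
  ultimately show ?thesis using shift by metis
qed

text \<open>Up to integer translations along \<open>eta\<close> the ray meets only finitely many alcoves.\<close>

lemma ex_shift: "\<exists>j n m. n > 0 \<and> (\<forall>x. wk (j + n) x = wk j x + of_int m *\<^sub>R eta)"
proof -
  obtain C where C: "\<And>x. x \<in> fund_alcove R D \<Longrightarrow> norm x \<le> C" using fund_alcove_bounded by blast
  define F where "F = weyl R D \<times> {c \<in> coweights. norm c \<le> norm z0 + norm eta + C}"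
  \<comment> \<open>Subtracting the integral part of the entry time brings the entry point back to
    \<open>z0\<close> plus a fraction of \<open>eta\<close>, which bounds the translation part. The
    pigeonhole principle applies to these normalised data.\<close>
  define f where "f j = (lin_part (wk j), wk j 0 - of_int \<lfloor>time j\<rfloor> *\<^sub>R eta)" for j
  have "f j \<in> F" for j
  proof -
    have cw: "wk j 0 - of_int \<lfloor>time j\<rfloor> *\<^sub>R eta \<in> coweights"
      using origin_coweights[OF walk_affine] eta_coweights unfolding coweights_def
      by (auto simp: inner_diff_left)
    have "ray (time j) \<in> alcove R D (wk j)" by (rule z_entry_alcove)
    then obtain x where x: "x \<in> fund_alcove R D" "ray (time j) = wk j x" unfolding alcove_def by blast
    then have "ray (time j) = lin_part (wk j) x + wk j 0" using affine_eq[OF walk_affine] by metis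
    then have "wk j 0 - of_int \<lfloor>time j\<rfloor> *\<^sub>R eta = z0 + frac (time j) *\<^sub>R eta - lin_part (wk j) x"
      by (simp add: frac_def algebra_simps)
    also have "norm \<dots> \<le> norm z0 + norm (frac (time j) *\<^sub>R eta) + norm (lin_part (wk j) x)"
      by (meson norm_triangle_ineq norm_triangle_ineq4 add_mono order_refl order_trans)
    also have "norm (frac (time j) *\<^sub>R eta) \<le> norm eta"
      using frac_ge_0[of "time j"] frac_lt_1[of "time j"] by (simp add: mult_left_le_one_le)
    also have "norm (lin_part (wk j) x) = norm x" using lin_part_inner[OF walk_affine] by (simp add: norm_eq_sqrt_inner)
    also have "norm x \<le> C" using C x by blast
    finally show ?thesis using cw lin_part_weyl[OF walk_affine] unfolding F_def f_def by simp
  qed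
  moreover have "finite F" unfolding F_def using finite_weyl finite_bounded_coweights by blast
  ultimately have "finite (range f)" by (meson finite_subset image_subsetI)
  then have "\<not> inj f" using finite_imageD[of f UNIV] by auto
  then obtain a b where "a \<noteq> b" "f a = f b" unfolding inj_def by blast
  then obtain a b where ab: "a < b" "f a = f b" by (metis linorder_neqE_nat)
  have "wk b x = wk a x + of_int (\<lfloor>time b\<rfloor> - \<lfloor>time a\<rfloor>) *\<^sub>R eta" for x
  proof -
    have "lin_part (wk a) = lin_part (wk b)" "wk a 0 - of_int \<lfloor>time a\<rfloor> *\<^sub>R eta = wk b 0 - of_int \<lfloor>time b\<rfloor> *\<^sub>R eta"
      using ab unfolding f_def by auto
    then show ?thesis using affine_eq[OF walk_affine, of a x] affine_eq[OF walk_affine, of b x]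
      by (simp add: algebra_simps)
  qed
  then have "b - a > 0 \<and> (\<forall>x. wk (a + (b - a)) x = wk a x + of_int (\<lfloor>time b\<rfloor> - \<lfloor>time a\<rfloor>) *\<^sub>R eta)"
    using ab by simp
  then show ?thesis by blast
qed

lemma billiard_periodic: "\<exists>n>0. \<forall>j. i (j + n) = i j"
proof -
  obtain a n m where n: "n > 0" and a: "\<And>x. wk (a + n) x = wk a x + of_int m *\<^sub>R eta"
    using ex_shift by blast
  let ?P = "\<lambda>j. \<forall>x. wk (j + n) x = wk j x + of_int m *\<^sub>R eta"
  have fwd: "?P (Suc j) \<and> i (j + n) = i j" if "?P j" for j using shift_forward[of "j + n" j m] that by simp
  have bwd: "?P j" if "?P (Suc j)" for j using shift_backward[of "j + n" j m] that by simp
  \<comment> \<open>Subtraction is truncated at 0, so the case \<open>k = a\<close> reaches index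
    0.\<close>
  have "?P (a - k)" for k
  proof (induction k)
    case (Suc k)
    show ?case
    proof (cases "k < a")
      case True
      then have "a - k = Suc (a - Suc k)" by simp
      then show ?thesis using Suc bwd[of "a - Suc k"] by metis
    qed (use Suc in simp)
  qed (use a in simp)
  from this[of a] have "?P 0" by simp
  then have "?P j" for j by (induction j) (use fwd in blast)+
  then show ?thesis using n fwd by blast
qed

text \<open>Linear reflections fix the origin. Without the affine one, a recurrence up to
  translation along \<open>eta\<close> would have translation 0, and two different crossing times
  would coincide.\<close>

lemma billiard_uses_None: "\<exists>j. i j = None"
proof (rule ccontr)
  assume no: "\<not> ?thesis"
  have u0: "wk j 0 = 0" for j
  proof (induction j)
    case (Suc j)
    obtain b where "i j = Some b" using no by auto
    then show ?case using Suc by (simp add: gen_def aff_refl_def)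
  qed simp
  obtain a n m where n: "n > 0" and a: "\<And>x. wk (a + n) x = wk a x + of_int m *\<^sub>R eta"
    using ex_shift by blast
  have "of_int m *\<^sub>R eta = 0" using a[of 0] u0 by simp
  then have "m = 0" using eta_nonzero by simp
  then have "time (Suc (a + n)) = time (Suc a)" using shift_exit[OF a] by simp
  then show False using n strict_mono_eq[OF time_mono] by simp
qed

lemma period_props: "period i > 0" "i (j + period i) = i j" "i (j mod period i) = i j"
proof -
  have "period i > 0 \<and> (\<forall>j. i (j + period i) = i j)"
    unfolding period_def by (rule LeastI_ex) (use billiard_periodic in blast)
  then show "period i > 0" and per: "\<And>j. i (j + period i) = i j" by auto
  have "i (r + k * period i) = i r" for r k
    by (induction k) (simp_all add: per add.assoc[symmetric] add.commute[of "period i"])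
  from this[of "j mod period i" "j div period i"] show "i (j mod period i) = i j" by simp
qed

end

end

section \<open>Markov chains driven by coins\<close>

lemma ex_finite_list_bound:
  fixes g :: "bool list \<Rightarrow> real"
  shows "\<exists>B. \<forall>l. length l = n \<longrightarrow> \<bar>g l\<bar> \<le> B"
proof -
  have "finite {l :: bool list. length l = n}"
    using finite_lists_length_eq[of "UNIV :: bool set" n] by simp
  then have "finite ((\<lambda>l. \<bar>g l\<bar>) ` {l. length l = n})" by blast
  then show ?thesis using Max_ge by (intro exI[of _ "Max ((\<lambda>l. \<bar>g l\<bar>) ` {l. length l = n})"]) blast
qed

section \<open>Integrals of functions of finitely many coins\<close>

locale coin_space =
  fixes p :: real
  assumes p0: "0 < p" and p1: "p < 1"
begin

definition B :: "bool stream measure" where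
  "B = stream_space (measure_pmf (bernoulli_pmf p))"

lemma prob_space_B: "prob_space B"
  unfolding B_def by (rule prob_space.prob_space_stream_space[OF prob_space_measure_pmf])

sublocale B: prob_space B by (rule prob_space_B)

lemma sets_B: "sets B = sets (stream_space (count_space UNIV))"
  unfolding B_def by (rule sets_stream_space_cong) simp

lemma measurable_stake_fun [measurable]: "(\<lambda>\<omega>. f (stake n \<omega>) :: real) \<in> borel_measurable B"
proof -
  have "stake n \<in> measurable B (count_space UNIV)"
    using measurable_stake[of n, where 'a = bool] measurable_cong_sets[OF sets_B refl] by blast
  then show ?thesis by (rule measurable_compose) simp
qed

lemma integrable_stake: "integrable B (\<lambda>\<omega>. f (stake n \<omega>) :: real)"
proof -
  obtain C where "\<And>l. length l = n \<Longrightarrow> \<bar>f l\<bar> \<le> C" using ex_finite_list_bound by blast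
  then show ?thesis by (intro B.integrable_const_bound[of _ C]) auto
qed

text \<open>A function of the past and the next coin is a function of a longer prefix; such
  functions take finitely many values, which settles measurability and integrability
  throughout.\<close>

lemma stake_Suc_fun: "f (stake n \<omega>) (\<omega> !! n) = (\<lambda>l. f (take n l) (l ! n)) (stake (Suc n) \<omega>)"
  by (simp add: stake_Suc take_stake nth_append del: stake.simps)

lemma integrable_stake_snth: "integrable B (\<lambda>\<omega>. f (stake n \<omega>) (\<omega> !! n) :: real)"
  unfolding stake_Suc_fun by (rule integrable_stake)

lemma measurable_stake_snth [measurable]: "(\<lambda>\<omega>. f (stake n \<omega>) (\<omega> !! n) :: real) \<in> borel_measurable B"
  using integrable_stake_snth by (rule borel_measurable_integrable)

text \<open>Independence of the next coin from the past. The induction splits off the first coin and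
  absorbs it into \<open>g\<close>, and working with nonnegative integrals avoids side
  conditions.\<close>

lemma nn_integral_coin:
  "(\<integral>\<^sup>+\<omega>. ennreal (g (stake n \<omega>) * of_bool (\<omega> !! n)) \<partial>B) = ennreal p * (\<integral>\<^sup>+\<omega>. ennreal (g (stake n \<omega>)) \<partial>B)"
proof -
  let ?M = "measure_pmf (bernoulli_pmf p)"
  have meas: "(\<lambda>\<omega>. ennreal (f (stake n \<omega>) (\<omega> !! n))) \<in> borel_measurable (stream_space ?M)" for f n
    using measurable_stake_snth[of f n] unfolding B_def by measurable
  show ?thesis
  proof (induction n arbitrary: g)
    case 0
    have "(\<integral>\<^sup>+\<omega>. ennreal (g (stake 0 \<omega>) * of_bool (\<omega> !! 0)) \<partial>B)
        = (\<integral>\<^sup>+x. (\<integral>\<^sup>+\<omega>. ennreal (g [] * of_bool x) \<partial>B) \<partial>?M)"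
      unfolding B_def by (subst prob_space.nn_integral_stream_space[OF prob_space_measure_pmf meas]) simp
    also have "\<dots> = (\<integral>\<^sup>+x. ennreal (g [] * of_bool x) \<partial>?M)"
      by (simp add: B.emeasure_space_1)
    also have "\<dots> = ennreal p * ennreal (g [])"
      using p0 p1 by (simp add: ennreal_mult'[symmetric] mult.commute)
    finally show ?case by (simp add: B.emeasure_space_1)
  next
    case (Suc n)
    have "(\<integral>\<^sup>+\<omega>. ennreal (g (stake (Suc n) \<omega>) * of_bool (\<omega> !! Suc n)) \<partial>B)
        = (\<integral>\<^sup>+x. (\<integral>\<^sup>+\<omega>. ennreal (g (x # stake n \<omega>) * of_bool (\<omega> !! n)) \<partial>B) \<partial>?M)"
      unfolding B_def by (subst prob_space.nn_integral_stream_space[OF prob_space_measure_pmf meas]) simp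
    also have "\<dots> = (\<integral>\<^sup>+x. ennreal p * (\<integral>\<^sup>+\<omega>. ennreal (g (x # stake n \<omega>)) \<partial>B) \<partial>?M)"
      using Suc.IH[of "\<lambda>l. g (_ # l)"] by simp
    also have "\<dots> = ennreal p * (\<integral>\<^sup>+x. (\<integral>\<^sup>+\<omega>. ennreal (g (x # stake n \<omega>)) \<partial>B) \<partial>?M)"
      by (rule nn_integral_cmult) simp
    also have "(\<integral>\<^sup>+x. (\<integral>\<^sup>+\<omega>. ennreal (g (x # stake n \<omega>)) \<partial>B) \<partial>?M) = (\<integral>\<^sup>+\<omega>. ennreal (g (stake (Suc n) \<omega>)) \<partial>B)"
      using prob_space.nn_integral_stream_space[OF prob_space_measure_pmf meas[of "\<lambda>l b. g l" "Suc n"]]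
      unfolding B_def by simp
    finally show ?case .
  qed
qed

lemma integral_coin_nonneg:
  assumes "\<And>l. g l \<ge> 0"
  shows "(\<integral>\<omega>. g (stake n \<omega>) * of_bool (\<omega> !! n) \<partial>B) = p * (\<integral>\<omega>. g (stake n \<omega>) \<partial>B)"
  using nn_integral_coin[of g n] assms p0
  by (simp add: integral_eq_nn_integral enn2real_mult measurable_stake_snth[of "\<lambda>l b. g l * of_bool b"])

definition \<xi> :: "bool \<Rightarrow> real" where "\<xi> b = of_bool b - p"

lemma \<xi>_bound: "\<bar>\<xi> b\<bar> \<le> 1"
  using p0 p1 by (cases b) (auto simp: \<xi>_def)

lemma integral_coin_centered: "(\<integral>\<omega>. g (stake n \<omega>) * \<xi> (\<omega> !! n) \<partial>B) = 0"
proof -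
  have nn: "(\<integral>\<omega>. h (stake n \<omega>) * \<xi> (\<omega> !! n) \<partial>B) = 0" if "\<And>l. h l \<ge> 0" for h
  proof -
    have "(\<integral>\<omega>. h (stake n \<omega>) * \<xi> (\<omega> !! n) \<partial>B)
        = (\<integral>\<omega>. h (stake n \<omega>) * of_bool (\<omega> !! n) - p * h (stake n \<omega>) \<partial>B)"
      by (simp add: \<xi>_def algebra_simps)
    also have "\<dots> = (\<integral>\<omega>. h (stake n \<omega>) * of_bool (\<omega> !! n) \<partial>B) - (\<integral>\<omega>. p * h (stake n \<omega>) \<partial>B)"
      by (intro Bochner_Integration.integral_diff integrable_stake
            integrable_stake_snth[of "\<lambda>l b. h l * of_bool b"] integrable_mult_right)
    finally show ?thesis using integral_coin_nonneg[of h n] that by simp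
  qed
  let ?P = "\<lambda>l. max 0 (g l)" and ?N = "\<lambda>l. max 0 (- g l)"
  have "(\<integral>\<omega>. g (stake n \<omega>) * \<xi> (\<omega> !! n) \<partial>B)
      = (\<integral>\<omega>. ?P (stake n \<omega>) * \<xi> (\<omega> !! n) - ?N (stake n \<omega>) * \<xi> (\<omega> !! n) \<partial>B)"
    by (intro Bochner_Integration.integral_cong) (auto simp: max_def)
  also have "\<dots> = (\<integral>\<omega>. ?P (stake n \<omega>) * \<xi> (\<omega> !! n) \<partial>B) - (\<integral>\<omega>. ?N (stake n \<omega>) * \<xi> (\<omega> !! n) \<partial>B)"
    by (intro Bochner_Integration.integral_diff integrable_stake_snth[of "\<lambda>l b. ?P l * \<xi> b"]
          integrable_stake_snth[of "\<lambda>l b. ?N l * \<xi> b"])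
  finally show ?thesis using nn[of ?P] nn[of ?N] by simp
qed

text \<open>A bounded predictable transform of the centered coins has fourth moments of order
  \<open>n\<^sup>2\<close>, so its averages vanish almost surely by Borel--Cantelli.\<close>

context
  fixes A :: "bool list \<Rightarrow> real"
  assumes A: "\<And>l. \<bar>A l\<bar> \<le> 1"
begin

definition S :: "nat \<Rightarrow> bool stream \<Rightarrow> real" where
  "S n \<omega> = (\<Sum>m<n. A (stake m \<omega>) * \<xi> (\<omega> !! m))"

lemma S_stake: "\<exists>h. \<forall>\<omega>. S n \<omega> = h (stake n \<omega>)"
proof (rule exI, rule allI)
  fix \<omega>
  show "S n \<omega> = (\<lambda>l. \<Sum>m<n. A (take m l) * \<xi> (l ! m)) (stake n \<omega>)"
    unfolding S_def by (intro sum.cong) (auto simp: take_stake min_def)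
qed

text \<open>Terms linear in the centered coin integrate to 0. The second moment enters the recursion
  for the fourth, hence the joint induction.\<close>

lemma S_moments: "(\<integral>\<omega>. (S n \<omega>)^2 \<partial>B) \<le> real n \<and> (\<integral>\<omega>. (S n \<omega>)^4 \<partial>B) \<le> 4 * (real n)^2"
proof (induction n)
  case 0
  show ?case by (simp add: S_def)
next
  case (Suc n)
  obtain h where h: "\<And>\<omega>. S n \<omega> = h (stake n \<omega>)" using S_stake by blast
  have Suc: "S (Suc n) \<omega> = h (stake n \<omega>) + A (stake n \<omega>) * \<xi> (\<omega> !! n)" for \<omega>
    using h by (simp add: S_def)
  have b: "\<bar>A l * \<xi> c\<bar> \<le> 1" for l c
    using mult_mono[OF A[of l] \<xi>_bound[of c]] by (simp add: abs_mult)
  have 2: "(h l + A l * \<xi> c)^2 \<le> (h l)^2 + (2 * h l * A l) * \<xi> c + 1" for l c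
  proof -
    have "(A l * \<xi> c)^2 \<le> 1" using b by (simp add: abs_square_le_1)
    then show ?thesis by (simp add: power2_sum)
  qed
  \<comment> \<open>The constants arise from the binomial expansion with an increment
    \<open>y\<close> of size at most 1: the quadratic term gives 6, the cubic one is at most
    \<open>2 * s^2 + 2\<close>, the last one at most 1.\<close>
  have 4: "(h l + A l * \<xi> c)^4 \<le> (h l)^4 + (4 * (h l)^3 * A l) * \<xi> c + 8 * (h l)^2 + 3" for l c
  proof -
    define s y where "s = h l" and "y = A l * \<xi> c"
    have y: "\<bar>y\<bar> \<le> 1" using b y_def by simp
    have y2: "y^2 \<le> 1" using y by (simp add: abs_square_le_1)
    then have y4: "y^4 \<le> 1" using power_mono[of "y^2" 1 2] by simp
    have a: "6 * s^2 * y^2 \<le> 6 * s^2" using y2 mult_left_mono[of "y^2" 1 "6 * s^2"] by simp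
    have "0 \<le> (s - y^3)^2" by simp
    then have "2 * (s * y^3) \<le> s^2 + (y^3)^2" by (simp add: power2_diff)
    moreover have "(y^3)^2 \<le> 1" using power_mono[OF y2, of 3] by (simp add: power_mult[symmetric])
    ultimately have c: "4 * s * y^3 \<le> 2 * s^2 + 2" by simp
    have "(s + y)^4 = s^4 + 4 * s^3 * y + 6 * s^2 * y^2 + 4 * s * y^3 + y^4"
      by (simp add: power4_eq_xxxx power3_eq_cube power2_eq_square algebra_simps)
    also have "\<dots> \<le> s^4 + 4 * s^3 * y + 8 * s^2 + 3" using a c y4 by linarith
    finally show ?thesis unfolding s_def y_def by (simp add: mult_ac)
  qed
  have i1: "integrable B (\<lambda>\<omega>. f (stake n \<omega>) * \<xi> (\<omega> !! n))" for f
    by (rule integrable_stake_snth[of "\<lambda>l b. f l * \<xi> b"])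
  have "(\<integral>\<omega>. (S (Suc n) \<omega>)^2 \<partial>B) \<le>
      (\<integral>\<omega>. (h (stake n \<omega>))^2 + (2 * h (stake n \<omega>) * A (stake n \<omega>)) * \<xi> (\<omega> !! n) + 1 \<partial>B)"
    unfolding Suc
    by (intro integral_mono 2 integrable_stake_snth[of "\<lambda>l b. (h l + A l * \<xi> b)^2"]
          integrable_stake_snth[of "\<lambda>l b. (h l)^2 + (2 * h l * A l) * \<xi> b + 1"])
  also have "\<dots> = (\<integral>\<omega>. (h (stake n \<omega>))^2 \<partial>B) + 1"
    using integral_coin_centered[of "\<lambda>l. 2 * h l * A l" n] i1[of "\<lambda>l. 2 * h l * A l"]
      integrable_stake[of "\<lambda>l. (h l)^2" n] by (simp add: B.prob_space)
  finally have m2: "(\<integral>\<omega>. (S (Suc n) \<omega>)^2 \<partial>B) \<le> real n + 1" using Suc.IH h by simp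
  have "(\<integral>\<omega>. (S (Suc n) \<omega>)^4 \<partial>B) \<le>
      (\<integral>\<omega>. (h (stake n \<omega>))^4 + (4 * (h (stake n \<omega>))^3 * A (stake n \<omega>)) * \<xi> (\<omega> !! n)
         + 8 * (h (stake n \<omega>))^2 + 3 \<partial>B)"
    unfolding Suc
    by (intro integral_mono 4 integrable_stake_snth[of "\<lambda>l b. (h l + A l * \<xi> b)^4"]
          integrable_stake_snth[of "\<lambda>l b. (h l)^4 + (4 * (h l)^3 * A l) * \<xi> b + 8 * (h l)^2 + 3"])
  also have "\<dots> = (\<integral>\<omega>. (h (stake n \<omega>))^4 \<partial>B) + 8 * (\<integral>\<omega>. (h (stake n \<omega>))^2 \<partial>B) + 3"
    using integral_coin_centered[of "\<lambda>l. 4 * (h l)^3 * A l" n] i1[of "\<lambda>l. 4 * (h l)^3 * A l"]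
      integrable_stake[of "\<lambda>l. (h l)^2" n] integrable_stake[of "\<lambda>l. (h l)^4" n] by (simp add: B.prob_space)
  also have "\<dots> \<le> 4 * (real n)^2 + 8 * real n + 3" using Suc.IH h by simp
  also have "\<dots> \<le> 4 * (real (Suc n))^2" by (simp add: power2_eq_square algebra_simps)
  finally show ?case using m2 by simp
qed

lemma S_average_zero: "AE \<omega> in B. (\<lambda>n. S n \<omega> / real n) \<longlonglongrightarrow> 0"
proof -
  have int4: "integrable B (\<lambda>\<omega>. (S n \<omega> / real n)^4)" for n
  proof -
    obtain h where "\<And>\<omega>. S n \<omega> = h (stake n \<omega>)" using S_stake by blast
    then show ?thesis using integrable_stake[of "\<lambda>l. (h l / real n)^4" n] by simp
  qed
  have meas4: "(\<lambda>\<omega>. ennreal ((S n \<omega> / real n)^4)) \<in> borel_measurable B" for n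
    using borel_measurable_integrable[OF int4] by measurable
  have E: "(\<integral>\<^sup>+\<omega>. ennreal ((S n \<omega> / real n)^4) \<partial>B) \<le> ennreal (4 * inverse ((real n)^2))" for n
  proof -
    have "(\<integral>\<omega>. (S n \<omega> / real n)^4 \<partial>B) = (\<integral>\<omega>. (S n \<omega>)^4 \<partial>B) / (real n)^4" by (simp add: power_divide)
    also have "\<dots> \<le> 4 * (real n)^2 / (real n)^4" using S_moments[of n] by (intro divide_right_mono) auto
    also have "\<dots> \<le> 4 * inverse ((real n)^2)" by (cases "n = 0") (auto simp: field_simps power4_eq_xxxx power2_eq_square)
    finally show ?thesis using int4[of n] by (subst nn_integral_eq_integral) (auto intro: ennreal_leI)
  qed
  have "summable (\<lambda>n. 4 * inverse ((real n)^2))"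
    by (intro summable_mult inverse_power_summable) simp
  then have fin: "(\<Sum>n. ennreal (4 * inverse ((real n)^2))) \<noteq> \<infinity>"
    by (subst suminf_ennreal2) auto
  have "(\<integral>\<^sup>+\<omega>. (\<Sum>n. ennreal ((S n \<omega> / real n)^4)) \<partial>B) = (\<Sum>n. (\<integral>\<^sup>+\<omega>. ennreal ((S n \<omega> / real n)^4) \<partial>B))"
    by (intro nn_integral_suminf meas4)
  also have "\<dots> \<le> (\<Sum>n. ennreal (4 * inverse ((real n)^2)))" by (intro suminf_le E) auto
  finally have "(\<integral>\<^sup>+\<omega>. (\<Sum>n. ennreal ((S n \<omega> / real n)^4)) \<partial>B) \<noteq> \<infinity>"
    using fin neq_top_trans unfolding infinity_ennreal_def by blast
  then have "AE \<omega> in B. (\<Sum>n. ennreal ((S n \<omega> / real n)^4)) \<noteq> \<infinity>"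
    by (intro nn_integral_PInf_AE borel_measurable_suminf_order meas4)
  then show ?thesis
  proof (rule AE_mp, intro AE_I2 impI)
    fix \<omega> assume "(\<Sum>n. ennreal ((S n \<omega> / real n)^4)) \<noteq> \<infinity>"
    then have "summable (\<lambda>n. (S n \<omega> / real n)^4)" by (intro summable_suminf_not_top) auto
    then have "(\<lambda>n. (S n \<omega> / real n)^4) \<longlonglongrightarrow> 0" by (rule summable_LIMSEQ_zero)
    then show "(\<lambda>n. S n \<omega> / real n) \<longlonglongrightarrow> 0"
      using power_tendsto_0_iff[of 4 "\<lambda>n. S n \<omega> / real n" sequentially] by simp
  qed
qed

end

end

section \<open>Stationary vectors of finite irreducible chains\<close>

definition step_prob :: "real \<Rightarrow> ('s \<Rightarrow> 's) \<Rightarrow> ('s \<Rightarrow> 's) \<Rightarrow> 's \<Rightarrow> 's \<Rightarrow> real" where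
  "step_prob p mv st x y = p * of_bool (y = mv x) + (1 - p) * of_bool (y = st x)"

definition stationary :: "'s set \<Rightarrow> ('s \<Rightarrow> 's \<Rightarrow> real) \<Rightarrow> ('s \<Rightarrow> real) \<Rightarrow> bool" where
  "stationary X T \<pi> \<longleftrightarrow> (\<forall>x. \<pi> x \<ge> 0) \<and> (\<forall>x. x \<notin> X \<longrightarrow> \<pi> x = 0) \<and> (\<Sum>x\<in>X. \<pi> x) = 1
     \<and> (\<forall>y\<in>X. (\<Sum>x\<in>X. \<pi> x * T x y) = \<pi> y)"

lemma finite_Bolzano_Weierstrass:
  fixes f :: "nat \<Rightarrow> 's \<Rightarrow> real"
  assumes "finite X" "\<And>n x. x \<in> X \<Longrightarrow> \<bar>f n x\<bar> \<le> 1"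
  shows "\<exists>r l. strict_mono (r :: nat \<Rightarrow> nat) \<and> (\<forall>x\<in>X. (\<lambda>n. f (r n) x) \<longlonglongrightarrow> l x)"
  using assms
proof (induction X rule: finite_induct)
  case empty
  show ?case by (intro exI[of _ id]) (auto simp: strict_mono_def)
next
  case (insert a X)
  then obtain r l where r: "strict_mono r" and l: "\<forall>x\<in>X. (\<lambda>n. f (r n) x) \<longlonglongrightarrow> l x" by auto
  have "bounded (range (\<lambda>n. f (r n) a))" using insert.prems by (auto simp: bounded_iff)
  then obtain m s where s: "strict_mono s" and m: "((\<lambda>n. f (r n) a) \<circ> s) \<longlonglongrightarrow> m"
    using bounded_imp_convergent_subsequence by blast
  have "(\<lambda>n. f ((r \<circ> s) n) x) \<longlonglongrightarrow> (l(a := m)) x" if "x \<in> insert a X" for x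
  proof (cases "x = a")
    case True
    then show ?thesis using m by (simp add: comp_def)
  next
    case False
    then have "((\<lambda>n. f (r n) x) \<circ> s) \<longlonglongrightarrow> l x" using l that LIMSEQ_subseq_LIMSEQ s by blast
    then show ?thesis using False by (simp add: comp_def)
  qed
  then show ?case using strict_mono_o[OF r s] by blast
qed

locale finite_irreducible =
  fixes X :: "'s set" and T :: "'s \<Rightarrow> 's \<Rightarrow> real"
  assumes fin: "finite X" and T0: "\<And>x y. x \<in> X \<Longrightarrow> y \<in> X \<Longrightarrow> T x y \<ge> 0"
    and irr: "\<And>x y. x \<in> X \<Longrightarrow> y \<in> X \<Longrightarrow> (x, y) \<in> {(a, b). a \<in> X \<and> b \<in> X \<and> T a b > 0}\<^sup>*"
begin

text \<open>Positivity spreads along every path of positive transitions. No normalisation is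
  required, so that the lemma also applies to differences of stationary vectors.\<close>

lemma invariant_pos:
  assumes nn: "\<And>x. x \<in> X \<Longrightarrow> \<nu> x \<ge> 0" and inv: "\<And>y. y \<in> X \<Longrightarrow> (\<Sum>x\<in>X. \<nu> x * T x y) = \<nu> y"
    and x: "x \<in> X" "\<nu> x > 0" and y: "y \<in> X"
  shows "\<nu> y > 0"
  using irr[OF x(1) y]
proof (induction rule: rtrancl_induct)
  case base
  show ?case by (rule x)
next
  case (step a b)
  then have ab: "a \<in> X" "b \<in> X" "T a b > 0" by auto
  have "(\<Sum>x\<in>X. \<nu> x * T x b) > 0"
    using ab step nn T0 by (intro sum_pos2[OF fin, of a]) auto
  then show ?case using inv ab by simp
qed

lemma stationary_pos: assumes s: "stationary X T \<pi>" and y: "y \<in> X" shows "\<pi> y > 0"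
proof -
  have "(\<Sum>x\<in>X. \<pi> x) \<noteq> 0" using s unfolding stationary_def by simp
  then obtain x where "x \<in> X" "\<pi> x \<noteq> 0" by (meson sum.neutral)
  then have "x \<in> X" "\<pi> x > 0" using s unfolding stationary_def by (auto simp: less_le)
  then show ?thesis using invariant_pos[of \<pi> x y] s y unfolding stationary_def by auto
qed

text \<open>Subtract from \<open>\<pi>\<close> the largest multiple of \<open>\<mu>\<close> that
  leaves a nonnegative vector. The rest is invariant and vanishes somewhere, hence everywhere on
  \<open>X\<close>, and the total mass forces the factor to be 1.\<close>

lemma stationary_unique: assumes s: "stationary X T \<pi>" and t: "stationary X T \<mu>" shows "\<pi> = \<mu>"
proof -
  have ne: "X \<noteq> {}" using s unfolding stationary_def by auto
  define c where "c = Min ((\<lambda>x. \<pi> x / \<mu> x) ` X)"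
  have "c \<in> (\<lambda>x. \<pi> x / \<mu> x) ` X" unfolding c_def using fin ne by (intro Min_in) auto
  then obtain z where z: "z \<in> X" "c = \<pi> z / \<mu> z" by blast
  define \<nu> where "\<nu> x = \<pi> x - c * \<mu> x" for x
  have nn: "\<nu> x \<ge> 0" if "x \<in> X" for x
  proof -
    have "c \<le> \<pi> x / \<mu> x" unfolding c_def using fin that by simp
    then show ?thesis using stationary_pos[OF t that] by (simp add: \<nu>_def field_simps)
  qed
  have inv: "(\<Sum>x\<in>X. \<nu> x * T x y) = \<nu> y" if "y \<in> X" for y
  proof -
    have "(\<Sum>x\<in>X. \<nu> x * T x y) = (\<Sum>x\<in>X. \<pi> x * T x y) - c * (\<Sum>x\<in>X. \<mu> x * T x y)"
      by (simp add: \<nu>_def algebra_simps sum_subtractf sum_distrib_left)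
    then show ?thesis using s t that unfolding stationary_def \<nu>_def by simp
  qed
  have "\<nu> z = 0" using z stationary_pos[OF t z(1)] by (simp add: \<nu>_def)
  then have \<nu>0: "\<nu> x = 0" if "x \<in> X" for x
    using invariant_pos[of \<nu> x z] nn inv that z by (metis less_eq_real_def less_irrefl)
  have "(\<Sum>x\<in>X. \<nu> x) = (\<Sum>x\<in>X. \<pi> x) - c * (\<Sum>x\<in>X. \<mu> x)"
    by (simp add: \<nu>_def sum_subtractf sum_distrib_left)
  then have "c = 1" using \<nu>0 s t unfolding stationary_def by simp
  then have "\<pi> x = \<mu> x" for x using \<nu>0[of x] s t unfolding stationary_def \<nu>_def by (cases "x \<in> X") auto
  then show ?thesis by auto
qed

text \<open>By compactness every subsequence has a further subsequence with a stationary limit.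
  Uniqueness makes all these limits equal, so the whole sequence converges.\<close>

lemma almost_invariant_converges:
  assumes L0: "\<And>n x. L n x \<ge> 0" and L1: "\<And>n. (\<Sum>x\<in>X. L n x) = 1"
    and Linv: "\<And>y. y \<in> X \<Longrightarrow> (\<lambda>n. (\<Sum>x\<in>X. L n x * T x y) - L n y) \<longlonglongrightarrow> 0"
  shows "\<exists>\<pi>. stationary X T \<pi> \<and> (\<forall>x\<in>X. (\<lambda>n. L n x) \<longlonglongrightarrow> \<pi> x)"
proof -
  have bd: "\<bar>L n x\<bar> \<le> 1" if "x \<in> X" for n x
    using member_le_sum[of x X "L n"] L0 L1[of n] fin that by simp
  have sub: "\<exists>r' \<pi>. strict_mono r' \<and> stationary X T \<pi> \<and> (\<forall>x\<in>X. (\<lambda>n. L (r (r' n)) x) \<longlonglongrightarrow> \<pi> x)"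
    if r: "strict_mono r" for r :: "nat \<Rightarrow> nat"
  proof -
    obtain r' l where r': "strict_mono r'" and l: "\<forall>x\<in>X. (\<lambda>n. L (r (r' n)) x) \<longlonglongrightarrow> l x"
      using finite_Bolzano_Weierstrass[OF fin, of "\<lambda>n. L (r n)"] bd by blast
    define \<pi> where "\<pi> x = (if x \<in> X then l x else 0)" for x
    have lim: "(\<lambda>n. L (r (r' n)) x) \<longlonglongrightarrow> \<pi> x" if "x \<in> X" for x using l that by (simp add: \<pi>_def)
    have "stationary X T \<pi>" unfolding stationary_def
    proof (intro conjI allI ballI impI)
      show "\<pi> x \<ge> 0" for x
      proof (cases "x \<in> X")
        case True
        then show ?thesis using lim LIMSEQ_le_const[OF lim[OF True], of 0] L0 by blast
      qed (simp add: \<pi>_def)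
      show "\<pi> x = 0" if "x \<notin> X" for x using that by (simp add: \<pi>_def)
      have "(\<lambda>n. \<Sum>x\<in>X. L (r (r' n)) x) \<longlonglongrightarrow> (\<Sum>x\<in>X. \<pi> x)" by (intro tendsto_sum lim)
      then show "(\<Sum>x\<in>X. \<pi> x) = 1" using L1 LIMSEQ_unique[OF _ tendsto_const] by simp
      fix y assume y: "y \<in> X"
      have "(\<lambda>n. (\<Sum>x\<in>X. L (r (r' n)) x * T x y) - L (r (r' n)) y) \<longlonglongrightarrow> (\<Sum>x\<in>X. \<pi> x * T x y) - \<pi> y"
        by (intro tendsto_diff tendsto_sum tendsto_mult_right lim y)
      moreover have "(\<lambda>n. (\<Sum>x\<in>X. L (r (r' n)) x * T x y) - L (r (r' n)) y) \<longlonglongrightarrow> 0"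
        using LIMSEQ_subseq_LIMSEQ[OF Linv[OF y] strict_mono_o[OF r r']] by (simp add: comp_def)
      ultimately show "(\<Sum>x\<in>X. \<pi> x * T x y) = \<pi> y" using LIMSEQ_unique by fastforce
    qed
    then show ?thesis using r' lim by blast
  qed
  obtain \<pi> where \<pi>: "stationary X T \<pi>" using sub[of id] by (auto simp: strict_mono_def)
  have "(\<lambda>n. L n x) \<longlonglongrightarrow> \<pi> x" if x: "x \<in> X" for x
  proof (rule ccontr)
    assume "\<not> ?thesis"
    then obtain e where e: "e > 0" and "\<not> (\<exists>N. \<forall>n\<ge>N. dist (L n x) (\<pi> x) < e)"
      unfolding lim_sequentially by blast
    then have "\<exists>n\<ge>N. dist (L n x) (\<pi> x) \<ge> e" for N by (meson not_less)
    then have "infinite {n. dist (L n x) (\<pi> x) \<ge> e}" by (auto simp: infinite_nat_iff_unbounded_le)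
    then obtain r :: "nat \<Rightarrow> nat" where r: "strict_mono r" "\<And>n. dist (L (r n) x) (\<pi> x) \<ge> e"
      using infinite_enumerate by blast
    obtain r' \<mu> where \<mu>: "stationary X T \<mu>" "(\<lambda>n. L (r (r' n)) x) \<longlonglongrightarrow> \<mu> x" using sub[OF r(1)] x by blast
    have "\<mu> = \<pi>" using stationary_unique \<mu> \<pi> by blast
    then have "(\<lambda>n. L (r (r' n)) x) \<longlonglongrightarrow> \<pi> x" using \<mu> by simp
    then have "\<exists>n. dist (L (r (r' n)) x) (\<pi> x) < e" using e unfolding lim_sequentially by blast
    then show False using r(2) by (meson not_less)
  qed
  then show ?thesis using \<pi> by blast
qed

end

section \<open>Ergodic averages along a coin sequence\<close>

primrec chain :: "('s \<Rightarrow> 's) \<Rightarrow> ('s \<Rightarrow> 's) \<Rightarrow> 's \<Rightarrow> bool stream \<Rightarrow> nat \<Rightarrow> 's" where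
  "chain mv st x \<omega> 0 = x"
| "chain mv st x \<omega> (Suc n) = (if \<omega> !! n then mv else st) (chain mv st x \<omega> n)"

lemma chain_stake: "chain mv st x \<omega> n = fold (\<lambda>b. if b then mv else st) (stake n \<omega>) x"
  by (induction n) (simp_all add: stake_Suc del: stake.simps(2))

text \<open>Visits are counted together with the coin because a wall is crossed only when the coin
  shows \<open>True\<close>; this yields the factor \<open>p\<close>. The argument is deterministic
  for each \<open>\<omega>\<close> along which the averages of \<open>S\<close> vanish.\<close>

theorem (in coin_space) ergodic:
  assumes irr: "finite_irreducible X (step_prob p mv st)"
    and x0: "x0 \<in> X" and mv: "\<And>x. x \<in> X \<Longrightarrow> mv x \<in> X" and st: "\<And>x. x \<in> X \<Longrightarrow> st x \<in> X"
  shows "\<exists>\<pi>. stationary X (step_prob p mv st) \<pi> \<and> (AE \<omega> in B. \<forall>x\<in>X.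
    (\<lambda>n. (\<Sum>m<n. of_bool (chain mv st x0 \<omega> m = x \<and> \<omega> !! m)) / real n) \<longlonglongrightarrow> p * \<pi> x)"
proof -
  interpret finite_irreducible X "step_prob p mv st" by (rule irr)
  define Y where "Y = chain mv st x0"
  define A where "A x l = (of_bool (fold (\<lambda>b. if b then mv else st) l x0 = x) :: real)" for x l
  have A: "\<bar>A x l\<bar> \<le> 1" for x l by (simp add: A_def)
  have AY: "A x (stake m \<omega>) = of_bool (Y \<omega> m = x)" for x m \<omega> by (simp add: A_def Y_def chain_stake)
  have YX: "Y \<omega> m \<in> X" for \<omega> m unfolding Y_def by (induction m) (auto simp: x0 mv st)
  have AE0: "AE \<omega> in B. \<forall>x\<in>X. (\<lambda>n. S (A x) n \<omega> / real n) \<longlonglongrightarrow> 0"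
    using fin S_average_zero[of "A _"] A by (intro AE_finite_allI) auto
  have conv: "\<exists>\<pi>. stationary X (step_prob p mv st) \<pi> \<and> (\<forall>x\<in>X.
      (\<lambda>n. (\<Sum>m<n. of_bool (Y \<omega> m = x \<and> \<omega> !! m)) / real n) \<longlonglongrightarrow> p * \<pi> x)"
    if S0: "\<forall>x\<in>X. (\<lambda>n. S (A x) n \<omega> / real n) \<longlonglongrightarrow> 0" for \<omega>
  proof -
    \<comment> \<open>With \<open>Suc n\<close> observations the denominator is never 0, so the
      weights sum to 1 for every \<open>n\<close>.\<close>
    define L where "L n x = (\<Sum>m<Suc n. of_bool (Y \<omega> m = x)) / real (Suc n)" for n x
    have L0: "L n x \<ge> 0" for n x unfolding L_def by (intro divide_nonneg_nonneg sum_nonneg) auto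
    have "(\<Sum>x\<in>X. L n x) = 1" for n
    proof -
      have "(\<Sum>x\<in>X. L n x) = (\<Sum>m<Suc n. (\<Sum>x\<in>X. of_bool (Y \<omega> m = x))) / real (Suc n)"
        unfolding L_def sum_divide_distrib[symmetric] by (subst sum.swap) simp
      also have "\<dots> = (\<Sum>m<Suc n. 1) / real (Suc n)"
        using YX[of \<omega>] fin by (simp add: of_bool_def sum.delta' del: sum.lessThan_Suc)
      finally show ?thesis by simp
    qed
    note L1 = this
    define D where "D y x = (of_bool (y = mv x) - of_bool (y = st x) :: real)" for y x
    have Linv: "(\<lambda>n. (\<Sum>x\<in>X. L n x * step_prob p mv st x y) - L n y) \<longlonglongrightarrow> 0" if y: "y \<in> X" for y
    proof -
      \<comment> \<open>The indicator of the next state is its conditional probability plus a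
        martingale increment: exchanging \<open>True\<close> for \<open>False\<close> changes it by
        \<open>D y x\<close>, weighted by the centered coin.\<close>
      have step: "of_bool (Y \<omega> (Suc m) = y) =
          (\<Sum>x\<in>X. of_bool (Y \<omega> m = x) * step_prob p mv st x y) + (\<Sum>x\<in>X. D y x * (of_bool (Y \<omega> m = x) * \<xi> (\<omega> !! m)))" for m
      proof -
        have "(\<Sum>x\<in>X. of_bool (Y \<omega> m = x) * f x) = f (Y \<omega> m)" for f :: "'a \<Rightarrow> real"
          using YX[of \<omega> m] fin by (simp add: of_bool_def if_distrib[of "\<lambda>c. c * _"] sum.delta' cong: if_cong)
        from this[of "\<lambda>x. step_prob p mv st x y"] this[of "\<lambda>x. D y x * \<xi> (\<omega> !! m)"]
        show ?thesis unfolding Y_def by (auto simp: step_prob_def D_def \<xi>_def mult_ac algebra_simps)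
      qed
      have sumstep: "(\<Sum>m<Suc n. of_bool (Y \<omega> (Suc m) = y)) =
          (\<Sum>x\<in>X. (\<Sum>m<Suc n. of_bool (Y \<omega> m = x)) * step_prob p mv st x y) + (\<Sum>x\<in>X. D y x * S (A x) (Suc n) \<omega>)" for n
        unfolding step S_def[OF A] AY sum.distrib sum_distrib_left sum_distrib_right
        by (intro arg_cong2[where f = "(+)"] sum.swap)
      have shift: "(\<Sum>m<Suc n. of_bool (Y \<omega> (Suc m) = y)) =
          (\<Sum>m<Suc n. of_bool (Y \<omega> m = y)) + (of_bool (Y \<omega> (Suc n) = y) - of_bool (Y \<omega> 0 = y) :: real)" for n
        by (induction n) auto
      have eq: "(\<Sum>x\<in>X. L n x * step_prob p mv st x y) - L n y =
          (of_bool (Y \<omega> (Suc n) = y) - of_bool (Y \<omega> 0 = y)) / real (Suc n)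
          - (\<Sum>x\<in>X. D y x * (S (A x) (Suc n) \<omega> / real (Suc n)))" for n
      proof -
        have "(\<Sum>x\<in>X. L n x * step_prob p mv st x y) - L n y =
           ((\<Sum>x\<in>X. (\<Sum>m<Suc n. of_bool (Y \<omega> m = x)) * step_prob p mv st x y)
             - (\<Sum>m<Suc n. of_bool (Y \<omega> m = y))) / real (Suc n)"
          by (simp add: L_def sum_divide_distrib diff_divide_distrib del: sum.lessThan_Suc of_nat_Suc)
        also have "(\<Sum>x\<in>X. (\<Sum>m<Suc n. of_bool (Y \<omega> m = x)) * step_prob p mv st x y)
             - (\<Sum>m<Suc n. of_bool (Y \<omega> m = y)) =
             (of_bool (Y \<omega> (Suc n) = y) - of_bool (Y \<omega> 0 = y)) - (\<Sum>x\<in>X. D y x * S (A x) (Suc n) \<omega>)"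
          using sumstep[of n] shift[of n] by linarith
        finally show ?thesis
          by (simp add: diff_divide_distrib sum_divide_distrib del: of_nat_Suc)
      qed
      have "(\<lambda>n. (of_bool (Y \<omega> (Suc n) = y) - of_bool (Y \<omega> 0 = y)) / real (Suc n)) \<longlonglongrightarrow> 0"
      proof (rule Lim_null_comparison[OF always_eventually LIMSEQ_inverse_real_of_nat], rule allI)
        fix n
        show "norm ((of_bool (Y \<omega> (Suc n) = y) - of_bool (Y \<omega> 0 = y)) / real (Suc n)) \<le> inverse (real (Suc n))"
          by (simp add: field_simps)
      qed
      moreover have "(\<lambda>n. \<Sum>x\<in>X. D y x * (S (A x) (Suc n) \<omega> / real (Suc n))) \<longlonglongrightarrow> (\<Sum>x\<in>X. D y x * 0)"
        using S0 by (intro tendsto_sum tendsto_mult_left LIMSEQ_Suc[of "\<lambda>n. S (A _) n \<omega> / real n"]) auto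
      ultimately have "(\<lambda>n. (of_bool (Y \<omega> (Suc n) = y) - of_bool (Y \<omega> 0 = y)) / real (Suc n)
          - (\<Sum>x\<in>X. D y x * (S (A x) (Suc n) \<omega> / real (Suc n)))) \<longlonglongrightarrow> 0 - (\<Sum>x\<in>X. D y x * 0)"
        by (rule tendsto_diff)
      then show ?thesis unfolding eq by simp
    qed
    obtain \<pi> where \<pi>: "stationary X (step_prob p mv st) \<pi>" and lim: "\<forall>x\<in>X. (\<lambda>n. L n x) \<longlonglongrightarrow> \<pi> x"
      using almost_invariant_converges[OF L0 L1 Linv] by blast
    have "(\<lambda>n. (\<Sum>m<n. of_bool (Y \<omega> m = x \<and> \<omega> !! m)) / real n) \<longlonglongrightarrow> p * \<pi> x" if x: "x \<in> X" for x
    proof (rule LIMSEQ_imp_Suc)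
      have "(\<Sum>m<Suc n. of_bool (Y \<omega> m = x \<and> \<omega> !! m)) / real (Suc n) = S (A x) (Suc n) \<omega> / real (Suc n) + p * L n x" for n
      proof -
        have "of_bool (Y \<omega> m = x \<and> \<omega> !! m) = A x (stake m \<omega>) * \<xi> (\<omega> !! m) + p * of_bool (Y \<omega> m = x)" for m
          unfolding AY \<xi>_def by auto
        then have "(\<Sum>m<Suc n. of_bool (Y \<omega> m = x \<and> \<omega> !! m)) = S (A x) (Suc n) \<omega> + p * (\<Sum>m<Suc n. of_bool (Y \<omega> m = x))"
          unfolding S_def[OF A] sum_distrib_left sum.distrib[symmetric] by (intro sum.cong) auto
        then show ?thesis by (simp add: L_def add_divide_distrib del: sum.lessThan_Suc of_nat_Suc)
      qed
      moreover have "(\<lambda>n. S (A x) (Suc n) \<omega> / real (Suc n) + p * L n x) \<longlonglongrightarrow> 0 + p * \<pi> x"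
        using S0 lim x by (intro tendsto_add tendsto_mult_left LIMSEQ_Suc[of "\<lambda>n. S (A x) n \<omega> / real n"]) auto
      ultimately show "(\<lambda>n. (\<Sum>m<Suc n. of_bool (Y \<omega> m = x \<and> \<omega> !! m)) / real (Suc n)) \<longlonglongrightarrow> p * \<pi> x"
        by simp
    qed
    then show ?thesis using \<pi> by blast
  qed
  \<comment> \<open>One good coin sequence fixes \<open>\<pi>\<close>; uniqueness then makes it the
    limit for all good sequences.\<close>
  obtain \<omega> where "\<forall>x\<in>X. (\<lambda>n. S (A x) n \<omega> / real n) \<longlonglongrightarrow> 0"
    using eventually_happens'[OF _ AE0] by (auto simp: ae_filter_eq_bot_iff B.emeasure_space_1)
  then obtain \<pi> where \<pi>: "stationary X (step_prob p mv st) \<pi>" using conv by blast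
  have "AE \<omega> in B. \<forall>x\<in>X. (\<lambda>n. (\<Sum>m<n. of_bool (Y \<omega> m = x \<and> \<omega> !! m)) / real n) \<longlonglongrightarrow> p * \<pi> x"
    using AE0
  proof (rule AE_mp, intro AE_I2 impI)
    fix \<omega> assume "\<forall>x\<in>X. (\<lambda>n. S (A x) n \<omega> / real n) \<longlonglongrightarrow> 0"
    from conv[OF this] show "\<forall>x\<in>X. (\<lambda>n. (\<Sum>m<n. of_bool (Y \<omega> m = x \<and> \<omega> !! m)) / real n) \<longlonglongrightarrow> p * \<pi> x"
      using stationary_unique[OF \<pi>] by metis
  qed
  then show ?thesis using \<pi> unfolding Y_def by blast
qed

section \<open>The chains of alcoves\<close>

lemma extreme_points_of_linear_image:
  assumes "linear f" "inj f"
  shows "{x. x extreme_point_of (f ` S)} = f ` {x. x extreme_point_of S}"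
proof -
  have "f x extreme_point_of (f ` S) \<longleftrightarrow> x extreme_point_of S" for x
    by (simp add: extreme_point_of_def open_segment_linear_image[OF assms] inj_image_mem_iff[OF assms(2)])
  moreover have "x \<in> f ` S" if "x extreme_point_of (f ` S)" for x
    using that by (simp add: extreme_point_of_def)
  ultimately show ?thesis by blast
qed

context based_root_system
begin

lemma polyhedron_fund_alcove: "polyhedron (fund_alcove R D)"
proof -
  have "fund_alcove R D = \<Inter>((\<lambda>i. {x. wall_root R D i \<bullet> x \<ge> wall_level i}) ` idx D)"
    using fund_alcove_wall[of _ R D] by (auto simp: inner_commute)
  moreover have "finite (idx D)" using finite_D by (simp add: idx_def)
  ultimately show ?thesis using polyhedron_halfspace_ge by (auto intro!: polyhedron_Inter)
qed

text \<open>An affine bijection carries extreme points to extreme points and barycentre to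
  barycentre. Compactness of the alcove is needed to know that there are extreme points, so that the
  translation part keeps weight 1.\<close>

lemma center_alcove:
  assumes u: "u \<in> affine_weyl R D" shows "center (alcove R D u) = u (center (fund_alcove R D))"
proof -
  define E where "E = {x. x extreme_point_of (fund_alcove R D)}"
  have fin: "finite E" unfolding E_def by (rule finite_polyhedron_extreme_points[OF polyhedron_fund_alcove])
  have "bounded (fund_alcove R D)" using fund_alcove_bounded unfolding bounded_iff .
  then have "compact (fund_alcove R D)"
    using polyhedron_imp_closed[OF polyhedron_fund_alcove] compact_eq_bounded_closed by blast
  moreover have "(0::'v) \<in> fund_alcove R D" by (simp add: fund_alcove_def fund_chamber_def)
  ultimately have "E \<noteq> {}" unfolding E_def
    using extreme_point_exists_convex[OF _ polyhedron_imp_convex[OF polyhedron_fund_alcove]] by blast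
  then have card: "real (card E) \<noteq> 0" using fin by simp
  define l c where "l = lin_part u" and "c = u 0"
  have l: "linear l" unfolding l_def by (rule lin_part_linear[OF u])
  obtain w' where "\<And>x. w' (l x) = x" unfolding l_def using weyl_inverse[OF lin_part_weyl[OF u]] by metis
  then have inj: "inj l" by (rule inj_on_inverseI)
  have ux: "u x = c + l x" for x unfolding l_def c_def using affine_eq[OF u, of x] by (simp add: add.commute)
  have img: "u ` S = (\<lambda>x. c + x) ` l ` S" for S by (auto simp: ux image_image)
  have ext: "{x. x extreme_point_of alcove R D u} = u ` E"
    unfolding alcove_def img extreme_points_of_translation extreme_points_of_linear_image[OF l inj] E_def ..
  have inju: "inj_on u E" using inj by (auto simp: inj_on_def ux)
  have "(\<Sum>x\<in>u ` E. x) = (\<Sum>x\<in>E. c + l x)" unfolding sum.reindex[OF inju] by (simp add: ux)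
  also have "\<dots> = real (card E) *\<^sub>R c + l (\<Sum>x\<in>E. x)"
    by (simp add: sum.distrib linear_sum[OF l] sum_constant_scaleR)
  finally have "center (alcove R D u) = c + l ((1 / real (card E)) *\<^sub>R (\<Sum>x\<in>E. x))"
    unfolding center_def ext card_image[OF inju] using card
    by (simp add: scaleR_right_distrib linear_scale[OF l])
  then show ?thesis unfolding ux center_def E_def .
qed

lemma lin_part_comp:
  assumes w: "w \<in> weyl R D" and v: "v \<in> affine_weyl R D"
  shows "lin_part (w \<circ> v) = w \<circ> lin_part v"
  using linear_diff[OF weyl_linear[OF w]] by (auto simp: lin_part_def)

lemma weyl_sgn: assumes "w \<in> weyl R D" shows "sgn (w x) = w (sgn x)"
proof -
  have "norm (w x) = norm x" using weyl_inner[OF assms] by (simp add: norm_eq_sqrt_inner)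
  then show ?thesis by (simp add: sgn_div_norm linear_scale[OF weyl_linear[OF assms]])
qed

end

context based_root_system_point
begin

text \<open>The linear hyperplanes between the alcove and the fundamental chamber. Their number
  serves as the monovariant that stops the changes of chamber.\<close>

definition inversions :: "('v \<Rightarrow> 'v) \<Rightarrow> 'v set" where
  "inversions u = {b \<in> Pos. u z0 \<bullet> b < 0}"

lemma finite_inversions: "finite (inversions u)"
  using finite_R unfolding inversions_def pos_roots_def by simp

text \<open>Losing an inversion \<open>b\<close> would mean crossing the wall with inner normal
  \<open>- b\<close> and level 0, but a permitted crossing needs \<open>z0\<close> on the inner
  side.\<close>

lemma inversions_cross:
  assumes u: "u \<in> affine_weyl R D" and j: "j \<in> idx D" and a: "tilde_allowed R D u j"
  shows "inversions u \<subseteq> inversions (u \<circ> gen R D j)"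
proof
  fix b assume "b \<in> inversions u"
  then have b: "b \<in> Pos" "u z0 \<bullet> b < 0" unfolding inversions_def by auto
  have bR: "b \<in> R" using b Pos_R by blast
  have "u (gen R D j z0) \<bullet> b < 0"
  proof (rule ccontr)
    assume "\<not> ?thesis"
    moreover have "u (gen R D j z0) \<bullet> b \<noteq> 0" using affine_not_Ints[OF affine_gen[OF u j] bR] by auto
    ultimately have "- b = wroot u j \<and> 0 = wlevel u j"
      using crossing_unique[OF u j neg_R[OF bR], of 0] b by simp
    then have "z0 \<bullet> (- b) > 0" using a tilde_allowed_iff[OF u j] by metis
    then show False using z0_Pos[OF b(1)] by simp
  qed
  then show "b \<in> inversions (u \<circ> gen R D j)" using b unfolding inversions_def by simp
qed

text \<open>Folding an alcove into the fundamental chamber: a tilde-step either induces the hat-step with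
  the same coin, or it crosses a linear hyperplane, which changes only the chamber and creates
  an inversion.\<close>

lemma folded_step:
  assumes v: "v \<in> dominant_part R D" and w: "w \<in> weyl R D" and j: "j \<in> idx D" and u: "u = w \<circ> v"
    and v': "v' = (if hat_allowed R D v j \<and> c then v \<circ> gen R D j else v)"
    and u': "u' = (if tilde_allowed R D u j \<and> c then u \<circ> gen R D j else u)"
  shows "\<exists>w'\<in>weyl R D. u' = w' \<circ> v' \<and>
    (w' = w \<and> card (inversions u) \<le> card (inversions u') \<or> card (inversions u) < card (inversions u'))"
proof -
  have vW: "v \<in> affine_weyl R D" by (rule dominant_affine[OF v])
  have uW: "u \<in> affine_weyl R D" unfolding u by (rule affine_weyl_comp[OF vW weyl_affine[OF w]])
  let ?b = "wroot v j" and ?k = "wlevel v j"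
  have bR: "?b \<in> R" by (rule wroot_R[OF vW j])
  have wr: "wroot u j = w ?b" unfolding u lin_part_comp[OF w vW] by simp
  have wl: "wlevel u j = ?k"
    unfolding u lin_part_comp[OF w vW] by (simp add: weyl_inner[OF w])
  have ta: "tilde_allowed R D u j \<longleftrightarrow> z0 \<bullet> w ?b > ?k"
    using tilde_allowed_iff[OF uW j] unfolding wl unfolding wr .
  have mono: "card (inversions u) \<le> card (inversions u')"
    using card_mono[OF finite_inversions inversions_cross[OF uW j]] u' by auto
  have z0R: "- 1 < z0 \<bullet> b" if "b \<in> R" for b
    using Pos_cases[OF that] z0_Pos[of b] z0_Pos[of "- b"] by auto
  show ?thesis
  proof (cases "- ?b \<in> Pos")
    case True
    then have "hat_allowed R D v j" using hat_allowed_iff[OF v j] by blast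
    moreover have "tilde_allowed R D u j"
      using ta dominant_wall_neg[OF v j True] z0R[OF weyl_R[OF w bR]] by linarith
    ultimately have "u' = w \<circ> v'" unfolding u' v' u by (auto simp: comp_assoc)
    then show ?thesis using w mono by blast
  next
    case False
    then have bP: "?b \<in> Pos" using Pos_cases bR by blast
    have v'v: "v' = v" using False hat_allowed_iff[OF v j] v' by auto
    show ?thesis
    proof (cases "tilde_allowed R D u j \<and> c")
      case cross: True
      \<comment> \<open>A permitted crossing with \<open>?b\<close> positive has level 0: the level
        is nonnegative, yet it lies below the value at \<open>z0\<close> of the root
        \<open>w ?b\<close>, which is less than 1.\<close>
      obtain k where k: "?k = of_int k" using wlevel_Ints[OF vW j] Ints_cases by blast
      have wbR: "w ?b \<in> R" by (rule weyl_R[OF w bR])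
      have gt: "z0 \<bullet> w ?b > of_int k" using cross ta k by simp
      have "k \<ge> 0" using dominant_wall_Pos[OF v j bP] k by simp
      then have "z0 \<bullet> w ?b > 0" using gt by (smt (verit) of_int_nonneg)
      then have wbP: "w ?b \<in> Pos" using Pos_cases[OF wbR] z0_Pos[of "- w ?b"] by auto
      then have "k \<le> 0" using z0_Pos[OF wbP] gt by simp
      then have k0: "?k = 0" using \<open>k \<ge> 0\<close> k by simp
      \<comment> \<open>At level 0 the crossing is a linear reflection applied after
        \<open>v\<close>, so it can be absorbed into the Weyl group factor while the folded alcove
        stays.\<close>
      have "v \<circ> gen R D j = aff_refl ?b 0 \<circ> v" using affine_gen_apply[OF vW, of j] k0 by auto
      then have "u' = (w \<circ> aff_refl ?b 0) \<circ> v'" unfolding u' v'v u using cross u by (simp add: comp_assoc)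
      moreover have "w \<circ> aff_refl ?b 0 \<in> weyl R D" using weyl_comp[OF weyl_refl[OF bR] w] .
      moreover have "card (inversions u) < card (inversions u')"
      proof (rule psubset_card_mono[OF finite_inversions])
        have u'g: "u' = u \<circ> gen R D j" using cross u' by simp
        have "u z0 \<bullet> w ?b > 0" using affine_z0_wall[OF uW j] k0 unfolding wl unfolding wr by simp
        then have "w ?b \<notin> inversions u" unfolding inversions_def by simp
        moreover have "u (gen R D j z0) \<bullet> w ?b < 0"
          using affine_gen_z0_wall[OF uW j] k0 unfolding wl unfolding wr by simp
        then have "w ?b \<in> inversions u'" unfolding inversions_def u'g using wbP by simp
        ultimately show "inversions u \<subset> inversions u'"
          using inversions_cross[OF uW j] cross unfolding u'g by blast
      qed
      ultimately show ?thesis by blast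
    next
      case False
      then have "u' = w \<circ> v'" using u' u v'v by auto
      then show ?thesis using w mono by blast
    qed
  qed
qed

end

section \<open>The projected chain, its drift and the limits\<close>

locale billiard = based_root_system_point R D z0 + coin_space p
  for R D :: "'v::euclidean_space set" and z0 :: 'v and p :: real +
  fixes eta :: 'v and i :: "nat \<Rightarrow> 'v option"
  assumes generic: "generic_dir R D z0 eta" and seq: "billiard_seq R D z0 eta i"
    and irreducible: "bar_irreducible R D i (period i) p"
begin

abbreviation "N \<equiv> period i"
abbreviation "hat \<omega> M \<equiv> fst (hat_chain R D i N \<omega> M)"
abbreviation "tilde \<omega> M \<equiv> fst (tilde_chain R D i N \<omega> M)"

lemma N_pos: "N > 0" by (rule period_props(1)[OF generic seq])

lemma i_idx: "i k \<in> idx D" by (rule idx_i[OF generic seq])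

lemma snd_hat: "snd (hat_chain R D i N \<omega> M) = M mod N"
  by (induction M) (auto simp: mod_Suc_eq split: prod.split)

lemma snd_tilde: "snd (tilde_chain R D i N \<omega> M) = M mod N"
  by (induction M) (auto simp: mod_Suc_eq split: prod.split)

lemma hat_Suc: "hat \<omega> (Suc M) = (if hat_allowed R D (hat \<omega> M) (i (M mod N)) \<and> \<omega> !! M
    then hat \<omega> M \<circ> gen R D (i (M mod N)) else hat \<omega> M)"
  using snd_hat[of \<omega> M] by (auto split: prod.split)

lemma tilde_Suc: "tilde \<omega> (Suc M) = (if tilde_allowed R D (tilde \<omega> M) (i (M mod N)) \<and> \<omega> !! M
    then tilde \<omega> M \<circ> gen R D (i (M mod N)) else tilde \<omega> M)"
  using snd_tilde[of \<omega> M] by (auto split: prod.split)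

lemma id_dominant: "id \<in> dominant_part R D"
  using affine_weyl.intros(1)[of R D] z0_Pos D_Pos unfolding dominant_part_iff by simp

lemma hat_step_dominant:
  assumes "v \<in> dominant_part R D" "hat_allowed R D v (i k)" shows "v \<circ> gen R D (i k) \<in> dominant_part R D"
  using dominant_cross[OF assms(1) i_idx] hat_allowed_iff[OF assms(1) i_idx] assms(2) by blast

lemma hat_dominant: "hat \<omega> M \<in> dominant_part R D"
proof (induction M)
  case (Suc M)
  then show ?case unfolding hat_Suc using hat_step_dominant by simp
qed (simp add: id_dominant del: id_apply)

lemma hat_affine: "hat \<omega> M \<in> affine_weyl R D"
  by (rule dominant_affine[OF hat_dominant])

definition descends :: "('v \<Rightarrow> 'v) \<Rightarrow> nat \<Rightarrow> bool" where
  "descends w k \<longleftrightarrow> - w (wall_root R D (i k)) \<in> Pos"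

definition stay :: "('v \<Rightarrow> 'v) \<times> nat \<Rightarrow> ('v \<Rightarrow> 'v) \<times> nat" where
  "stay x = (fst x, Suc (snd x) mod N)"

text \<open>If the wall may not be crossed, \<open>move\<close> agrees with \<open>stay\<close>, and
  the weights \<open>p\<close> and \<open>1 - p\<close> in \<open>step_prob\<close> add up to 1
  there. Each coin thus acts as one of two total maps.\<close>

definition move :: "('v \<Rightarrow> 'v) \<times> nat \<Rightarrow> ('v \<Rightarrow> 'v) \<times> nat" where
  "move x = (if descends (fst x) (snd x)
     then (fst x \<circ> aff_refl (wall_root R D (i (snd x))) 0, Suc (snd x) mod N) else stay x)"

abbreviation "X \<equiv> bar_states R D N"
abbreviation "T \<equiv> step_prob p move stay"
abbreviation "bar \<omega> M \<equiv> chain move stay (id, 0) \<omega> M"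

lemma finite_X: "finite X"
  unfolding bar_states_def using finite_weyl by blast

lemma start_X: "(id, 0) \<in> X"
  unfolding bar_states_def using weyl.intros(1) N_pos by auto

lemma stay_X: "x \<in> X \<Longrightarrow> stay x \<in> X"
  unfolding bar_states_def stay_def using N_pos by auto

lemma move_X: "x \<in> X \<Longrightarrow> move x \<in> X"
  using stay_X[of x] weyl_comp[OF weyl_refl[OF wall_root_R[OF i_idx]]] N_pos
  unfolding bar_states_def move_def by auto

lemma hat_bar: "bar \<omega> M = (lin_part (hat \<omega> M), M mod N)"
proof (induction M)
  case 0
  show ?case by (simp add: lin_part_def id_def)
next
  case (Suc M)
  have "hat_allowed R D (hat \<omega> M) (i (M mod N)) \<longleftrightarrow> descends (lin_part (hat \<omega> M)) (M mod N)"
    unfolding descends_def by (rule hat_allowed_iff[OF hat_dominant i_idx])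
  then show ?case unfolding hat_Suc using Suc lin_part_comp_gen[OF hat_affine i_idx]
    by (simp add: move_def stay_def mod_Suc_eq)
qed

text \<open>Irreducibility provides a dominant representative of every Weyl group element: it is
  reached from the identity.\<close>

lemma rep_dominant:
  assumes "w \<in> weyl R D" shows "rep R D w \<in> dominant_part R D \<and> lin_part (rep R D w) = w"
proof -
  have rep: "rep R D w \<in> dominant_part R D \<and> lin_part (rep R D w) = w"
    if "\<exists>v. v \<in> dominant_part R D \<and> lin_part v = w" for w
    unfolding rep_def using someI_ex[OF that] .
  have "(w, 0) \<in> X" using assms N_pos unfolding bar_states_def by auto
  then have "((id, 0), (w, 0)) \<in> {(a, b). a \<in> X \<and> b \<in> X \<and> bar_trans R D i N p a b > 0}\<^sup>*"
    using irreducible start_X unfolding bar_irreducible_def by blast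
  then have "\<exists>v. v \<in> dominant_part R D \<and> lin_part v = fst (w, 0 :: nat)"
  proof (induction rule: rtrancl_induct)
    case base
    have "lin_part id = (id :: 'v \<Rightarrow> 'v)" by (auto simp: lin_part_def)
    then show ?case using id_dominant by (intro exI[of _ id]) (simp del: id_apply)
  next
    case (step x y)
    obtain w k where x: "x = (w, k)" by (cases x)
    \<comment> \<open>\<open>bar_trans\<close> is defined through this choice. The existence carried
      by the induction makes the choice meaningful at the current state and thereby at its
      successor.\<close>
    let ?v = "rep R D w"
    have v: "?v \<in> dominant_part R D" "lin_part ?v = w" using rep step x by auto
    have pos: "bar_trans R D i N p (w, k) y > 0" using step x by blast
    show ?case
    proof (cases "y = (w, Suc k mod N)")
      case True
      then show ?thesis using v by auto
    next
      case False
      then have "hat_allowed R D ?v (i k)" "y = (lin_part (?v \<circ> gen R D (i k)), Suc k mod N)"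
        using pos by (auto simp: bar_trans_def Let_def split: if_splits)
      then show ?thesis using hat_step_dominant[OF v(1)] by auto
    qed
  qed
  then show ?thesis using rep by simp
qed

lemma bar_trans_eq: assumes "x \<in> X" shows "bar_trans R D i N p x y = T x y"
proof -
  obtain w k where x: "x = (w, k)" and w: "w \<in> weyl R D" using assms unfolding bar_states_def by auto
  have v: "rep R D w \<in> dominant_part R D" "lin_part (rep R D w) = w" using rep_dominant[OF w] by auto
  have "hat_allowed R D (rep R D w) (i k) \<longleftrightarrow> descends w k"
    using hat_allowed_iff[OF v(1) i_idx] v(2) unfolding descends_def by metis
  then show ?thesis using lin_part_comp_gen[OF dominant_affine[OF v(1)] i_idx, of k] v(2)
    unfolding x bar_trans_def step_prob_def move_def stay_def by (simp add: Let_def)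
qed

lemma irreducible_T: "finite_irreducible X T"
proof
  show "finite X" by (rule finite_X)
  show "T x y \<ge> 0" for x y using p0 p1 by (simp add: step_prob_def)
  fix x y assume xy: "x \<in> X" "y \<in> X"
  have eq: "{(a, b). a \<in> X \<and> b \<in> X \<and> bar_trans R D i N p a b > 0} = {(a, b). a \<in> X \<and> b \<in> X \<and> T a b > 0}"
    using bar_trans_eq by auto
  show "(x, y) \<in> {(a, b). a \<in> X \<and> b \<in> X \<and> T a b > 0}\<^sup>*"
    unfolding eq[symmetric] using irreducible xy unfolding bar_irreducible_def by blast
qed

lemma bar_stationary_iff: "bar_stationary R D i N p \<pi> \<longleftrightarrow> stationary X T \<pi>"
  unfolding bar_stationary_def stationary_def using bar_trans_eq by (simp cong: sum.cong)

abbreviation "\<zeta> \<equiv> zeta R D i N p"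

lemma zeta_ergodic:
  "stationary X T \<zeta>"
  "AE \<omega> in B. \<forall>x\<in>X. (\<lambda>n. (\<Sum>m<n. of_bool (bar \<omega> m = x \<and> \<omega> !! m)) / real n) \<longlonglongrightarrow> p * \<zeta> x"
proof -
  obtain \<pi> where \<pi>: "stationary X T \<pi>"
    and conv: "AE \<omega> in B. \<forall>x\<in>X. (\<lambda>n. (\<Sum>m<n. of_bool (bar \<omega> m = x \<and> \<omega> !! m)) / real n) \<longlonglongrightarrow> p * \<pi> x"
    using ergodic[OF irreducible_T start_X move_X stay_X] by blast
  have "\<zeta> = \<pi>" unfolding zeta_def bar_stationary_iff
    using \<pi> finite_irreducible.stationary_unique[OF irreducible_T _ \<pi>] by (intro the_equality)
  then show "stationary X T \<zeta>"
    "AE \<omega> in B. \<forall>x\<in>X. (\<lambda>n. (\<Sum>m<n. of_bool (bar \<omega> m = x \<and> \<omega> !! m)) / real n) \<longlonglongrightarrow> p * \<zeta> x"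
    using \<pi> conv by auto
qed

definition crossings :: "(('v \<Rightarrow> 'v) \<times> nat) set" where
  "crossings = {(w, k) \<in> X. i k = None \<and> w \<theta> \<in> Pos}"

lemma crossings_X: "crossings \<subseteq> X" and finite_crossings: "finite crossings"
  using finite_X finite_subset[of crossings X] unfolding crossings_def by auto

abbreviation "\<psi> \<equiv> psi R D i N p"

lemma psi_eq: "\<psi> = (\<Sum>x\<in>crossings. \<zeta> x *\<^sub>R fst x (coroot \<theta>))"
  unfolding psi_def crossings_def by (intro sum.cong) auto

text \<open>Each summand is a positive weight times a positive multiple of the positive root
  \<open>w \<theta>\<close>, on which \<open>z0\<close> is positive. The sum is nonempty because the
  ray uses the affine reflection, and \<open>id\<close> maps \<open>\<theta>\<close> to a positive
  root.\<close>

lemma psi_nonzero: "\<psi> \<noteq> 0"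
proof -
  have pos: "\<zeta> x * (z0 \<bullet> fst x (coroot \<theta>)) > 0" if x: "x \<in> crossings" for x
  proof -
    obtain w k where xw: "x = (w, k)" "w \<in> weyl R D" "w \<theta> \<in> Pos"
      using x unfolding crossings_def bar_states_def by auto
    have "w (coroot \<theta>) = (2 / (\<theta> \<bullet> \<theta>)) *\<^sub>R w \<theta>"
      unfolding coroot_def by (rule linear_scale[OF weyl_linear[OF xw(2)]])
    then have "z0 \<bullet> w (coroot \<theta>) > 0" using z0_Pos[OF xw(3)] nonzero_R[OF \<theta>_R] by simp
    moreover have "\<zeta> x > 0"
      using finite_irreducible.stationary_pos[OF irreducible_T zeta_ergodic(1)] x crossings_X by blast
    ultimately show ?thesis using xw by simp
  qed
  obtain j where j: "i j = None" using billiard_uses_None[OF generic seq] by blast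
  then have "i (j mod N) = None" using period_props(3)[OF generic seq] by simp
  then have ne: "(id, j mod N) \<in> crossings"
    unfolding crossings_def bar_states_def using weyl.intros(1)[of R D] N_pos \<theta>_Pos by auto
  have "z0 \<bullet> \<psi> = (\<Sum>x\<in>crossings. \<zeta> x * (z0 \<bullet> fst x (coroot \<theta>)))"
    unfolding psi_eq by (simp add: inner_sum_right)
  also have "\<dots> > 0" using pos ne finite_crossings by (intro sum_pos) auto
  finally show ?thesis by auto
qed

text \<open>Linear generators fix 0 and the affine one sends it to \<open>coroot \<theta>\<close>.
  The affine wall has inner normal \<open>- w \<theta>\<close>, so the crossing is permitted exactly
  at states in \<open>crossings\<close>, and then moves the vertex by
  \<open>w (coroot \<theta>)\<close>.\<close>

lemma hat_origin:
  "hat \<omega> M 0 = (\<Sum>x\<in>crossings. (\<Sum>m<M. of_bool (bar \<omega> m = x \<and> \<omega> !! m)) *\<^sub>R fst x (coroot \<theta>))"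
proof (induction M)
  case 0
  show ?case by simp
next
  case (Suc M)
  let ?v = "hat \<omega> M" and ?k = "M mod N"
  let ?x = "bar \<omega> M"
  have x: "?x = (lin_part ?v, ?k)" by (rule hat_bar)
  have xX: "?x \<in> X" unfolding x bar_states_def using lin_part_weyl[OF hat_affine] N_pos by auto
  have "(\<Sum>x\<in>crossings. (\<Sum>m<Suc M. of_bool (bar \<omega> m = x \<and> \<omega> !! m)) *\<^sub>R fst x (coroot \<theta>))
      = ?v 0 + (\<Sum>x\<in>crossings. of_bool (?x = x \<and> \<omega> !! M) *\<^sub>R fst x (coroot \<theta>))"
    unfolding Suc by (simp add: scaleR_left_distrib sum.distrib del: chain.simps)
  also have "(\<Sum>x\<in>crossings. of_bool (?x = x \<and> \<omega> !! M) *\<^sub>R fst x (coroot \<theta>))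
      = (\<Sum>x\<in>crossings. if ?x = x then of_bool (\<omega> !! M) *\<^sub>R fst ?x (coroot \<theta>) else 0)"
    by (intro sum.cong) auto
  also have "\<dots> = (if ?x \<in> crossings then of_bool (\<omega> !! M) *\<^sub>R fst ?x (coroot \<theta>) else 0)"
    using finite_crossings by (simp add: sum.delta')
  finally have sum: "(\<Sum>x\<in>crossings. (\<Sum>m<Suc M. of_bool (bar \<omega> m = x \<and> \<omega> !! m)) *\<^sub>R fst x (coroot \<theta>))
      = ?v 0 + (if ?x \<in> crossings then of_bool (\<omega> !! M) *\<^sub>R fst ?x (coroot \<theta>) else 0)" .
  have allowed: "hat_allowed R D ?v (i ?k) \<longleftrightarrow> descends (lin_part ?v) ?k"
    unfolding descends_def by (rule hat_allowed_iff[OF hat_dominant i_idx])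
  have "hat \<omega> (Suc M) 0 = ?v 0 + (if ?x \<in> crossings then of_bool (\<omega> !! M) *\<^sub>R fst ?x (coroot \<theta>) else 0)"
  proof (cases "i ?k")
    case None
    have "?x \<in> crossings \<longleftrightarrow> hat_allowed R D ?v (i ?k)"
      using xX None linear_neg[OF lin_part_linear[OF hat_affine]]
      unfolding allowed crossings_def descends_def x by (simp add: wall_root_def)
    moreover have "gen R D (i ?k) 0 = coroot \<theta>" using None by (simp add: gen_def aff_refl_def)
    ultimately show ?thesis unfolding hat_Suc using affine_eq[OF hat_affine, of \<omega> M "coroot \<theta>"] x by simp
  next
    case (Some a)
    then have "?x \<notin> crossings" unfolding crossings_def x by simp
    moreover have "gen R D (i ?k) 0 = 0" using Some by (simp add: gen_def aff_refl_def)
    ultimately show ?thesis unfolding hat_Suc by simp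
  qed
  then show ?case by (rule trans[OF _ sum[symmetric]])
qed

lemma unit_center_eq:
  assumes "u \<in> affine_weyl R D" shows "unit_center (alcove R D u) = sgn (u (center (fund_alcove R D)))"
  unfolding unit_center_def center_alcove[OF assms] ..

lemma hat_converges: "AE \<omega> in B. (\<lambda>M. unit_center (alcove R D (hat \<omega> M))) \<longlonglongrightarrow> sgn \<psi>"
  using zeta_ergodic(2)
proof (rule AE_mp, intro AE_I2 impI)
  fix \<omega>
  assume conv: "\<forall>x\<in>X. (\<lambda>n. (\<Sum>m<n. of_bool (bar \<omega> m = x \<and> \<omega> !! m)) / real n) \<longlonglongrightarrow> p * \<zeta> x"
  let ?c = "center (fund_alcove R D)"
  have "(\<lambda>M. \<Sum>x\<in>crossings. ((\<Sum>m<M. of_bool (bar \<omega> m = x \<and> \<omega> !! m)) / real M) *\<^sub>R fst x (coroot \<theta>))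
      \<longlonglongrightarrow> (\<Sum>x\<in>crossings. (p * \<zeta> x) *\<^sub>R fst x (coroot \<theta>))"
    using conv crossings_X by (intro tendsto_sum tendsto_scaleR tendsto_const) blast
  moreover have "(\<Sum>x\<in>crossings. ((\<Sum>m<M. of_bool (bar \<omega> m = x \<and> \<omega> !! m)) / real M) *\<^sub>R fst x (coroot \<theta>))
      = (1 / real M) *\<^sub>R hat \<omega> M 0" for M
    unfolding hat_origin by (simp add: scaleR_sum_right)
  moreover have "(\<Sum>x\<in>crossings. (p * \<zeta> x) *\<^sub>R fst x (coroot \<theta>)) = p *\<^sub>R \<psi>"
    unfolding psi_eq by (simp add: scaleR_sum_right)
  ultimately have 1: "(\<lambda>M. (1 / real M) *\<^sub>R hat \<omega> M 0) \<longlonglongrightarrow> p *\<^sub>R \<psi>" by simp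
  \<comment> \<open>The center differs from the vertex by a vector of constant norm, which vanishes
    after division by \<open>M\<close>.\<close>
  have 2: "(\<lambda>M. (1 / real M) *\<^sub>R lin_part (hat \<omega> M) ?c) \<longlonglongrightarrow> 0"
  proof (rule Lim_null_comparison)
    show "(\<lambda>M. (1 / real M) * norm ?c) \<longlonglongrightarrow> 0"
      using tendsto_mult_right[OF lim_1_over_n, of "norm ?c"] by simp
    have "norm (lin_part (hat \<omega> M) ?c) = norm ?c" for M
      using lin_part_inner[OF hat_affine] by (simp add: norm_eq_sqrt_inner)
    then show "\<forall>\<^sub>F M in sequentially. norm ((1 / real M) *\<^sub>R lin_part (hat \<omega> M) ?c) \<le> (1 / real M) * norm ?c"
      by simp
  qed
  have "(1 / real M) *\<^sub>R hat \<omega> M ?c = (1 / real M) *\<^sub>R lin_part (hat \<omega> M) ?c + (1 / real M) *\<^sub>R hat \<omega> M 0" for M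
    using affine_eq[OF hat_affine, of \<omega> M ?c] by (simp add: scaleR_right_distrib)
  then have "(\<lambda>M. (1 / real M) *\<^sub>R hat \<omega> M ?c) \<longlonglongrightarrow> p *\<^sub>R \<psi>" using tendsto_add[OF 2 1] by simp
  \<comment> \<open>\<open>sgn\<close> is continuous away from 0, hence the need for
    \<open>psi_nonzero\<close>; it also forgets the positive factors \<open>p\<close> and
    \<open>1 / real M\<close>.\<close>
  then have "(\<lambda>M. sgn ((1 / real M) *\<^sub>R hat \<omega> M ?c)) \<longlonglongrightarrow> sgn (p *\<^sub>R \<psi>)"
    by (rule tendsto_sgn) (use psi_nonzero p0 in simp)
  then have "(\<lambda>M. sgn ((1 / real M) *\<^sub>R hat \<omega> M ?c)) \<longlonglongrightarrow> sgn \<psi>" using p0 by (simp add: sgn_scaleR)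
  moreover have "\<forall>\<^sub>F M in sequentially. sgn ((1 / real M) *\<^sub>R hat \<omega> M ?c) = unit_center (alcove R D (hat \<omega> M))"
    using eventually_gt_at_top[of "0::nat"]
    by (rule eventually_mono) (simp add: sgn_scaleR unit_center_eq[OF hat_affine])
  ultimately show "(\<lambda>M. unit_center (alcove R D (hat \<omega> M))) \<longlonglongrightarrow> sgn \<psi>"
    by (rule Lim_transform_eventually)
qed

lemma tilde_folds: "\<exists>w\<in>weyl R D. \<exists>M0. \<forall>M\<ge>M0. tilde \<omega> M = w \<circ> hat \<omega> M"
proof -
  let ?n = "\<lambda>M. card (inversions (tilde \<omega> M))"
  \<comment> \<open>The folding elements are chosen along the trajectory so that each change of the
    element strictly increases the number of inversions. That number is bounded by
    \<open>card R\<close>, so it reaches a maximum, after which the element is constant.\<close>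
  have "\<exists>f. \<forall>M. (f M \<in> weyl R D \<and> tilde \<omega> M = f M \<circ> hat \<omega> M) \<and>
      (f (Suc M) = f M \<and> ?n M \<le> ?n (Suc M) \<or> ?n M < ?n (Suc M))"
  proof (rule dependent_nat_choice)
    show "\<exists>w. w \<in> weyl R D \<and> tilde \<omega> 0 = w \<circ> hat \<omega> 0"
      using weyl.intros(1)[of R D] by (intro exI[of _ id]) simp
    fix w M assume w: "w \<in> weyl R D \<and> tilde \<omega> M = w \<circ> hat \<omega> M"
    show "\<exists>w'. (w' \<in> weyl R D \<and> tilde \<omega> (Suc M) = w' \<circ> hat \<omega> (Suc M)) \<and>
        (w' = w \<and> ?n M \<le> ?n (Suc M) \<or> ?n M < ?n (Suc M))"
      using folded_step[OF hat_dominant _ i_idx _ hat_Suc tilde_Suc, of w \<omega> M] w by blast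
  qed
  then obtain f where f: "\<And>M. f M \<in> weyl R D" "\<And>M. tilde \<omega> M = f M \<circ> hat \<omega> M"
    and incr: "\<And>M. f (Suc M) = f M \<and> ?n M \<le> ?n (Suc M) \<or> ?n M < ?n (Suc M)" by blast
  have le: "?n M \<le> card R" for M
    using finite_R by (intro card_mono) (auto simp: inversions_def pos_roots_def)
  have "?n M \<le> ?n (Suc M)" for M using incr[of M] by auto
  then have mono: "?n a \<le> ?n b" if "a \<le> b" for a b using that by (rule lift_Suc_mono_le)
  have "finite (range ?n)" using le by (intro finite_subset[of "range ?n" "{..card R}"]) auto
  then have "Max (range ?n) \<in> range ?n" by (intro Max_in) auto
  then obtain M0 where "?n M0 = Max (range ?n)" by auto
  then have max: "?n M \<le> ?n M0" for M using \<open>finite (range ?n)\<close> by simp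
  have "f M = f M0" if "M \<ge> M0" for M
    using that
  proof (induction M rule: dec_induct)
    case (step M)
    then have "\<not> ?n M < ?n (Suc M)" using max[of "Suc M"] mono[of M0 M] by linarith
    then have "f (Suc M) = f M" using incr[of M] by blast
    then show ?case using step by simp
  qed simp
  then show ?thesis using f by metis
qed

text \<open>From some time on the two alcoves differ by a fixed linear isometry, which commutes with
  \<open>sgn\<close> and is continuous. The limit depends on the coins only through that
  isometry.\<close>

lemma tilde_converges: "AE \<omega> in B. \<exists>L. (\<lambda>M. unit_center (alcove R D (tilde \<omega> M))) \<longlonglongrightarrow> L
    \<and> L \<in> (\<lambda>w. w (sgn \<psi>)) ` weyl R D"
  using hat_converges
proof (rule AE_mp, intro AE_I2 impI)
  fix \<omega> assume lim: "(\<lambda>M. unit_center (alcove R D (hat \<omega> M))) \<longlonglongrightarrow> sgn \<psi>"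
  obtain w M0 where w: "w \<in> weyl R D" and M0: "\<And>M. M \<ge> M0 \<Longrightarrow> tilde \<omega> M = w \<circ> hat \<omega> M"
    using tilde_folds by blast
  have "bounded_linear w" using weyl_linear[OF w] by (simp add: linear_conv_bounded_linear)
  then have "(\<lambda>M. w (unit_center (alcove R D (hat \<omega> M)))) \<longlonglongrightarrow> w (sgn \<psi>)"
    using lim by (rule bounded_linear.tendsto)
  moreover have "\<forall>\<^sub>F M in sequentially. w (unit_center (alcove R D (hat \<omega> M))) = unit_center (alcove R D (tilde \<omega> M))"
    using eventually_ge_at_top[of M0]
  proof (rule eventually_mono)
    fix M assume "M0 \<le> M"
    then have t: "tilde \<omega> M = w \<circ> hat \<omega> M" by (rule M0)
    have "w \<circ> hat \<omega> M \<in> affine_weyl R D" by (rule affine_weyl_comp[OF hat_affine weyl_affine[OF w]])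
    then show "w (unit_center (alcove R D (hat \<omega> M))) = unit_center (alcove R D (tilde \<omega> M))"
      unfolding t using unit_center_eq[OF hat_affine] unit_center_eq weyl_sgn[OF w] by simp
  qed
  ultimately have "(\<lambda>M. unit_center (alcove R D (tilde \<omega> M))) \<longlonglongrightarrow> w (sgn \<psi>)"
    by (rule Lim_transform_eventually)
  then show "\<exists>L. (\<lambda>M. unit_center (alcove R D (tilde \<omega> M))) \<longlonglongrightarrow> L \<and> L \<in> (\<lambda>w. w (sgn \<psi>)) ` weyl R D"
    using w by blast
qed

end

theorem theorem1p2:
  fixes R D :: "'v::euclidean_space set" and z0 eta :: 'v and i :: "nat \<Rightarrow> 'v option" and p :: real
  assumes "root_system R" and "simple_system R D"
    and "z0 \<in> interior (fund_alcove R D)"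
    and "0 < p" and "p < 1"
    and "generic_dir R D z0 eta"
    and "billiard_seq R D z0 eta i"
    and "bar_irreducible R D i (period i) p"
  shows "(AE \<omega> in stream_space (measure_pmf (bernoulli_pmf p)).
           (\<lambda>M. unit_center (alcove R D (fst (hat_chain R D i (period i) \<omega> M))))
             \<longlonglongrightarrow> sgn (psi R D i (period i) p))
       \<and> (AE \<omega> in stream_space (measure_pmf (bernoulli_pmf p)).
           \<exists>L. (\<lambda>M. unit_center (alcove R D (fst (tilde_chain R D i (period i) \<omega> M)))) \<longlonglongrightarrow> L
             \<and> L \<in> (\<lambda>w. w (sgn (psi R D i (period i) p))) ` weyl R D)"
proof -
  interpret billiard R D z0 p eta i by unfold_locales (fact assms)+
  show ?thesis using hat_converges tilde_converges unfolding B_def by blast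
qed

end
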